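(* Let $Q$ be a quiver, with vertices $1,2,\ldots,n$, obtained from a Dynkin quiver of type $\Delta$ (a simply laced Dynkin diagram $A_n$, $D_n$, $E_6$, $E_7$ or $E_8$) by a finite sequence of mutations. Let $B_Q$ be the group with generators $s_1,s_2,\ldots,s_n$, subject to the relations: (a) $s_is_j=s_js_i$ if there is no arrow between $i$ and $j$ (in either direction); (b) $s_is_js_i=s_js_is_j$ if there is an arrow between $i$ and $j$ (in either direction); (c) whenever $i_1\to i_2\to\cdots\to i_r\to i_1$ is a chordless cycle in $Q$, $$s_{i_1}s_{i_2}\cdots s_{i_r}s_{i_1}\cdots s_{i_{r-2}}=s_{i_2}s_{i_3}\cdots s_{i_r}s_{i_1}\cdots s_{i_{r-1}}=\cdots=s_{i_r}s_{i_1}\cdots s_{i_r}s_{i_1}\cdots s_{i_{r-3}},$$ that is, all the $r$ words of length $2r-2$ obtained by reading consecutive generators cyclically along the cycle, starting at each of its vertices, are equal. Then $B_Q$ is isomorphic to the Artin braid group $B_\Delta$ of type $\Delta$.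
   Context: A quiver is a directed graph; all quivers have finitely many vertices and arrows and no loops or oriented $2$-cycles. The mutation $\mu_k(Q)$ of a quiver $Q$ at a vertex $k$ is the quiver on the same vertex set obtained by: (1) for each pair of arrows $i\to k\to j$ adding an arrow $i\to j$; (2) reversing all arrows incident with $k$; (3) removing a maximal set of $2$-cycles. A quiver is Dynkin (of type $\Delta$) if its underlying unoriented graph is a Dynkin diagram $\Delta$ of type $ADE$ ($A_n$ with $n\ge 1$, $D_n$ with $n\ge 4$, $E_6,E_7,E_8$). A cycle is chordless if the full subgraph on its vertices contains no edges other than those of the cycle. For such a $\Delta$ with vertex set $I$, the Artin braid group $B_\Delta$ is the group generated by $s_i$, $i\in I$, with relations $s_is_j=s_js_i$ if $i,j$ are not joined by an edge and $s_is_js_i=s_js_is_j$ if $i,j$ are joined by an edge. *)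

theory Defs
  imports "HOL-Algebra.Group"
begin

section \<open>Groups given by generators and relations\<close>

text \<open>
  A word over \<open>S\<close> is a list of pairs \<open>(x, b)\<close> with \<open>x \<in> S\<close>, where \<open>(x, True)\<close> stands for
  the generator \<open>x\<close> and \<open>(x, False)\<close> for its formal inverse. A pair \<open>(u, v) \<in> R\<close> is the
  relation \<open>u = v\<close>.
\<close>

type_synonym 'a word = "('a \<times> bool) list"

abbreviation words :: "'a set \<Rightarrow> 'a word set" where
  "words S \<equiv> lists (S \<times> UNIV)"

abbreviation pos_word :: "'a list \<Rightarrow> 'a word" where
  "pos_word xs \<equiv> map (\<lambda>x. (x, True)) xs"

inductive pres_eq :: "'a set \<Rightarrow> ('a word \<times> 'a word) set \<Rightarrow> 'a word \<Rightarrow> 'a word \<Rightarrow> bool"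
  for S R where
  pres_refl: "u \<in> words S \<Longrightarrow> pres_eq S R u u"
| pres_sym: "pres_eq S R u v \<Longrightarrow> pres_eq S R v u"
| pres_trans: "pres_eq S R u v \<Longrightarrow> pres_eq S R v w \<Longrightarrow> pres_eq S R u w"
| pres_cong: "pres_eq S R u u' \<Longrightarrow> pres_eq S R v v' \<Longrightarrow> pres_eq S R (u @ v) (u' @ v')"
| pres_cancel: "x \<in> S \<Longrightarrow> pres_eq S R [(x, b), (x, \<not> b)] []"
| pres_relator: "(u, v) \<in> R \<Longrightarrow> u \<in> words S \<Longrightarrow> v \<in> words S \<Longrightarrow> pres_eq S R u v"

definition pres_rel :: "'a set \<Rightarrow> ('a word \<times> 'a word) set \<Rightarrow> ('a word \<times> 'a word) set" where
  "pres_rel S R = {(u, v). pres_eq S R u v}"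

definition presented_group :: "'a set \<Rightarrow> ('a word \<times> 'a word) set \<Rightarrow> 'a word set monoid" where
  "presented_group S R =
     \<lparr>carrier = words S // pres_rel S R,
      mult = (\<lambda>A B. \<Union>u\<in>A. \<Union>v\<in>B. pres_rel S R `` {u @ v}),
      one = pres_rel S R `` {[]}\<rparr>"

lemma pres_eq_words: "pres_eq S R u v \<Longrightarrow> u \<in> words S \<and> v \<in> words S"
  by (induction rule: pres_eq.induct) auto

lemma equiv_pres_rel: "equiv (words S) (pres_rel S R)"
  by (rule equivI)
    (auto simp: pres_rel_def refl_on_def sym_def trans_def
      dest: pres_eq_words intro: pres_refl pres_sym pres_trans)

lemma pres_rel_class_eq:
  assumes "u \<in> words S" "v \<in> words S"
  shows "pres_rel S R `` {u} = pres_rel S R `` {v} \<longleftrightarrow> pres_eq S R u v"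
  using eq_equiv_class_iff[OF equiv_pres_rel assms] by (simp add: pres_rel_def)

lemma pres_mult_class:
  assumes "u \<in> words S" "v \<in> words S"
  shows "pres_rel S R `` {u} \<otimes>\<^bsub>presented_group S R\<^esub> pres_rel S R `` {v} = pres_rel S R `` {u @ v}"
proof -
  have "pres_rel S R `` {u' @ v'} = pres_rel S R `` {u @ v}"
    if "pres_eq S R u u'" "pres_eq S R v v'" for u' v'
  proof -
    have "pres_eq S R (u' @ v') (u @ v)" using that by (intro pres_sym[OF pres_cong])
    with pres_eq_words[OF this] show ?thesis by (simp only: pres_rel_class_eq)
  qed
  then have "(\<Union>u'\<in>pres_rel S R `` {u}. \<Union>v'\<in>pres_rel S R `` {v}. pres_rel S R `` {u' @ v'})
      = (\<Union>u'\<in>pres_rel S R `` {u}. \<Union>v'\<in>pres_rel S R `` {v}. pres_rel S R `` {u @ v})"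
    by (intro SUP_cong refl) (simp_all add: pres_rel_def)
  moreover have "u \<in> pres_rel S R `` {u}" "v \<in> pres_rel S R `` {v}"
    using assms by (auto simp: pres_rel_def intro: pres_refl)
  ultimately show ?thesis
    by (auto simp: presented_group_def)
qed

lemma pres_carrierE:
  assumes "A \<in> carrier (presented_group S R)"
  obtains u where "u \<in> words S" "A = pres_rel S R `` {u}"
  using assms by (auto simp: presented_group_def quotient_def)

lemma pres_class_carrier: "u \<in> words S \<Longrightarrow> pres_rel S R `` {u} \<in> carrier (presented_group S R)"
  by (simp add: presented_group_def quotientI)

lemma pres_one: "\<one>\<^bsub>presented_group S R\<^esub> = pres_rel S R `` {[]}"
  by (simp add: presented_group_def)

lemma pres_left_inverse:
  "u \<in> words S \<Longrightarrow> \<exists>v\<in>words S. pres_eq S R (v @ u) []"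
proof (induction u)
  case Nil
  then show ?case by (auto intro: pres_refl)
next
  case (Cons a u)
  obtain x b where a: "a = (x, b)" by force
  have x: "x \<in> S" and u: "u \<in> words S" using Cons.prems a by auto
  obtain v where v: "v \<in> words S" "pres_eq S R (v @ u) []" using Cons.IH u by blast
  have "pres_eq S R [(x, \<not> b), (x, b)] []" using pres_cancel[OF x, of R "\<not> b"] by simp
  then have "pres_eq S R (v @ [(x, \<not> b), (x, b)] @ u) (v @ [] @ u)"
    using u v by (intro pres_cong pres_refl)
  then have "pres_eq S R ((v @ [(x, \<not> b)]) @ a # u) []"
    using v(2) a by (auto intro: pres_trans)
  moreover have "v @ [(x, \<not> b)] \<in> words S" using v x by auto
  ultimately show ?case by blast
qed

lemma group_presented_group: "group (presented_group S R)"
proof (rule groupI)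
  let ?G = "presented_group S R"
  fix A B assume A: "A \<in> carrier ?G" and B: "B \<in> carrier ?G"
  from A obtain u where u: "u \<in> words S" "A = pres_rel S R `` {u}" by (rule pres_carrierE)
  from B obtain v where v: "v \<in> words S" "B = pres_rel S R `` {v}" by (rule pres_carrierE)
  show "A \<otimes>\<^bsub>?G\<^esub> B \<in> carrier ?G"
    unfolding u(2) v(2) pres_mult_class[OF u(1) v(1)]
    using u(1) v(1) by (intro pres_class_carrier) auto
  fix C assume C: "C \<in> carrier ?G"
  from C obtain w where w: "w \<in> words S" "C = pres_rel S R `` {w}" by (rule pres_carrierE)
  have "u @ v \<in> words S" "v @ w \<in> words S" using u v w by auto
  then show "A \<otimes>\<^bsub>?G\<^esub> B \<otimes>\<^bsub>?G\<^esub> C = A \<otimes>\<^bsub>?G\<^esub> (B \<otimes>\<^bsub>?G\<^esub> C)"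
    using u v w by (simp add: pres_mult_class del: append_in_lists_conv)
next
  let ?G = "presented_group S R"
  show "\<one>\<^bsub>?G\<^esub> \<in> carrier ?G" unfolding pres_one by (rule pres_class_carrier) simp
  fix A assume A: "A \<in> carrier ?G"
  then obtain u where u: "u \<in> words S" "A = pres_rel S R `` {u}" by (rule pres_carrierE)
  show "\<one>\<^bsub>?G\<^esub> \<otimes>\<^bsub>?G\<^esub> A = A" using u by (simp add: pres_one pres_mult_class)
  obtain v where v: "v \<in> words S" "pres_eq S R (v @ u) []" using pres_left_inverse u by blast
  have "pres_rel S R `` {v} \<otimes>\<^bsub>?G\<^esub> A = \<one>\<^bsub>?G\<^esub>"
    unfolding u(2) pres_mult_class[OF v(1) u(1)] pres_one
    using u v by (subst pres_rel_class_eq) auto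
  then show "\<exists>B\<in>carrier ?G. B \<otimes>\<^bsub>?G\<^esub> A = \<one>\<^bsub>?G\<^esub>" using v pres_class_carrier by blast
qed

definition word_eval :: "('g, 'm) monoid_scheme \<Rightarrow> ('a \<Rightarrow> 'g) \<Rightarrow> 'a word \<Rightarrow> 'g" where
  "word_eval G f w = foldr (\<lambda>(x, b) g. (if b then f x else inv\<^bsub>G\<^esub> (f x)) \<otimes>\<^bsub>G\<^esub> g) w \<one>\<^bsub>G\<^esub>"

lemma word_eval_carrier:
  assumes "group G" "f \<in> S \<rightarrow> carrier G" "w \<in> words S"
  shows "word_eval G f w \<in> carrier G"
proof -
  interpret group G by fact
  show ?thesis using assms(3)
  proof (induction w)
    case (Cons a w)
    obtain x b where a: "a = (x, b)" by force
    have "f x \<in> carrier G" using Cons.hyps a assms(2) by (auto dest: funcset_mem)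
    then show ?case using Cons a by (simp add: word_eval_def)
  qed (simp add: word_eval_def)
qed

lemma word_eval_append:
  assumes "group G" "f \<in> S \<rightarrow> carrier G" "u \<in> words S" "v \<in> words S"
  shows "word_eval G f (u @ v) = word_eval G f u \<otimes>\<^bsub>G\<^esub> word_eval G f v"
proof -
  interpret group G by fact
  note c = word_eval_carrier[OF assms(1,2)]
  show ?thesis using assms(3)
  proof (induction u)
    case Nil
    then show ?case using c[OF assms(4)] by (simp add: word_eval_def)
  next
    case (Cons a u)
    obtain x b where a: "a = (x, b)" by force
    have "f x \<in> carrier G" using Cons.hyps a assms(2) by (auto dest: funcset_mem)
    moreover have "u \<in> words S" using Cons.hyps by simp
    ultimately show ?case
      using Cons.IH c[of u] c[OF assms(4)] a by (simp add: word_eval_def m_assoc)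
  qed
qed

text \<open>The universal property.\<close>

lemma presented_group_hom:
  assumes "group G" "f \<in> S \<rightarrow> carrier G"
    and R: "\<And>u v. (u, v) \<in> R \<Longrightarrow> u \<in> words S \<Longrightarrow> v \<in> words S \<Longrightarrow> word_eval G f u = word_eval G f v"
  shows "\<exists>h\<in>hom (presented_group S R) G. \<forall>w\<in>words S. h (pres_rel S R `` {w}) = word_eval G f w"
proof -
  interpret group G by fact
  have eq: "word_eval G f u = word_eval G f v" if "pres_eq S R u v" for u v
    using that
  proof (induction rule: pres_eq.induct)
    case (pres_cong u u' v v')
    then show ?case
      using pres_eq_words[OF pres_cong(1)] pres_eq_words[OF pres_cong(2)]
      by (simp add: word_eval_append[OF assms(1,2)])
  next
    case (pres_cancel x b)
    then have "f x \<in> carrier G" using assms(2) by (auto dest: funcset_mem)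
    then show ?case by (cases b) (simp_all add: word_eval_def)
  qed (simp_all add: R)
  define h where "h A = word_eval G f (SOME u. u \<in> A)" for A
  have h: "h (pres_rel S R `` {w}) = word_eval G f w" if "w \<in> words S" for w
  proof -
    have "w \<in> pres_rel S R `` {w}" using that by (auto simp: pres_rel_def intro: pres_refl)
    then have "(SOME u. u \<in> pres_rel S R `` {w}) \<in> pres_rel S R `` {w}" by (rule someI)
    then show ?thesis unfolding h_def by (auto simp: pres_rel_def dest: eq)
  qed
  have "h \<in> hom (presented_group S R) G"
  proof (rule homI)
    fix A assume "A \<in> carrier (presented_group S R)"
    then obtain u where u: "u \<in> words S" "A = pres_rel S R `` {u}" by (rule pres_carrierE)
    then show "h A \<in> carrier G" by (simp only: h word_eval_carrier[OF assms(1,2)])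
    fix B assume "B \<in> carrier (presented_group S R)"
    then obtain v where v: "v \<in> words S" "B = pres_rel S R `` {v}" by (rule pres_carrierE)
    have uv: "u @ v \<in> words S" using u v by auto
    show "h (A \<otimes>\<^bsub>presented_group S R\<^esub> B) = h A \<otimes>\<^bsub>G\<^esub> h B"
      unfolding u(2) v(2) pres_mult_class[OF u(1) v(1)] h[OF uv] h[OF u(1)] h[OF v(1)]
      by (rule word_eval_append[OF assms(1,2) u(1) v(1)])
  qed
  with h show ?thesis by blast
qed

section \<open>Quivers and mutation\<close>

text \<open>
  A quiver is given by its vertices and the number \<open>arr Q i j\<close> of arrows \<open>i \<rightarrow> j\<close>;
  parallel arrows are not distinguished.
\<close>

record 'v quiver =
  verts :: "'v set"
  arr :: "'v \<Rightarrow> 'v \<Rightarrow> nat"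

definition is_quiver :: "'v quiver \<Rightarrow> bool" where
  "is_quiver Q \<longleftrightarrow>
     finite (verts Q) \<and>
     (\<forall>i j. arr Q i j \<noteq> 0 \<longrightarrow> i \<in> verts Q \<and> j \<in> verts Q) \<and>
     (\<forall>i. arr Q i i = 0) \<and>
     (\<forall>i j. arr Q i j = 0 \<or> arr Q j i = 0)"

definition add_paths :: "'v \<Rightarrow> 'v quiver \<Rightarrow> 'v quiver" where
  "add_paths k Q = Q\<lparr>arr := (\<lambda>i j. arr Q i j + arr Q i k * arr Q k j)\<rparr>"

definition reverse_at :: "'v \<Rightarrow> 'v quiver \<Rightarrow> 'v quiver" where
  "reverse_at k Q = Q\<lparr>arr := (\<lambda>i j. if i = k \<or> j = k then arr Q j i else arr Q i j)\<rparr>"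

text \<open>
  A maximal set of 2-cycles between \<open>i\<close> and \<open>j\<close> uses \<open>min (arr Q i j) (arr Q j i)\<close> arrows in
  each direction, so that the truncated difference of the two numbers is what remains.
\<close>

definition cancel_two_cycles :: "'v quiver \<Rightarrow> 'v quiver" where
  "cancel_two_cycles Q = Q\<lparr>arr := (\<lambda>i j. arr Q i j - arr Q j i)\<rparr>"

definition mutate :: "'v \<Rightarrow> 'v quiver \<Rightarrow> 'v quiver" where
  "mutate k Q = cancel_two_cycles (reverse_at k (add_paths k Q))"

lemma verts_mutate [simp]: "verts (mutate k Q) = verts Q"
  by (simp add: mutate_def cancel_two_cycles_def reverse_at_def add_paths_def)

lemma is_quiver_mutate:
  assumes "is_quiver Q"
  shows "is_quiver (mutate k Q)"
proof -
  have supp: "i \<in> verts Q \<and> j \<in> verts Q" if "arr Q i j \<noteq> 0" for i j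
    using assms that by (auto simp: is_quiver_def)
  have "i \<in> verts Q \<and> j \<in> verts Q" if "arr (mutate k Q) i j \<noteq> 0" for i j
  proof -
    have "arr Q i j \<noteq> 0 \<or> arr Q j i \<noteq> 0 \<or> (arr Q i k \<noteq> 0 \<and> arr Q k j \<noteq> 0)"
    proof (rule ccontr)
      assume "\<not> ?thesis"
      then have "arr (mutate k Q) i j = 0"
        by (auto simp: mutate_def cancel_two_cycles_def reverse_at_def add_paths_def)
      with that show False by simp
    qed
    then show ?thesis using supp by blast
  qed
  moreover have "finite (verts Q)" using assms by (simp add: is_quiver_def)
  ultimately show ?thesis
    by (auto simp: is_quiver_def) (auto simp: mutate_def cancel_two_cycles_def)
qed

definition adjacent :: "'v quiver \<Rightarrow> 'v \<Rightarrow> 'v \<Rightarrow> bool" where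
  "adjacent Q i j \<longleftrightarrow> arr Q i j \<noteq> 0 \<or> arr Q j i \<noteq> 0"

text \<open>
  The list \<open>[i\<^sub>1, \<dots>, i\<^sub>r]\<close> is a chordless (oriented) cycle \<open>i\<^sub>1 \<rightarrow> \<dots> \<rightarrow> i\<^sub>r \<rightarrow> i\<^sub>1\<close> if the arrows
  of the full subquiver on these vertices are exactly the \<open>r\<close> arrows of the cycle.
\<close>

definition chordless_cycle :: "'v quiver \<Rightarrow> 'v list \<Rightarrow> bool" where
  "chordless_cycle Q c \<longleftrightarrow>
     length c \<ge> 3 \<and> distinct c \<and> set c \<subseteq> verts Q \<and>
     (\<forall>p<length c. \<forall>q<length c.
        arr Q (c ! p) (c ! q) = (if q = Suc p mod length c then 1 else 0))"

section \<open>The braid group of a quiver\<close>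

definition cycle_word :: "'v list \<Rightarrow> nat \<Rightarrow> 'v list" where
  "cycle_word c p = map (\<lambda>t. c ! ((p + t) mod length c)) [0..<2 * length c - 2]"

definition quiver_relations :: "'v quiver \<Rightarrow> ('v word \<times> 'v word) set" where
  "quiver_relations Q =
     {(pos_word [i, j], pos_word [j, i]) | i j.
        i \<in> verts Q \<and> j \<in> verts Q \<and> \<not> adjacent Q i j} \<union>
     {(pos_word [i, j, i], pos_word [j, i, j]) | i j.
        i \<in> verts Q \<and> j \<in> verts Q \<and> adjacent Q i j} \<union>
     {(pos_word (cycle_word c p), pos_word (cycle_word c q)) | c p q.
        chordless_cycle Q c \<and> p < length c \<and> q < length c}"

definition quiver_braid_group :: "'v quiver \<Rightarrow> 'v word set monoid" where
  "quiver_braid_group Q = presented_group (verts Q) (quiver_relations Q)"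

section \<open>Dynkin diagrams and Artin braid groups\<close>

datatype dynkin_type = Dynkin_A nat | Dynkin_D nat | Dynkin_E nat

fun is_dynkin_type :: "dynkin_type \<Rightarrow> bool" where
  "is_dynkin_type (Dynkin_A m) \<longleftrightarrow> m \<ge> 1"
| "is_dynkin_type (Dynkin_D m) \<longleftrightarrow> m \<ge> 4"
| "is_dynkin_type (Dynkin_E m) \<longleftrightarrow> m \<in> {6, 7, 8}"

fun dynkin_rank :: "dynkin_type \<Rightarrow> nat" where
  "dynkin_rank (Dynkin_A m) = m"
| "dynkin_rank (Dynkin_D m) = m"
| "dynkin_rank (Dynkin_E m) = m"

definition dynkin_verts :: "dynkin_type \<Rightarrow> nat set" where
  "dynkin_verts T = {1..dynkin_rank T}"

text \<open>
  Bourbaki's numbering of the vertices: \<open>A\<^sub>m\<close> is the path \<open>1, \<dots>, m\<close>; \<open>D\<^sub>m\<close> is the path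
  \<open>1, \<dots>, m - 1\<close> with \<open>m\<close> joined to \<open>m - 2\<close>; \<open>E\<^sub>m\<close> is the path \<open>1, 3, 4, \<dots>, m\<close> with \<open>2\<close>
  joined to \<open>4\<close>.
\<close>

fun dynkin_edges :: "dynkin_type \<Rightarrow> nat set set" where
  "dynkin_edges (Dynkin_A m) = {{i, i + 1} | i. 1 \<le> i \<and> i + 1 \<le> m}"
| "dynkin_edges (Dynkin_D m) = {{i, i + 1} | i. 1 \<le> i \<and> i + 1 \<le> m - 1} \<union> {{m - 2, m}}"
| "dynkin_edges (Dynkin_E m) = {{1, 3}, {2, 4}} \<union> {{i, i + 1} | i. 3 \<le> i \<and> i + 1 \<le> m}"

text \<open>The underlying graph is required to be isomorphic to the standard diagram, so the vertices
  of a Dynkin quiver may be labelled in any way.\<close>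

definition dynkin_quiver :: "dynkin_type \<Rightarrow> 'v quiver \<Rightarrow> bool" where
  "dynkin_quiver T Q \<longleftrightarrow>
     is_quiver Q \<and>
     (\<exists>f. bij_betw f (verts Q) (dynkin_verts T) \<and>
        (\<forall>i\<in>verts Q. \<forall>j\<in>verts Q.
           arr Q i j + arr Q j i = (if {f i, f j} \<in> dynkin_edges T then 1 else 0)))"

definition artin_relations :: "'v set \<Rightarrow> 'v set set \<Rightarrow> ('v word \<times> 'v word) set" where
  "artin_relations V E =
     {(pos_word [i, j], pos_word [j, i]) | i j. i \<in> V \<and> j \<in> V \<and> {i, j} \<notin> E} \<union>
     {(pos_word [i, j, i], pos_word [j, i, j]) | i j. i \<in> V \<and> j \<in> V \<and> {i, j} \<in> E}"

definition artin_braid_group :: "'v set \<Rightarrow> 'v set set \<Rightarrow> 'v word set monoid" where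
  "artin_braid_group V E = presented_group V (artin_relations V E)"

end

theory Submission
  imports Defs Complex_Main
begin

text \<open>
  Call a quiver of finite type if its chordless unoriented cycles are oriented and there is a positive
  definite integral form with diagonal entries \<open>2\<close> whose off-diagonal entries are, up to sign, the
  numbers of arrows (a positive quasi-Cartan companion in the sense of Barot, Geiss and Zelevinsky).
  Dynkin quivers have this property, and mutation at \<open>k\<close> preserves it: the form changes by
  reflections in the basis vector of \<open>k\<close>, and positivity forces a vertex outside a mutated cycle to
  have at most two neighbours on it, which are then adjacent. Hence mutation only leaves a chordless
  cycle alone, inserts \<open>k\<close> into it, removes \<open>k\<close> from it, or turns a path \<open>a \<rightarrow> k \<rightarrow> b\<close> into a triangle.

  The cycle relation for \<open>i\<^sub>1, \<dots>, i\<^sub>r\<close> is equivalent to \<open>s\<^bsub>i\<^sub>1\<^esub>\<close> commuting with the conjugate of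
  \<open>s\<^bsub>i\<^sub>r\<^esub>\<close> by \<open>s\<^bsub>i\<^sub>2\<^esub> \<cdots> s\<^bsub>i\<^sub>r\<^sub>-\<^sub>1\<^esub>\<close>. In this form it is easily seen that replacing \<open>s\<^sub>i\<close> by
  \<open>s\<^sub>k\<^sup>-\<^sup>1 s\<^sub>i s\<^sub>k\<close> for all arrows \<open>i \<rightarrow> k\<close> turns the relations of a quiver into those of its mutation,
  so that the braid groups of the two quivers map to each other, inversely up to conjugation.
\<close>

section \<open>Braid relations in a group\<close>

context group
begin

text \<open>No presentation is ever rewritten. A homomorphism out of a presented group is a family
  of elements satisfying the relations, so mutation is treated as an operation on families in an
  arbitrary group; words occur only where the two descriptions are compared. Mutation at a fixed
  vertex is an involution, hence a single computation yields both homomorphisms.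

  What keeps this computation short is that one commutation per oriented cycle stands for all
  equalities between its words: the braid relations along the rest of the cycle carry it from one
  starting vertex to any other.

  The companion serves a global purpose. A cycle of the mutated quiver could a priori contain many
  neighbours of \<open>k\<close>, and it is the sign rule for cycles of a positive form that
  excludes this. For Dynkin diagrams the companion is the Cartan matrix; its positivity is obtained
  by completing squares from the leaves towards a root, where the bounds \<open>d - 1 / c\<close>
  and \<open>(l + 1) / l\<close> come from.\<close>

definition commutes :: "'a \<Rightarrow> 'a \<Rightarrow> bool" where
  "commutes x y \<longleftrightarrow> x \<otimes> y = y \<otimes> x"

definition braids :: "'a \<Rightarrow> 'a \<Rightarrow> bool" where
  "braids x y \<longleftrightarrow> x \<otimes> y \<otimes> x = y \<otimes> x \<otimes> y"

definition conjug :: "'a \<Rightarrow> 'a \<Rightarrow> 'a" where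
  "conjug g x = g \<otimes> x \<otimes> inv g"

primrec lprod :: "'a list \<Rightarrow> 'a" where
  "lprod [] = \<one>"
| "lprod (x # xs) = x \<otimes> lprod xs"

text \<open>The last entry conjugated by the product of the entries before it, see
  \<open>cchain_snoc\<close>. The nested form exposes the first entry, where inductions along a path
  and the cancellation of a conjugation take place.\<close>

primrec cchain :: "'a list \<Rightarrow> 'a" where
  "cchain [] = \<one>"
| "cchain (x # xs) = (if xs = [] then x else conjug x (cchain xs))"

text \<open>In the presence of the other relations this says that the words around the cycle starting at
  its first two vertices are equal, see \<open>cyc_iff_words_eq\<close>.\<close>

primrec cyc :: "'a list \<Rightarrow> bool" where
  "cyc [] \<longleftrightarrow> True"
| "cyc (x # xs) \<longleftrightarrow> commutes x (cchain xs)"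

text \<open>The relations of the Artin group of a path (type A), imposed on the entries of a list in
  their order.\<close>

primrec braid_path :: "'a list \<Rightarrow> bool" where
  "braid_path [] \<longleftrightarrow> True"
| "braid_path (x # xs) \<longleftrightarrow>
     braid_path xs \<and> (xs \<noteq> [] \<longrightarrow> braids x (hd xs) \<and> (\<forall>z\<in>set (tl xs). commutes x z))"

lemma conjug_closed [simp, intro]:
  "g \<in> carrier G \<Longrightarrow> x \<in> carrier G \<Longrightarrow> conjug g x \<in> carrier G"
  by (simp add: conjug_def)

lemma lprod_closed [simp, intro]: "set xs \<subseteq> carrier G \<Longrightarrow> lprod xs \<in> carrier G"
  by (induction xs) auto

lemma cchain_closed [simp, intro]: "set xs \<subseteq> carrier G \<Longrightarrow> cchain xs \<in> carrier G"
  by (induction xs) auto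

lemma lprod_append:
  "set xs \<subseteq> carrier G \<Longrightarrow> set ys \<subseteq> carrier G \<Longrightarrow> lprod (xs @ ys) = lprod xs \<otimes> lprod ys"
  by (induction xs) (auto simp: m_assoc)

lemma conjug_mult:
  assumes "g \<in> carrier G" "x \<in> carrier G" "y \<in> carrier G"
  shows "conjug g (x \<otimes> y) = conjug g x \<otimes> conjug g y"
proof -
  have "inv g \<otimes> (g \<otimes> (y \<otimes> inv g)) = y \<otimes> inv g"
    using assms by (simp add: m_assoc[symmetric])
  then show ?thesis using assms by (simp add: conjug_def m_assoc)
qed

lemma conjug_conjug:
  "g \<in> carrier G \<Longrightarrow> h \<in> carrier G \<Longrightarrow> x \<in> carrier G \<Longrightarrow> conjug g (conjug h x) = conjug (g \<otimes> h) x"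
  by (simp add: conjug_def m_assoc inv_mult_group)

lemma conjug_inv_cancel [simp]:
  "g \<in> carrier G \<Longrightarrow> x \<in> carrier G \<Longrightarrow> conjug (inv g) (conjug g x) = x"
  "g \<in> carrier G \<Longrightarrow> x \<in> carrier G \<Longrightarrow> conjug g (conjug (inv g) x) = x"
  by (simp_all only: conjug_conjug inv_closed l_inv r_inv) (simp_all add: conjug_def)

lemma conjug_inject:
  assumes "g \<in> carrier G" "x \<in> carrier G" "y \<in> carrier G"
  shows "conjug g x = conjug g y \<longleftrightarrow> x = y"
  using assms by (metis conjug_inv_cancel(1))

lemma conjug_swap:
  assumes "g \<in> carrier G" "x \<in> carrier G" "y \<in> carrier G"
  shows "conjug (inv g) x = y \<longleftrightarrow> x = conjug g y"
  using assms by (metis conjug_inv_cancel)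

lemma commutes_sym: "commutes x y \<longleftrightarrow> commutes y x"
  by (auto simp: commutes_def)

lemma braids_sym: "braids x y \<longleftrightarrow> braids y x"
  by (auto simp: braids_def)

lemma commutes_iff_conjug:
  assumes "g \<in> carrier G" "x \<in> carrier G"
  shows "commutes g x \<longleftrightarrow> conjug g x = x"
  using assms unfolding commutes_def conjug_def by (metis inv_solve_right m_closed)

lemma commutes_mult:
  "x \<in> carrier G \<Longrightarrow> y \<in> carrier G \<Longrightarrow> z \<in> carrier G \<Longrightarrow> commutes x y \<Longrightarrow> commutes x z \<Longrightarrow>
    commutes x (y \<otimes> z)"
  unfolding commutes_def by (metis m_assoc)

lemma commutes_lprod:
  "x \<in> carrier G \<Longrightarrow> set ys \<subseteq> carrier G \<Longrightarrow> \<forall>y\<in>set ys. commutes x y \<Longrightarrow> commutes x (lprod ys)"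
  by (induction ys) (auto intro: commutes_mult simp: commutes_def[of x \<one>])

lemma commutes_inv:
  "x \<in> carrier G \<Longrightarrow> y \<in> carrier G \<Longrightarrow> commutes x y \<Longrightarrow> commutes x (inv y)"
  unfolding commutes_def by (metis inv_solve_left inv_solve_right m_assoc inv_closed m_closed)

lemma commutes_conjug:
  assumes "g \<in> carrier G" "x \<in> carrier G" "y \<in> carrier G"
  shows "commutes (conjug g x) (conjug g y) \<longleftrightarrow> commutes x y"
  unfolding commutes_def using assms by (simp add: conjug_mult[symmetric] conjug_inject)

lemma braids_conjug:
  assumes "g \<in> carrier G" "x \<in> carrier G" "y \<in> carrier G"
  shows "braids (conjug g x) (conjug g y) \<longleftrightarrow> braids x y"
  unfolding braids_def using assms by (simp add: conjug_mult[symmetric] conjug_inject)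

text \<open>The braid relation says that conjugating \<open>conjug x y\<close> by \<open>y\<close>
  gives \<open>x\<close>. In this form it exchanges a conjugation by one element for an inverse
  conjugation by the other.\<close>

lemma braids_conjug_inv:
  assumes "x \<in> carrier G" "y \<in> carrier G" "braids x y"
  shows "conjug x y = conjug (inv y) x"
proof -
  have "conjug y (conjug x y) = x"
  proof -
    have "y \<otimes> x \<otimes> y \<otimes> inv x = x \<otimes> y"
      using assms unfolding braids_def by (metis inv_solve_right m_closed)
    then have "conjug y (conjug x y) = x \<otimes> y \<otimes> inv y"
      using assms by (simp add: conjug_def m_assoc)
    then show ?thesis using assms by (simp add: m_assoc)
  qed
  then show ?thesis using assms by (metis conjug_swap conjug_closed)
qed

lemma cchain_conjug:
  "g \<in> carrier G \<Longrightarrow> set xs \<subseteq> carrier G \<Longrightarrow> xs \<noteq> [] \<Longrightarrow>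
    cchain (map (conjug g) xs) = conjug g (cchain xs)"
proof (induction xs)
  case (Cons x xs)
  have "conjug (conjug g x) (conjug g y) = conjug g (conjug x y)" if "y \<in> carrier G" for y
  proof -
    have "conjug g (inv x) = inv (conjug g x)"
      using Cons.prems by (simp add: conjug_def inv_mult_group m_assoc)
    then show ?thesis
      using Cons.prems that by (simp add: conjug_def[of "conjug g x"] conjug_def[of x] conjug_mult)
  qed
  then show ?case using Cons by auto
qed simp

lemma cyc_conjug:
  "g \<in> carrier G \<Longrightarrow> set xs \<subseteq> carrier G \<Longrightarrow> length xs \<ge> 2 \<Longrightarrow> cyc (map (conjug g) xs) \<longleftrightarrow> cyc xs"
proof (cases xs)
  case (Cons x ys)
  assume "g \<in> carrier G" "set xs \<subseteq> carrier G" "length xs \<ge> 2"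
  moreover from this Cons have "ys \<noteq> []" by auto
  ultimately show ?thesis using Cons by (simp add: cchain_conjug commutes_conjug cchain_closed)
qed simp

lemma cchain_snoc:
  "set (xs @ [y]) \<subseteq> carrier G \<Longrightarrow> cchain (xs @ [y]) = conjug (lprod xs) y"
  by (induction xs) (simp_all add: conjug_conjug, simp add: conjug_def)

text \<open>The same element is reached from either end of a path: \<open>braids_conjug_inv\<close>
  exchanges the two ends of the first edge, and \<open>y\<close> commutes with everything beyond its
  neighbour.\<close>

lemma cchain_braid_path:
  "braid_path (y # zs) \<Longrightarrow> set (y # zs) \<subseteq> carrier G \<Longrightarrow>
    cchain (y # zs) = conjug (inv (lprod zs)) y"
proof (induction zs arbitrary: y)
  case (Cons u us)
  let ?p = "lprod us"
  have c: "y \<in> carrier G" "u \<in> carrier G" "?p \<in> carrier G" using Cons.prems by auto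
  have "commutes y ?p" using Cons.prems by (intro commutes_lprod) auto
  then have yp: "y \<otimes> inv ?p = inv ?p \<otimes> y"
    using commutes_inv c by (simp add: commutes_def)
  have "cchain (y # u # us) = conjug y (conjug (inv ?p) u)"
    using Cons by simp
  also have "\<dots> = conjug (inv ?p) (conjug y u)"
    using c yp by (simp add: conjug_conjug)
  also have "conjug y u = conjug (inv u) y"
    using Cons.prems c by (simp add: braids_conjug_inv)
  also have "conjug (inv ?p) (conjug (inv u) y) = conjug (inv (u \<otimes> ?p)) y"
    using c by (simp add: conjug_conjug inv_mult_group)
  finally show ?case by simp
qed (simp add: conjug_def)

text \<open>By \<open>cchain_braid_path\<close> the chain of \<open>ys\<close> is its first entry
  conjugated by the inverse of the product of the others. Moving this conjugation over to
  \<open>x\<close> produces the chain of the rotated list.\<close>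

lemma cyc_rotate:
  assumes "braid_path ys" "set (x # ys) \<subseteq> carrier G" "ys \<noteq> []" "cyc (x # ys)"
  shows "cyc (ys @ [x])"
proof (cases ys)
  case (Cons y zs)
  let ?p = "lprod zs"
  have c: "x \<in> carrier G" "y \<in> carrier G" "?p \<in> carrier G" using assms Cons by auto
  have "commutes x (conjug (inv ?p) y)"
    using cchain_braid_path[of y zs] assms Cons by simp
  then have "commutes (conjug ?p x) y"
    using c commutes_conjug[of ?p x "conjug (inv ?p) y"] by simp
  moreover have "cchain (zs @ [x]) = conjug ?p x"
    using assms Cons by (intro cchain_snoc) auto
  ultimately show ?thesis using Cons c by (simp add: commutes_sym)
qed (use assms in simp)

text \<open>In type \<open>A\<close>, conjugation by the Coxeter element \<open>lprod ys\<close> shifts the generators.\<close>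

lemma coxeter_shift:
  "braid_path ys \<Longrightarrow> set ys \<subseteq> carrier G \<Longrightarrow>
    lprod ys \<otimes> lprod (butlast ys) = lprod (tl ys) \<otimes> lprod ys"
proof (induction ys)
  case (Cons x ys)
  show ?case
  proof (cases ys)
    case ys: (Cons y zs)
    let ?z = "lprod zs" and ?p = "lprod ys" and ?q = "lprod (butlast ys)"
    have q: "?q \<in> carrier G" using Cons.prems by (auto dest: in_set_butlastD)
    have c: "x \<in> carrier G" "y \<in> carrier G" "?z \<in> carrier G" "?p \<in> carrier G"
      using Cons.prems ys by auto
    have p: "?p = y \<otimes> ?z" using ys by simp
    have xz: "x \<otimes> ?z = ?z \<otimes> x"
      using commutes_lprod[of x zs] Cons.prems ys by (auto simp: commutes_def)
    have xy: "x \<otimes> y \<otimes> x = y \<otimes> x \<otimes> y"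
      using Cons.prems ys by (simp add: braids_def)
    have IH: "?p \<otimes> ?q = ?z \<otimes> ?p"
      using Cons.IH Cons.prems ys by auto
    have "x \<otimes> ?p \<otimes> (x \<otimes> ?q) = x \<otimes> y \<otimes> (?z \<otimes> x) \<otimes> ?q"
      using c q by (simp add: p m_assoc)
    also have "\<dots> = (x \<otimes> y \<otimes> x) \<otimes> ?z \<otimes> ?q"
      using c q by (simp add: m_assoc xz[symmetric])
    also have "\<dots> = y \<otimes> x \<otimes> (?p \<otimes> ?q)"
      using c q by (simp add: xy p m_assoc)
    also have "\<dots> = y \<otimes> (x \<otimes> ?z) \<otimes> ?p"
      using c by (simp add: IH m_assoc)
    also have "\<dots> = ?p \<otimes> (x \<otimes> ?p)"
      using c by (simp only: xz p) (simp add: m_assoc)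
    finally show ?thesis using ys by simp
  qed (use Cons in simp)
qed simp

text \<open>With u the conjugate of r by the product of w, and t the product of w, x and
  \<open>butlast w\<close>, the first word is x u t, and \<open>coxeter_shift\<close> for
  \<open>x # w\<close> turns the second into u x t. Cancelling t leaves the commutation of x with u,
  which is the chain of \<open>w @ [r]\<close>.\<close>

lemma cyc_iff_words_eq:
  assumes "braid_path (x # w)" "set (x # w @ [r]) \<subseteq> carrier G" "w \<noteq> []"
  shows "cyc (x # w @ [r]) \<longleftrightarrow>
    lprod ((x # w @ [r]) @ x # butlast w) = lprod ((w @ [r, x]) @ w)"
proof -
  let ?w = "lprod w" and ?q = "lprod (butlast w)"
  have q: "set (butlast w) \<subseteq> carrier G" using assms by (auto dest: in_set_butlastD)
  have c: "x \<in> carrier G" "?w \<in> carrier G" "r \<in> carrier G" "?q \<in> carrier G"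
    using assms q by auto
  have sh: "x \<otimes> ?w \<otimes> (x \<otimes> ?q) = ?w \<otimes> (x \<otimes> ?w)"
    using coxeter_shift[of "x # w"] assms by simp
  let ?u = "conjug ?w r" and ?t = "?w \<otimes> (x \<otimes> ?q)"
  have u: "?u \<otimes> ?w = ?w \<otimes> r" using c by (simp add: conjug_def m_assoc)
  have uc: "?u \<in> carrier G" "?t \<in> carrier G" using c by auto
  have "lprod ((x # w @ [r]) @ x # butlast w) = x \<otimes> (?w \<otimes> r) \<otimes> (x \<otimes> ?q)"
    using assms q c by (simp add: lprod_append m_assoc)
  also have "\<dots> = x \<otimes> ?u \<otimes> ?t"
    using c uc by (simp only: u[symmetric]) (simp add: m_assoc)
  finally have 1: "lprod ((x # w @ [r]) @ x # butlast w) = x \<otimes> ?u \<otimes> ?t" .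
  have "lprod ((w @ [r, x]) @ w) = (?w \<otimes> r) \<otimes> (x \<otimes> ?w)"
    using assms q c by (simp add: lprod_append m_assoc)
  also have "\<dots> = ?u \<otimes> (?w \<otimes> (x \<otimes> ?w))"
    using c uc by (simp only: u[symmetric]) (simp add: m_assoc)
  also have "\<dots> = ?u \<otimes> x \<otimes> ?t"
    using c uc by (simp only: sh[symmetric]) (simp add: m_assoc)
  finally have 2: "lprod ((w @ [r, x]) @ w) = ?u \<otimes> x \<otimes> ?t" .
  have "cchain (w @ [r]) = ?u" using assms by (intro cchain_snoc) auto
  then have "cyc (x # w @ [r]) \<longleftrightarrow> x \<otimes> ?u = ?u \<otimes> x" by (simp add: commutes_def)
  then show ?thesis using 1 2 c uc by simp
qed

end

section \<open>Induced paths and cycles\<close>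

definition adj :: "('v \<Rightarrow> 'v \<Rightarrow> bool) \<Rightarrow> 'v \<Rightarrow> 'v \<Rightarrow> bool" where
  "adj E i j \<longleftrightarrow> E i j \<or> E j i"

lemma adj_sym: "adj E i j \<longleftrightarrow> adj E j i"
  by (auto simp: adj_def)

lemma symp_adj: "symp (adj E)"
  by (auto simp: adj_def symp_def)

text \<open>\<open>R\<close> is tested only from earlier to later entries, so this is the usual
  notion when \<open>R\<close> is symmetric; the same holds for \<open>induced_cycle\<close>.
  Orientation is recorded separately by \<open>cyclic\<close>.\<close>

primrec induced_path :: "('v \<Rightarrow> 'v \<Rightarrow> bool) \<Rightarrow> 'v list \<Rightarrow> bool" where
  "induced_path R [] \<longleftrightarrow> True"
| "induced_path R (x # ys) \<longleftrightarrow>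
     induced_path R ys \<and> x \<notin> set ys \<and> (\<forall>z\<in>set ys. R x z \<longleftrightarrow> z = hd ys)"

fun induced_cycle :: "('v \<Rightarrow> 'v \<Rightarrow> bool) \<Rightarrow> 'v list \<Rightarrow> bool" where
  "induced_cycle R [] \<longleftrightarrow> False"
| "induced_cycle R (x # ys) \<longleftrightarrow>
     induced_path R ys \<and> length ys \<ge> 2 \<and> x \<notin> set ys \<and>
     (\<forall>z\<in>set ys. R x z \<longleftrightarrow> z = hd ys \<or> z = last ys)"

lemma induced_path_distinct: "induced_path R xs \<Longrightarrow> distinct xs"
  by (induction xs) auto

lemma induced_cycle_distinct: "induced_cycle R c \<Longrightarrow> distinct c"
  by (cases c) (auto dest: induced_path_distinct)

lemma induced_cycle_length: "induced_cycle R c \<Longrightarrow> length c \<ge> 3"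
  by (cases c) auto

lemma induced_path_append:
  "induced_path R (xs @ ys) \<longleftrightarrow>
    induced_path R xs \<and> induced_path R ys \<and> set xs \<inter> set ys = {} \<and>
    (\<forall>x\<in>set xs. \<forall>y\<in>set ys. R x y \<longleftrightarrow> x = last xs \<and> y = hd ys)"
proof (induction xs)
  case (Cons x xs)
  show ?case
  proof (cases "xs = []")
    case False
    then have "hd (xs @ ys) = hd xs" "last (x # xs) = last xs" by auto
    moreover have "hd xs \<notin> set ys" if "set xs \<inter> set ys = {}"
      using that False hd_in_set[of xs] by blast
    ultimately show ?thesis using Cons False by auto
  qed auto
qed simp

lemma induced_path_rev: "symp R \<Longrightarrow> induced_path R (rev xs) \<longleftrightarrow> induced_path R xs"
  by (induction xs) (auto simp: induced_path_append last_rev symp_def)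

lemma induced_path_cong:
  "(\<And>x y. x \<in> set xs \<Longrightarrow> y \<in> set xs \<Longrightarrow> R x y \<longleftrightarrow> R' x y) \<Longrightarrow>
    induced_path R xs \<longleftrightarrow> induced_path R' xs"
  by (induction xs) auto

lemma induced_cycle_cong:
  assumes "\<And>x y. x \<in> set c \<Longrightarrow> y \<in> set c \<Longrightarrow> R x y \<longleftrightarrow> R' x y"
  shows "induced_cycle R c \<longleftrightarrow> induced_cycle R' c"
proof (cases c)
  case (Cons x ys)
  then show ?thesis using assms induced_path_cong[of ys R R'] by auto
qed simp

lemma induced_cycle_rotate1:
  assumes "symp R" "induced_cycle R (x # ys)"
  shows "induced_cycle R (ys @ [x])"
proof (cases ys)
  case (Cons y zs)
  with assms have zs: "zs \<noteq> []" by auto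
  then have "last zs \<in> set zs" "hd zs \<in> set zs" by auto
  moreover have "hd zs \<noteq> y \<and> last zs \<noteq> y" using assms Cons calculation by auto
  ultimately show ?thesis
    using assms Cons zs by (auto simp: induced_path_append symp_def)
qed (use assms in simp)

lemma induced_cycle_rotate:
  "symp R \<Longrightarrow> induced_cycle R c \<Longrightarrow> induced_cycle R (rotate n c)"
proof (induction n)
  case (Suc n)
  then obtain x ys where "rotate n c = x # ys" by (cases "rotate n c") auto
  then show ?case using Suc induced_cycle_rotate1[of R x ys] by simp
qed simp

lemma induced_cycle_rev:
  assumes "symp R" "induced_cycle R c"
  shows "induced_cycle R (rev c)"
proof -
  obtain x ys where c: "c = x # ys" using assms by (cases c) auto
  then have "ys \<noteq> []" using assms by auto
  then have "induced_cycle R (x # rev ys)"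
    using assms c by (auto simp: induced_path_rev hd_rev last_rev)
  then show ?thesis using induced_cycle_rotate1[OF assms(1), of x "rev ys"] c by simp
qed

definition cyclic :: "('v \<Rightarrow> 'v \<Rightarrow> bool) \<Rightarrow> 'v list \<Rightarrow> bool" where
  "cyclic E c \<longleftrightarrow> successively E c \<and> E (last c) (hd c)"

lemma cyclic_rotate1: "ys \<noteq> [] \<Longrightarrow> cyclic E (ys @ [x]) \<longleftrightarrow> cyclic E (x # ys)"
  by (auto simp: cyclic_def successively_append_iff successively_Cons)

lemma cyclic_rotate: "length c \<ge> 2 \<Longrightarrow> cyclic E (rotate n c) \<longleftrightarrow> cyclic E c"
proof (induction n)
  case (Suc n)
  then have "length (rotate n c) \<ge> 2" by simp
  then obtain x ys where "rotate n c = x # ys" "ys \<noteq> []"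
    by (cases "rotate n c" rule: remdups_adj.cases) auto
  then show ?case using Suc by (simp add: cyclic_rotate1)
qed simp

lemma cyclic_rev: "c \<noteq> [] \<Longrightarrow> cyclic E (rev c) \<longleftrightarrow> cyclic (\<lambda>x y. E y x) c"
  by (simp add: cyclic_def hd_rev last_rev)

lemma cyclic_cong:
  "c \<noteq> [] \<Longrightarrow> (\<And>x y. x \<in> set c \<Longrightarrow> y \<in> set c \<Longrightarrow> E x y \<longleftrightarrow> E' x y) \<Longrightarrow>
    cyclic E c \<longleftrightarrow> cyclic E' c"
  unfolding cyclic_def by (intro conj_cong successively_cong) auto

lemma rotate_to_head:
  assumes "x \<in> set c"
  obtains n ys where "rotate n c = x # ys"
proof -
  obtain us vs where "c = us @ x # vs" using assms by (meson split_list)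
  then have "rotate (length us) c = x # vs @ us" by (simp add: rotate_append)
  then show ?thesis using that by blast
qed

section \<open>Positive companions\<close>

text \<open>The ring is general because companions are integral, while positivity for Dynkin
  diagrams is proved over the reals, where completing a square requires division.\<close>

definition form :: "'v set \<Rightarrow> ('v \<Rightarrow> 'v \<Rightarrow> 'r) \<Rightarrow> ('v \<Rightarrow> 'r) \<Rightarrow> 'r::comm_ring_1" where
  "form V A x = (\<Sum>i\<in>V. \<Sum>j\<in>V. A i j * x i * x j)"

text \<open>The off-diagonal signs stay free, since reflections change them. Integer vectors suffice
  as test vectors: positivity is applied only to integral combinations of basis vectors.\<close>

definition companion :: "'v set \<Rightarrow> ('v \<Rightarrow> 'v \<Rightarrow> bool) \<Rightarrow> ('v \<Rightarrow> 'v \<Rightarrow> int) \<Rightarrow> bool" where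
  "companion V R A \<longleftrightarrow>
     (\<forall>i j. A i j = A j i) \<and> (\<forall>i\<in>V. A i i = 2) \<and>
     (\<forall>i j. i \<noteq> j \<longrightarrow> \<bar>A i j\<bar> = (if R i j then 1 else 0)) \<and>
     (\<forall>x. (\<exists>i\<in>V. x i \<noteq> 0) \<longrightarrow> form V A x > 0)"

text \<open>With the minus sign, a Cartan matrix gives 1 along every path of its diagram. For a
  closed walk along edges the value -1 means that an odd number of edges carry a positive
  entry.\<close>

primrec edge_prod :: "('v \<Rightarrow> 'v \<Rightarrow> int) \<Rightarrow> 'v list \<Rightarrow> int" where
  "edge_prod A [] = 1"
| "edge_prod A (x # ys) = (if ys = [] then 1 else - A x (hd ys) * edge_prod A ys)"

lemma edge_prod_append:
  "edge_prod A (xs @ y # zs) = edge_prod A (xs @ [y]) * edge_prod A (y # zs)"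
proof (induction xs)
  case (Cons x xs)
  have "hd (xs @ y # zs) = hd (xs @ [y])" by (cases xs) auto
  then show ?case using Cons by simp
qed simp

lemma form_add_delta:
  assumes "finite V" "v \<in> V" "\<And>i j. A i j = A j i"
  shows "form V A (\<lambda>i. u i + (if i = v then c else 0)) =
    form V A u + 2 * c * (\<Sum>j\<in>V. A v j * u j) + c\<^sup>2 * A v v"
proof -
  let ?d = "\<lambda>i. if i = v then c else 0"
  have 1: "A i j * (u i + ?d i) * (u j + ?d j) =
      A i j * u i * u j + A i j * u i * ?d j + A i j * ?d i * u j + A i j * ?d i * ?d j" for i j
    by (simp add: algebra_simps)
  have d: "(\<Sum>j\<in>V. f j * ?d j) = f v * c" for f
  proof -
    have "(\<Sum>j\<in>V. f j * ?d j) = (\<Sum>j\<in>V. if j = v then f j * c else 0)"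
      by (intro sum.cong) auto
    then show ?thesis using assms by simp
  qed
  have 2: "(\<Sum>i\<in>V. \<Sum>j\<in>V. A i j * u i * ?d j) = c * (\<Sum>j\<in>V. A v j * u j)"
  proof -
    have "(\<Sum>i\<in>V. \<Sum>j\<in>V. A i j * u i * ?d j) = (\<Sum>i\<in>V. A i v * u i * c)"
      by (simp only: d)
    then show ?thesis by (simp add: assms(3)[of v] sum_distrib_left algebra_simps)
  qed
  have 3: "(\<Sum>i\<in>V. \<Sum>j\<in>V. A i j * ?d i * u j) = c * (\<Sum>j\<in>V. A v j * u j)"
  proof -
    have "(\<Sum>i\<in>V. \<Sum>j\<in>V. A i j * ?d i * u j) = (\<Sum>j\<in>V. \<Sum>i\<in>V. A j i * u j * ?d i)"
      by (subst sum.swap, intro sum.cong refl, subst assms(3)) (simp only: mult_ac)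
    then show ?thesis by (simp only: 2)
  qed
  have 4: "(\<Sum>i\<in>V. \<Sum>j\<in>V. A i j * ?d i * ?d j) = c\<^sup>2 * A v v"
  proof -
    have "(\<Sum>i\<in>V. \<Sum>j\<in>V. A i j * ?d i * ?d j) = (\<Sum>i\<in>V. A i v * ?d i * c)"
      by (simp only: d)
    also have "\<dots> = (\<Sum>i\<in>V. (A i v * c) * ?d i)"
      by (intro sum.cong refl) (simp only: mult_ac)
    also have "\<dots> = A v v * c * c" by (simp only: d)
    finally show ?thesis by (simp add: power2_eq_square algebra_simps)
  qed
  show ?thesis
    unfolding form_def 1 sum.distrib 2 3 4 by (simp add: algebra_simps)
qed

lemma companion_square:
  assumes "companion V R A" "i \<noteq> j"
  shows "A i j * A i j = (if R i j then 1 else 0)"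
proof -
  have "\<bar>A i j\<bar> = (if R i j then 1 else 0)" using assms by (auto simp: companion_def)
  then have "A i j = 0 \<and> \<not> R i j \<or> A i j = 1 \<and> R i j \<or> A i j = -1 \<and> R i j"
    by (auto split: if_splits)
  then show ?thesis by auto
qed

lemma companion_pos: "companion V R A \<Longrightarrow> i \<in> V \<Longrightarrow> x i \<noteq> 0 \<Longrightarrow> form V A x > 0"
  by (auto simp: companion_def)

lemma companion_zero:
  assumes "companion V R A" "i \<noteq> j" "\<not> R i j"
  shows "A i j = 0"
  using companion_square[OF assms(1,2)] assms(3) by simp

lemma sum_supported:
  assumes "finite V" "set ys \<subseteq> V" "x \<notin> set ys" "\<And>i. i \<notin> set ys \<Longrightarrow> u i = 0"
    "companion V R A" "S \<subseteq> set ys" "\<forall>z\<in>set ys. R x z \<longrightarrow> z \<in> S"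
  shows "(\<Sum>j\<in>V. A x j * u j) = (\<Sum>j\<in>S. A x j * u j)"
proof -
  have "A x j * u j = 0" if "j \<notin> S" for j
    using assms that companion_zero[of V R A x j] by (cases "j \<in> set ys") auto
  then show ?thesis using assms by (intro sum.mono_neutral_right) auto
qed

text \<open>A root of the form supported on the path, with coefficients \<plusminus>1. Prepending
  \<open>x\<close> rescales the old root by the sign that makes its pairing with \<open>x\<close>
  equal to -1, so that the new value is 2 - 2 + 2.\<close>

lemma path_root:
  assumes "finite V" "companion V R A"
  shows "induced_path R ys \<Longrightarrow> ys \<noteq> [] \<Longrightarrow> set ys \<subseteq> V \<Longrightarrow>
    \<exists>u. (\<forall>i. i \<notin> set ys \<longrightarrow> u i = 0) \<and> u (hd ys) = 1 \<and> u (last ys) = edge_prod A ys \<and>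
      form V A u = 2"
proof (induction ys)
  case (Cons x ys)
  have A: "\<And>i j. A i j = A j i" "A x x = 2" using assms Cons.prems by (auto simp: companion_def)
  have zero: "form V A (\<lambda>i. 0) = 0" by (simp add: form_def)
  show ?case
  proof (cases "ys = []")
    case True
    have "form V A (\<lambda>i. 0 + (if i = x then 1 else 0)) = 2"
      using Cons.prems by (subst form_add_delta) (simp_all add: assms A zero)
    then have "form V A (\<lambda>i. if i = x then 1 else 0) = 2" by simp
    with True show ?thesis by (intro exI[of _ "\<lambda>i. if i = x then 1 else 0"]) auto
  next
    case False
    then obtain u where u: "\<forall>i. i \<notin> set ys \<longrightarrow> u i = 0" "u (hd ys) = 1"
      "u (last ys) = edge_prod A ys" "form V A u = 2"
      using Cons by auto
    let ?s = "- A x (hd ys)"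
    let ?u = "\<lambda>i. ?s * u i + (if i = x then 1 else 0)"
    have hd: "hd ys \<in> set ys" "last ys \<in> set ys" using False by auto
    then have ne: "x \<noteq> hd ys" "x \<noteq> last ys" using Cons.prems by auto
    have R: "R x (hd ys)" using Cons.prems hd by auto
    have s2: "?s * ?s = 1" using companion_square[OF assms(2) ne(1)] R by simp
    have "(\<Sum>j\<in>V. A x j * u j) = (\<Sum>j\<in>{hd ys}. A x j * u j)"
      using Cons.prems u hd by (intro sum_supported[OF assms(1) _ _ _ assms(2)]) auto
    moreover have "(\<Sum>j\<in>V. A x j * (?s * u j)) = ?s * (\<Sum>j\<in>V. A x j * u j)"
      unfolding sum_distrib_left by (intro sum.cong) auto
    ultimately have sum: "(\<Sum>j\<in>V. A x j * (?s * u j)) = ?s * A x (hd ys)"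
      using u by simp
    have sc: "form V A (\<lambda>i. ?s * u i) = ?s * ?s * form V A u"
      by (simp add: form_def sum_distrib_left algebra_simps)
    have "form V A ?u = form V A (\<lambda>i. ?s * u i) + 2 * 1 * (\<Sum>j\<in>V. A x j * (?s * u j)) + 1\<^sup>2 * A x x"
      using Cons.prems by (intro form_add_delta assms A) auto
    also have "\<dots> = 2" unfolding sc sum using s2 A u by (simp add: algebra_simps)
    finally have f: "form V A ?u = 2" .
    have "u x = 0" using u Cons.prems by auto
    then show ?thesis using f u False ne Cons.prems
      by (intro exI[of _ ?u]) auto
  qed
qed simp

lemma edge_prod_induced_path:
  assumes "companion V R A"
  shows "induced_path R ys \<Longrightarrow> edge_prod A ys = 1 \<or> edge_prod A ys = -1"
proof (induction ys)
  case (Cons x ys)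
  show ?case
  proof (cases "ys = []")
    case False
    then have "hd ys \<in> set ys" by simp
    then have "x \<noteq> hd ys" "R x (hd ys)" using Cons.prems False by auto
    then have "A x (hd ys) * A x (hd ys) = 1" using companion_square[OF assms] by simp
    then have "A x (hd ys) = 1 \<or> A x (hd ys) = -1" by algebra
    then show ?thesis using Cons by auto
  qed simp
qed simp

text \<open>Otherwise the cycle would carry an isotropic vector, as for affine type \<open>A\<close>.\<close>

lemma edge_prod_induced_cycle:
  assumes "finite V" "companion V R A" "induced_cycle R (x # ys)" "set (x # ys) \<subseteq> V"
  shows "edge_prod A (x # ys @ [x]) = -1"
proof -
  have ys: "ys \<noteq> []" "induced_path R ys" using assms by auto
  then obtain u where u: "\<forall>i. i \<notin> set ys \<longrightarrow> u i = 0" "u (hd ys) = 1"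
      "u (last ys) = edge_prod A ys" "form V A u = 2"
    using path_root[OF assms(1,2)] assms(4) by (metis insert_subset list.simps(15))
  let ?h = "hd ys" and ?l = "last ys" and ?p = "edge_prod A ys"
  have mem: "?h \<in> set ys" "?l \<in> set ys" using ys by auto
  then have ne: "x \<noteq> ?h" "x \<noteq> ?l" "R x ?h" "R x ?l" using assms by auto
  have hl: "?h \<noteq> ?l"
  proof -
    obtain y zs where "ys = y # zs" "zs \<noteq> []"
      using assms(3) by (cases ys rule: remdups_adj.cases) auto
    then show ?thesis using induced_path_distinct[OF ys(2)] last_in_set[of zs] by auto
  qed
  have A: "\<And>i j. A i j = A j i" "A x x = 2" using assms by (auto simp: companion_def)
  \<comment> \<open>The sign makes the first vertex pair with \<open>x\<close> to -1, as in
    \<open>path_root\<close>. The additional edge from \<open>x\<close> to \<open>?l\<close> then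
    shifts the value of the form from 2 to 0 or 4, and positivity rules out 0.\<close>
  let ?s = "- A x ?h"
  let ?u = "\<lambda>i. ?s * u i + (if i = x then 1 else 0)"
  have s2: "?s * ?s = 1" using companion_square[OF assms(2) ne(1)] ne by simp
  have "(\<Sum>j\<in>V. A x j * u j) = (\<Sum>j\<in>{?h, ?l}. A x j * u j)"
    using assms u mem by (intro sum_supported[OF assms(1) _ _ _ assms(2)]) auto
  moreover have "(\<Sum>j\<in>V. A x j * (?s * u j)) = ?s * (\<Sum>j\<in>V. A x j * u j)"
    unfolding sum_distrib_left by (intro sum.cong) auto
  ultimately have sum: "(\<Sum>j\<in>V. A x j * (?s * u j)) = ?s * (A x ?h + A x ?l * ?p)"
    using u hl by simp
  have sc: "form V A (\<lambda>i. ?s * u i) = ?s * ?s * form V A u"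
    by (simp add: form_def sum_distrib_left algebra_simps)
  have "form V A ?u = form V A (\<lambda>i. ?s * u i) + 2 * 1 * (\<Sum>j\<in>V. A x j * (?s * u j)) + 1\<^sup>2 * A x x"
    using assms by (intro form_add_delta A) auto
  also have "\<dots> = 2 - 2 * (A x ?h * A x ?l * ?p)"
    unfolding sc sum using s2 A u by (simp add: algebra_simps)
  finally have f: "form V A ?u = 2 - 2 * (A x ?h * A x ?l * ?p)" .
  have "u x = 0" using u assms by auto
  then have "?u x \<noteq> 0" by simp
  then have "form V A ?u > 0" using companion_pos[OF assms(2), of x] assms(4) by auto
  then have lt: "A x ?h * A x ?l * ?p < 1" using f by simp
  have "A x ?l * A x ?l = 1" using companion_square[OF assms(2) ne(2)] ne by simp
  then have l: "A x ?l = 1 \<or> A x ?l = -1" by algebra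
  have h: "A x ?h = 1 \<or> A x ?h = -1" using s2 by algebra
  have p: "?p = 1 \<or> ?p = -1" using edge_prod_induced_path[OF assms(2) ys(2)] .
  have "edge_prod A (ys @ [x]) = ?p * - A ?l x"
  proof -
    have bl: "butlast ys @ ?l # [x] = ys @ [x]"
      using append_butlast_last_id[OF ys(1)] by (metis append.assoc append_Cons append_Nil)
    show ?thesis using edge_prod_append[of A "butlast ys" ?l "[x]"] ys unfolding bl by simp
  qed
  then have "edge_prod A (x # ys @ [x]) = A x ?h * A x ?l * ?p"
    using ys A(1)[of ?l x] by simp
  then show ?thesis using lt l h p by auto
qed

section \<open>Mutation of quivers of finite type\<close>

locale finite_type =
  fixes V :: "'v set" and E :: "'v \<Rightarrow> 'v \<Rightarrow> bool"
  assumes finite_V: "finite V"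
    and arrow_V: "E i j \<Longrightarrow> i \<in> V \<and> j \<in> V"
    and arrow_asym: "E i j \<Longrightarrow> \<not> E j i"
    and ex_companion: "\<exists>A. companion V (adj E) A"
    and cycle_oriented: "induced_cycle (adj E) c \<Longrightarrow> cyclic E c \<or> cyclic E (rev c)"

text \<open>Mutation when there is at most one arrow between two vertices. The composite arrow of
  \<open>i\<close>, \<open>k\<close>, \<open>j\<close> either is new or cancels an arrow from
  \<open>j\<close> to \<open>i\<close>. In finite type it never doubles an old arrow, because a
  non-oriented triangle is excluded by \<open>triangle\<close>.\<close>

definition mut :: "'v \<Rightarrow> ('v \<Rightarrow> 'v \<Rightarrow> bool) \<Rightarrow> 'v \<Rightarrow> 'v \<Rightarrow> bool" where
  "mut k E i j =
    (if i = k \<or> j = k then E j i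
     else if E i k \<and> E k j then \<not> E j i
     else if E j k \<and> E k i then False
     else E i j)"

context finite_type
begin

lemma not_arrow_refl: "\<not> E i i"
  using arrow_asym by blast

lemma adj_irrefl: "\<not> adj E i i"
  using not_arrow_refl by (simp add: adj_def)

lemma triangle: "E i k \<Longrightarrow> E k j \<Longrightarrow> \<not> E i j"
proof
  assume "E i k" "E k j" "E i j"
  then have "induced_cycle (adj E) [i, k, j]" "\<not> cyclic E [i, k, j] \<and> \<not> cyclic E (rev [i, k, j])"
    using not_arrow_refl arrow_asym by (auto simp: adj_def cyclic_def)
  then show False using cycle_oriented by blast
qed

lemma mut_k: "mut k E k j \<longleftrightarrow> E j k" "mut k E i k \<longleftrightarrow> E k i"
  by (simp_all add: mut_def)

lemma mut_through:
  assumes "E i k" "E k j"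
  shows "mut k E i j \<longleftrightarrow> \<not> E j i" "\<not> mut k E j i"
proof -
  have "i \<noteq> k" "j \<noteq> k" "\<not> E k i" "\<not> E j k" using assms not_arrow_refl arrow_asym by auto
  then show "mut k E i j \<longleftrightarrow> \<not> E j i" "\<not> mut k E j i" using assms by (simp_all add: mut_def)
qed

lemma mut_unchanged:
  assumes "i \<noteq> k" "j \<noteq> k" "\<not> (E i k \<and> E k j)" "\<not> (E j k \<and> E k i)"
  shows "mut k E i j \<longleftrightarrow> E i j"
  using assms by (auto simp: mut_def)

lemma mut_cases:
  obtains "i = k" | "j = k" | "E i k" "E k j" | "E j k" "E k i"
    | "i \<noteq> k" "j \<noteq> k" "\<not> (E i k \<and> E k j)" "\<not> (E j k \<and> E k i)"
  by blast

text \<open>Through this, \<open>braid_family_mut\<close> applied to the mutated quiver leads back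
  to the original one and provides the homomorphism in the other direction.\<close>

lemma mut_mut: "mut k (mut k E) = E"
proof (intro ext)
  fix i j
  show "mut k (mut k E) i j = E i j"
  proof (cases rule: mut_cases[where i = i and j = j and k = k])
    case 3
    then have "i \<noteq> k" "j \<noteq> k" "\<not> E k i" "\<not> E j k" "\<not> E i j"
      using not_arrow_refl arrow_asym triangle by blast+
    with 3 show ?thesis by (simp add: mut_def[of k "mut k E"] mut_k)
  next
    case 4
    then have "i \<noteq> k" "j \<noteq> k" "\<not> E i k" "\<not> E k j"
      using not_arrow_refl arrow_asym by blast+
    with 4 show ?thesis by (simp add: mut_def[of k "mut k E"] mut_k mut_through)
  next
    case 5
    then show ?thesis by (auto simp: mut_def[of k "mut k E"] mut_k mut_unchanged)
  qed (simp_all add: mut_def)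
qed

lemma mut_asym:
  assumes "mut k E i j"
  shows "\<not> mut k E j i"
proof (cases rule: mut_cases[where i = i and j = j and k = k])
  case 5
  with assms show ?thesis using arrow_asym[of i j] by (simp add: mut_unchanged)
next
  case 4
  then show ?thesis using mut_through[of j k i] assms by blast
qed (use assms arrow_asym[of j i] in \<open>simp_all add: mut_k mut_through\<close>)

lemma mut_arrow_V: "mut k E i j \<Longrightarrow> i \<in> V \<and> j \<in> V"
  using arrow_V by (auto simp: mut_def split: if_splits)

lemma adj_mut_k: "adj (mut k E) k z \<longleftrightarrow> adj E k z" "adj (mut k E) z k \<longleftrightarrow> adj E z k"
  by (auto simp: adj_def mut_def)

lemma adj_mut_unchanged:
  assumes "i \<noteq> k" "j \<noteq> k" "\<not> (E i k \<and> E k j)" "\<not> (E j k \<and> E k i)"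
  shows "adj (mut k E) i j \<longleftrightarrow> adj E i j"
  using mut_unchanged[OF assms] mut_unchanged[OF assms(2,1,4,3)] by (auto simp: adj_def)

lemma adj_mut_through:
  assumes "E a k" "E k b"
  shows "adj (mut k E) a b \<longleftrightarrow> \<not> E b a" "adj (mut k E) a b \<longleftrightarrow> mut k E a b"
  using mut_through[OF assms] by (auto simp: adj_def)

text \<open>The new companion is the Gram matrix obtained by reflecting the basis vectors with an arrow
  to \<open>k\<close> in the basis vector of \<open>k\<close>.\<close>

lemma companion_mut:
  assumes "k \<in> V"
  shows "\<exists>A. companion V (adj (mut k E)) A"
proof -
  obtain A where A: "companion V (adj E) A" using ex_companion by blast
  have sym: "A i j = A j i" for i j using A by (simp add: companion_def)
  have Akk: "A k k = 2" using A assms by (simp add: companion_def)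
  \<comment> \<open>The basis vector of \<open>i\<close> is replaced by itself minus
    \<open>e i\<close> times that of \<open>k\<close>. Since \<open>A k k = 2\<close>, this is the
    reflection when there is an arrow from \<open>i\<close> to \<open>k\<close>, and no change
    otherwise.\<close>
  define e where "e i = (if E i k then A i k else 0)" for i
  define B where "B i j = A i j - e i * A k j - e j * A i k + 2 * e i * e j" for i j
  have Bsym: "B i j = B j i" for i j
    by (simp add: B_def sym[of i j] sym[of k j] sym[of i k] algebra_simps)
  have sq: "A i j * A i j = (if adj E i j then 1 else 0)" if "i \<noteq> j" for i j
    using companion_square[OF A that] .
  have abs: "\<bar>A i j\<bar> = (if adj E i j then 1 else 0)" if "i \<noteq> j" for i j
    using A that by (simp add: companion_def)
  have ek: "e k = 0" using not_arrow_refl by (simp add: e_def)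
  have Bii: "B i i = 2" if "i \<in> V" for i
  proof -
    have "A i i = 2" using A that by (simp add: companion_def)
    then show ?thesis by (simp add: B_def e_def sym[of k i])
  qed
  have through: "\<bar>B i j\<bar> = (if adj (mut k E) i j then 1 else 0)" if ij: "E i k" "E k j" for i j
  proof -
    have ne: "i \<noteq> k" "j \<noteq> k" "i \<noteq> j" using ij not_arrow_refl arrow_asym by auto
    have ej: "e j = 0" using ij arrow_asym by (auto simp: e_def)
    have B: "B i j = A i j - A i k * A k j" using ij ej by (simp add: B_def e_def)
    have "A i k * A i k = 1" "A k j * A k j = 1"
      using sq ne ij by (auto simp: adj_def)
    then have ik: "A i k = 1 \<or> A i k = -1" and kj: "A k j = 1 \<or> A k j = -1" by algebra+
    show ?thesis
    proof (cases "E j i")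
      case True
      then have cyc: "induced_cycle (adj E) [i, k, j]" using ij ne by (auto simp: adj_def)
      have "set [i, k, j] \<subseteq> V" using ij arrow_V by auto
      \<comment> \<open>The sign rule for the oriented triangle makes the two terms of
        \<open>B i j\<close> equal, so the entry vanishes exactly where the composite arrow cancels
        the old one.\<close>
      then have "edge_prod A (i # [k, j] @ [i]) = -1"
        using edge_prod_induced_cycle[OF finite_V A, of i "[k, j]"] cyc by simp
      then have "A i k * A k j * A j i = 1" by (simp add: algebra_simps)
      then have "A i j = A i k * A k j" using ik kj by (auto simp: sym[of i j])
      then show ?thesis using B True adj_mut_through[OF ij] by simp
    next
      case False
      then have "\<not> adj E i j" using triangle[OF ij] by (simp add: adj_def)
      then have "A i j = 0" using companion_zero[OF A ne(3)] by simp
      then show ?thesis using B False adj_mut_through[OF ij] ik kj by auto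
    qed
  qed
  have Babs: "\<bar>B i j\<bar> = (if adj (mut k E) i j then 1 else 0)" if "i \<noteq> j" for i j
  proof -
    consider "i = k" | "j = k" | "E i k" "E k j" | "E j k" "E k i"
      | "i \<noteq> k" "j \<noteq> k" "\<not> (E i k \<and> E k j)" "\<not> (E j k \<and> E k i)" by blast
    then show ?thesis
    proof cases
      case 1
      then have "B i j = A k j \<or> B i j = - A k j"
        by (auto simp: B_def ek Akk e_def sym[of j k] not_arrow_refl)
      then show ?thesis using abs[of k j] that 1 by (auto simp: adj_mut_k)
    next
      case 2
      then have "B i j = A i k \<or> B i j = - A i k"
        by (auto simp: B_def ek Akk e_def sym[of i k] not_arrow_refl)
      then show ?thesis using abs[of i k] that 2 by (auto simp: adj_mut_k)
    next
      case 3
      then show ?thesis by (rule through)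
    next
      case 4
      then show ?thesis using through[of j i] Bsym[of i j] adj_sym[of "mut k E" i j] by simp
    next
      case 5
      have *: "B i j = A i j"
      proof (cases "E i k")
        case True
        show ?thesis
        proof (cases "E j k")
          case True
          then show ?thesis using \<open>E i k\<close> by (simp add: B_def e_def sym[of k])
        next
          case False
          then have "A k j = 0" using 5 True companion_zero[OF A, of k j] by (auto simp: adj_def)
          then show ?thesis using False by (simp add: B_def e_def)
        qed
      next
        case Fi: False
        show ?thesis
        proof (cases "E j k")
          case True
          then have "A i k = 0" using 5 Fi companion_zero[OF A, of i k] by (auto simp: adj_def)
          then show ?thesis using Fi by (simp add: B_def e_def)
        next
          case False
          then show ?thesis using Fi by (simp add: B_def e_def)
        qed
      qed
      show ?thesis using abs[OF that] * adj_mut_unchanged[OF 5] by simp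
    qed
  qed
  have pos: "form V B x > 0" if x: "\<exists>i\<in>V. x i \<noteq> 0" for x
  proof -
    define s where "s = (\<Sum>i\<in>V. e i * x i)"
    \<comment> \<open>The coordinates, in the old basis, of the vector with coordinates
      \<open>x\<close> in the reflected basis. Only the coordinate at \<open>k\<close> differs, and
      \<open>s\<close> is zero if \<open>x\<close> is supported at \<open>k\<close>, so
      \<open>?y\<close> is nonzero whenever \<open>x\<close> is.\<close>
    let ?y = "\<lambda>i. x i + (if i = k then - s else 0)"
    have Bxx: "B i j * x i * x j = A i j * x i * x j - (e i * x i) * (A k j * x j)
        - (A k i * x i) * (e j * x j) + (2 * (e i * x i)) * (e j * x j)" for i j
      unfolding B_def sym[of i k] by (simp add: algebra_simps)
    have "form V B x = (\<Sum>i\<in>V. \<Sum>j\<in>V. A i j * x i * x j - (e i * x i) * (A k j * x j)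
        - (A k i * x i) * (e j * x j) + (2 * (e i * x i)) * (e j * x j))"
      unfolding form_def Bxx ..
    also have "\<dots> = form V A x - s * (\<Sum>j\<in>V. A k j * x j) - (\<Sum>j\<in>V. A k j * x j) * s
        + (\<Sum>i\<in>V. 2 * (e i * x i)) * s"
      by (simp only: sum.distrib sum_subtractf form_def s_def sum_product[symmetric])
    also have "\<dots> = form V A x - 2 * s * (\<Sum>j\<in>V. A k j * x j) + 2 * s\<^sup>2"
      by (simp add: s_def sum_distrib_left[symmetric] power2_eq_square)
    also have "\<dots> = form V A ?y"
      unfolding form_add_delta[OF finite_V assms sym] Akk by (simp add: algebra_simps)
    finally have "form V B x = form V A ?y" .
    moreover obtain i where "i \<in> V" "?y i \<noteq> 0"
    proof (cases "\<exists>i\<in>V. i \<noteq> k \<and> x i \<noteq> 0")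
      case True
      then show ?thesis using that by auto
    next
      case False
      then have "e i * x i = 0" if "i \<in> V" for i using that ek by auto
      then have "s = 0" unfolding s_def by (rule sum.neutral[OF ballI])
      moreover obtain i where "i \<in> V" "x i \<noteq> 0" using x by blast
      ultimately have "?y i \<noteq> 0" by auto
      with \<open>i \<in> V\<close> show ?thesis by (rule that)
    qed
    ultimately show ?thesis using companion_pos[OF A, of i ?y] by simp
  qed
  have "companion V (adj (mut k E)) B"
    unfolding companion_def using Bsym Bii Babs pos by blast
  then show ?thesis by blast
qed

end

text \<open>The walk is cut at the vertices satisfying \<open>N\<close>. The contributions of
  consecutive arcs telescope, because each intermediate cut point enters as the square of its
  \<theta>, which is 1.\<close>

lemma edge_prod_walk:
  assumes "\<And>us a vs b ws. w = us @ a # vs @ b # ws \<Longrightarrow> N a \<Longrightarrow> N b \<Longrightarrow> \<forall>v\<in>set vs. \<not> N v \<Longrightarrow>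
      edge_prod A (a # vs @ [b]) = \<theta> a * \<theta> b"
    and "\<And>a. N a \<Longrightarrow> \<theta> a * \<theta> a = 1"
    and "w \<noteq> []" "N (hd w)" "N (last w)"
  shows "edge_prod A w = \<theta> (hd w) * \<theta> (last w)"
  using assms(1,3-5)
proof (induction w rule: measure_induct_rule[of length])
  case (less w)
  obtain a w' where w: "w = a # w'" using less.prems(2) by (cases w) auto
  have a: "N a" using less.prems w by simp
  show ?case
  proof (cases "w' = []")
    case True
    then show ?thesis using w a assms(2) by simp
  next
    case False
    then have "last w \<in> set w'" using w by simp
    then obtain vs b ws where s: "w' = vs @ b # ws" "N b" "\<forall>v\<in>set vs. \<not> N v"
      using split_list_first_prop[of w' N] less.prems w by (metis)
    have arcs: "edge_prod A (c # xs @ [d]) = \<theta> c * \<theta> d"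
      if "b # ws = us @ c # xs @ d # ys" "N c" "N d" "\<forall>v\<in>set xs. \<not> N v" for us c xs d ys
      using less.prems(1)[of "(a # vs) @ us" c xs d ys] that w s(1) by simp
    have "length (b # ws) < length w" "N (hd (b # ws))" "N (last (b # ws))"
      using less.prems(4) w s by auto
    then have "edge_prod A (b # ws) = \<theta> (hd (b # ws)) * \<theta> (last (b # ws))"
      using arcs by (intro less.IH) simp_all
    moreover have "edge_prod A (a # vs @ [b]) = \<theta> a * \<theta> b"
      using less.prems(1)[of "[]" a vs b ws] w s a by simp
    moreover have "edge_prod A w = edge_prod A ((a # vs) @ [b]) * edge_prod A (b # ws)"
      using edge_prod_append[of A "a # vs" b ws] w s by simp
    ultimately show ?thesis using assms(2)[OF s(2)] w s by (simp add: algebra_simps)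
  qed
qed

section \<open>Chordless cycles of the mutated quiver\<close>

context finite_type
begin

text \<open>On the cycle only \<open>a\<close> and \<open>b\<close> are neighbours of
  \<open>k\<close>, so among the remaining vertices mutation can affect only the pair
  \<open>a\<close>, \<open>b\<close>. If both arrows at \<open>k\<close> pointed the same way,
  nothing would change, and the cycle would be a non-oriented chordless cycle of \<open>E\<close>.
  Hence one enters and one leaves, and the adjacency of \<open>a\<close> and \<open>b\<close>
  flips.\<close>

lemma mut_cycle_through:
  assumes c: "induced_cycle (adj (mut k E)) (k # ys)"
  defines "a \<equiv> hd ys" and "b \<equiv> last ys"
  shows "(E a k \<and> E k b) \<or> (E b k \<and> E k a)"
    and "length ys = 2 \<Longrightarrow> \<not> adj E a b"
    and "length ys > 2 \<Longrightarrow> induced_cycle (adj E) ys"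
proof -
  let ?E = "mut k E"
  obtain zs where zs: "ys = a # zs" "zs \<noteq> []" "b = last zs"
  proof (cases ys rule: remdups_adj.cases)
    case (3 x y xs)
    then show ?thesis using that[of "y # xs"] by (simp add: a_def b_def)
  qed (use c in auto)
  have path: "induced_path (adj ?E) ys" "k \<notin> set ys"
    and k: "\<And>z. z \<in> set ys \<Longrightarrow> adj E k z \<longleftrightarrow> z = a \<or> z = b"
    using c by (auto simp: adj_mut_k a_def b_def)
  have ab: "a \<in> set ys" "b \<in> set zs" "a \<notin> set zs" "a \<noteq> b"
    using zs path by auto
  have unch: "mut k E u v = E u v"
    if "u \<in> set ys" "v \<in> set ys" "\<not> ({u, v} = {a, b})" for u v
  proof (rule mut_unchanged)
    have "u = v \<or> \<not> adj E k u \<or> \<not> adj E k v" using that k by auto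
    then show "\<not> (E u k \<and> E k v)" "\<not> (E v k \<and> E k u)" using arrow_asym by (auto simp: adj_def)
  qed (use that path in auto)
  have adjk: "adj E k a" "adj E k b" using k ab zs by auto
  show types: "(E a k \<and> E k b) \<or> (E b k \<and> E k a)"
  proof (rule ccontr)
    assume n: "\<not> ?thesis"
    then have "adj (mut k E) u v = adj E u v" if "u \<in> set (k # ys)" "v \<in> set (k # ys)" for u v
    proof (cases "u = k \<or> v = k")
      case False
      then show ?thesis
      proof (cases "{u, v} = {a, b}")
        case True
        then show ?thesis using False n by (intro adj_mut_unchanged) (auto simp: doubleton_eq_iff)
      next
        case False
        then have "{v, u} \<noteq> {a, b}" by (simp add: insert_commute)
        then show ?thesis using that False \<open>\<not> (u = k \<or> v = k)\<close> unch[of u v] unch[of v u]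
          by (simp add: adj_def)
      qed
    qed (auto simp: adj_mut_k)
    then have "induced_cycle (adj E) (k # ys)"
      using c induced_cycle_cong[of "k # ys" "adj ?E" "adj E"] by blast
    then have "cyclic E (k # ys) \<or> cyclic E (rev (k # ys))" by (rule cycle_oriented)
    then have "E b k \<and> E k a \<or> E k b \<and> E a k"
      using zs cyclic_rev[of "k # ys" E] by (auto simp: cyclic_def)
    with n show False by blast
  qed
  have through: "adj ?E a b \<longleftrightarrow> \<not> adj E a b"
    using types
  proof
    assume "E a k \<and> E k b"
    then show ?thesis using adj_mut_through(1)[of a k b] triangle[of a k b] by (auto simp: adj_def)
  next
    assume "E b k \<and> E k a"
    then show ?thesis using adj_mut_through(1)[of b k a] triangle[of b k a] adj_sym[of ?E a b]
      by (auto simp: adj_def)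
  qed
  show "\<not> adj E a b" if "length ys = 2"
  proof -
    have "zs = [b]" using that zs by (cases zs) auto
    then have "hd zs = b" by simp
    then have "adj ?E a b" using path(1) zs(1) ab(2) by simp
    then show ?thesis using through by blast
  qed
  show "induced_cycle (adj E) ys" if len: "length ys > 2"
  proof -
    have un: "adj ?E u v \<longleftrightarrow> adj E u v" if "u \<in> set ys" "v \<in> set ys" "{u, v} \<noteq> {a, b}" for u v
      using unch[of u v] unch[of v u] that by (auto simp: adj_def insert_commute)
    have "induced_path (adj ?E) zs" using path zs by auto
    moreover have "adj ?E u v \<longleftrightarrow> adj E u v" if "u \<in> set zs" "v \<in> set zs" for u v
      using un[of u v] that ab zs by (auto simp: doubleton_eq_iff)
    ultimately have "induced_path (adj E) zs" using induced_path_cong by blast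
    moreover have hd: "hd zs \<noteq> b"
    proof -
      obtain y ws where "zs = y # ws" "ws \<noteq> []"
        using len zs by (cases zs rule: remdups_adj.cases) auto
      moreover then have "y \<notin> set ws" using path zs by auto
      ultimately show ?thesis using zs last_in_set[of ws] by auto
    qed
    moreover have "adj E a z \<longleftrightarrow> z = hd zs \<or> z = last zs" if "z \<in> set zs" for z
    proof (cases "z = b")
      case True
      then have "\<not> adj ?E a b" using path zs hd ab by auto
      then show ?thesis using True through zs by simp
    next
      case False
      then have "adj ?E a z \<longleftrightarrow> adj E a z" using that ab zs by (intro un) (auto simp: doubleton_eq_iff)
      then show ?thesis using path zs that False by auto
    qed
    ultimately show ?thesis using that zs path by auto
  qed
qed

text \<open>Beyond the triangle case, \<open>a # zs\<close> is a cycle of \<open>E\<close>, and the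
  triangle on \<open>a\<close>, \<open>k\<close> and \<open>last zs\<close> forces its closing arrow
  to run from \<open>last zs\<close> to \<open>a\<close>. This fixes the direction of the whole
  cycle; mutation replaces that arrow by the two reversed arrows through \<open>k\<close>.\<close>

lemma mut_cycle_through_cyclic:
  assumes c: "induced_cycle (adj (mut k E)) (k # a # zs)" and "E a k"
  shows "cyclic (mut k E) (k # a # zs)"
proof -
  let ?E = "mut k E" and ?b = "last zs"
  have zs: "zs \<noteq> []" using c by auto
  have path: "induced_path (adj ?E) (a # zs)" "k \<notin> set (a # zs)" "a \<notin> set zs"
    and k: "\<And>z. z \<in> set zs \<Longrightarrow> adj E k z \<longleftrightarrow> z = ?b"
    using c zs by (auto simp: adj_mut_k)
  have b: "E k ?b"
    using mut_cycle_through(1)[OF c] zs \<open>E a k\<close> arrow_asym[of a k] by auto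
  show ?thesis
  proof (cases "length zs = 1")
    case True
    then have z: "zs = [?b]" by (cases zs) auto
    then have "\<not> adj E a ?b" using mut_cycle_through(2)[OF c] True zs by simp
    then have "?E a ?b" using mut_through[OF \<open>E a k\<close> b] by (simp add: adj_def)
    then have "cyclic ?E (k # a # [?b])" using b \<open>E a k\<close> by (simp add: cyclic_def mut_k)
    then show ?thesis using z by simp
  next
    case False
    then have len: "length zs \<ge> 2" using zs by (cases zs rule: remdups_adj.cases) auto
    then have cyc: "induced_cycle (adj E) (a # zs)" using mut_cycle_through(3)[OF c] by simp
    then have "adj E a ?b" using zs by auto
    then have ba: "E ?b a" using triangle[OF \<open>E a k\<close> b] by (simp add: adj_def)
    have "cyclic E (a # zs) \<or> cyclic E (rev (a # zs))" using cycle_oriented[OF cyc] .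
    moreover have "\<not> cyclic E (rev (a # zs))"
      using ba arrow_asym zs by (subst cyclic_rev) (auto simp: cyclic_def)
    ultimately have cE: "cyclic E (a # zs)" by blast
    have unch: "?E u v \<longleftrightarrow> E u v"
      if "u \<in> set (a # zs)" "v \<in> set zs" "u = a \<longrightarrow> v \<noteq> ?b" for u v
    proof (rule mut_unchanged)
      have "u = v \<or> \<not> adj E k u \<or> \<not> adj E k v" using that k by auto
      then show "\<not> (E u k \<and> E k v)" "\<not> (E v k \<and> E k u)" using arrow_asym by (auto simp: adj_def)
    qed (use that path in auto)
    have "hd zs \<noteq> ?b"
    proof -
      obtain y ws where "zs = y # ws" "ws \<noteq> []"
        using len by (cases zs rule: remdups_adj.cases) auto
      moreover then have "y \<notin> set ws" using path by auto
      ultimately show ?thesis using last_in_set[of ws] by auto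
    qed
    then have "?E a (hd zs)" using unch[of a "hd zs"] cE zs by (simp add: cyclic_def successively_Cons)
    moreover have "successively ?E zs"
    proof -
      have "successively ?E zs \<longleftrightarrow> successively E zs"
        using path by (intro successively_cong unch) auto
      then show ?thesis using cE zs by (simp add: cyclic_def successively_Cons)
    qed
    ultimately show ?thesis using zs b \<open>E a k\<close> by (simp add: cyclic_def successively_Cons mut_k)
  qed
qed

end

lemma rev_rotate_ex: "\<exists>m. rev (rotate n xs) = rotate m (rev xs)"
proof -
  let ?k = "n mod length xs"
  have "rev xs = rev (drop ?k xs) @ rev (take ?k xs)"
    by (simp flip: rev_append)
  then have "rotate (length (rev (drop ?k xs))) (rev xs) = rev (take ?k xs) @ rev (drop ?k xs)"
    by (simp only: rotate_append)
  then show ?thesis by (metis rev_append rotate_drop_take)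
qed

text \<open>The list is a cycle of the mutated quiver, read in the direction of its arrows; the
  names of the rules tell how it arises in \<open>E\<close>: a cycle lost \<open>k\<close>, a path
  through \<open>k\<close> closed up, or a cycle gained \<open>k\<close>.\<close>

inductive mut_cycle_shape :: "('v \<Rightarrow> 'v \<Rightarrow> bool) \<Rightarrow> 'v \<Rightarrow> 'v list \<Rightarrow> bool" for E k where
  contracted: "E a k \<Longrightarrow> E k b \<Longrightarrow> \<forall>z\<in>set cs. \<not> adj E k z \<Longrightarrow>
    induced_cycle (adj E) (a # k # b # cs) \<Longrightarrow> mut_cycle_shape E k (a # b # cs)"
| triangle: "E a k \<Longrightarrow> E k b \<Longrightarrow> \<not> adj E a b \<Longrightarrow> mut_cycle_shape E k [k, a, b]"
| extended: "E a k \<Longrightarrow> E k b \<Longrightarrow> \<forall>z\<in>set cs. \<not> adj E k z \<Longrightarrow> k \<notin> set cs \<Longrightarrow>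
    induced_cycle (adj E) (a # cs @ [b]) \<Longrightarrow> mut_cycle_shape E k (k # a # cs @ [b])"

context finite_type
begin

text \<open>Otherwise the neighbours of \<open>k\<close> cut the cycle into arcs, each of which closes up with \<open>k\<close>
  to a cycle through \<open>k\<close>. With \<open>\<theta> z = \<plusminus> A k z\<close>, the sign being the direction of the arrow between
  \<open>z\<close> and \<open>k\<close>, an arc from \<open>a\<close> to \<open>b\<close> has \<open>edge_prod\<close> equal to \<open>\<theta> a * \<theta> b\<close>; so the whole cycle
  has \<open>edge_prod\<close> equal to \<open>1\<close>, although it must be \<open>-1\<close>.\<close>

lemma mut_cycle_avoiding:
  assumes kV: "k \<in> V" and C: "induced_cycle (adj (mut k E)) c" and kc: "k \<notin> set c"
    and xy: "x \<in> set c" "y \<in> set c" "x \<noteq> y" "adj E k x" "adj E k y"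
  shows "\<exists>n a b cs. rotate n c = a # b # cs \<and> (\<forall>z\<in>set c. adj E k z \<longleftrightarrow> z = a \<or> z = b)"
proof (rule ccontr)
  assume no: "\<not> ?thesis"
  let ?R = "adj (mut k E)" and ?N = "adj E k"
  obtain m ys where m: "rotate m c = x # ys" using rotate_to_head[OF xy(1)] .
  have set: "set c = insert x (set ys)" using m by (metis list.simps(15) set_rotate)
  have R: "symp ?R" by (rule symp_adj)
  have cyc: "induced_cycle ?R (x # ys)" using induced_cycle_rotate[OF R C, of m] m by simp
  then have ys: "ys \<noteq> []" "distinct ys" "x \<notin> set ys" "induced_path ?R ys"
    and xz: "\<And>z. z \<in> set ys \<Longrightarrow> ?R x z \<longleftrightarrow> z = hd ys \<or> z = last ys"
    using induced_cycle_distinct[OF cyc] by auto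
  have no': False if "rotate n (x # ys) = a # b # cs" "\<forall>z\<in>set c. ?N z \<longleftrightarrow> z = a \<or> z = b" for n a b cs
    using no that m by (metis rotate_rotate)
  have y: "y \<in> set ys" using xy set by auto
  have cV: "set c \<subseteq> V"
  proof
    fix z assume "z \<in> set c"
    then obtain n zs where "rotate n c = z # zs" using rotate_to_head by metis
    then have "induced_cycle ?R (z # zs)" using induced_cycle_rotate[OF R C, of n] by simp
    then have "?R z (hd zs)" by (cases zs) auto
    then show "z \<in> V" using mut_arrow_V by (auto simp: adj_def)
  qed
  obtain A where A: "companion V ?R A" using companion_mut[OF kV] by blast
  have sym: "A i j = A j i" for i j using A by (simp add: companion_def)
  have sq: "A k z * A k z = 1" if "?N z" for z
    using companion_square[OF A, of k z] that adj_irrefl adj_mut_k by auto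
  define \<theta> where "\<theta> z = (if E z k then 1 else -1) * A k z" for z
  have \<theta>: "\<theta> z * \<theta> z = 1" if "?N z" for z
    using sq[OF that] by (simp add: \<theta>_def)
  have arc: "edge_prod A (a # vs @ [b]) = \<theta> a * \<theta> b"
    if w: "x # ys @ [x] = us @ a # vs @ b # ws" and ab: "?N a" "?N b" and vs: "\<forall>v\<in>set vs. \<not> ?N v"
    for us a vs b ws
  proof -
    \<comment> \<open>An arc could fail to be induced only by running through all vertices of the
      cycle, its ends being joined by the remaining edge. Then its ends would be the only neighbours
      of \<open>k\<close> and consecutive on the cycle, which \<open>no'\<close> excludes. An arc
      from \<open>x\<close> all the way round to \<open>x\<close> is excluded by the second
      neighbour \<open>y\<close>.\<close>
    have path: "induced_path ?R (a # vs @ [b])"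
    proof (cases us)
      case Nil
      then have a: "a = x" "ys @ [x] = vs @ b # ws" using w by auto
      show ?thesis
      proof (cases ws rule: rev_cases)
        case Nil
        then show ?thesis using a y xy vs by auto
      next
        case (snoc ws' z)
        then have s: "ys = vs @ b # ws'" using a by auto
        have "ws' \<noteq> []"
        proof
          assume "ws' = []"
          then have "rotate (length (x # vs)) (x # ys) = b # x # vs"
            using s rotate_append[of "x # vs" "[b]"] by simp
          moreover have "\<forall>z\<in>set c. ?N z \<longleftrightarrow> z = b \<or> z = x"
            using s set vs ab a \<open>ws' = []\<close> by auto
          ultimately show False using no' by blast
        qed
        then have "last ys \<in> set ws'" "hd ys = hd (vs @ [b])" using s by (auto simp: hd_append)
        moreover have "induced_path ?R ((vs @ [b]) @ ws')" using ys s by simp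
        ultimately show ?thesis
          using xz ys s a by (auto simp: induced_path_append[of _ "vs @ [b]"] simp del: append_assoc)
      qed
    next
      case (Cons u us')
      then have u: "ys @ [x] = us' @ a # vs @ b # ws" using w by auto
      show ?thesis
      proof (cases ws rule: rev_cases)
        case Nil
        then have b: "b = x" "ys = us' @ a # vs" using u by auto
        have "us' \<noteq> []"
        proof
          assume "us' = []"
          then have "rotate 0 (x # ys) = x # a # vs" using b by simp
          moreover have "\<forall>z\<in>set c. ?N z \<longleftrightarrow> z = x \<or> z = a"
            using b set vs ab \<open>us' = []\<close> by auto
          ultimately show False using no' by blast
        qed
        then have h: "hd ys \<in> set us'" "last ys = last (a # vs)" using b by auto
        have p: "induced_path ?R (us' @ (a # vs))" using ys b by simp
        have "?R z x \<longleftrightarrow> z = last (a # vs)" if "z \<in> set (a # vs)" for z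
          using xz[of z] that h p b adj_sym[of "mut k E"]
          by (auto simp: induced_path_append[of _ us'])
        then have "induced_path ?R ((a # vs) @ [x])"
          using p ys b unfolding induced_path_append by auto
        then show ?thesis using b by simp
      next
        case (snoc ws' z)
        then have "ys = us' @ (a # vs @ [b]) @ ws'" using u by auto
        then show ?thesis using ys(4) by (simp only: induced_path_append)
      qed
    qed
    have "set (a # vs @ [b]) \<subseteq> set (x # ys @ [x])" unfolding w by auto
    then have sub: "set (a # vs @ [b]) \<subseteq> set c" using set by auto
    have "induced_cycle ?R (k # a # vs @ [b])"
      using path sub kc ab vs by (auto simp: adj_mut_k)
    moreover from this have "edge_prod A (k # (a # vs @ [b]) @ [k]) = -1"
      using sub cV kV by (intro edge_prod_induced_cycle[OF finite_V A]) auto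
    ultimately have "(E a k \<and> E k b) \<or> (E b k \<and> E k a)"
      "edge_prod A (k # (a # vs @ [b]) @ [k]) = -1"
      using mut_cycle_through(1)[of k "a # vs @ [b]"] by auto
    moreover have "edge_prod A (k # (a # vs @ [b]) @ [k]) = A k a * edge_prod A (a # vs @ [b]) * A k b"
      using edge_prod_append[of A "a # vs" b "[k]"] sym[of b k] by simp
    ultimately have types: "(E a k \<and> E k b) \<or> (E b k \<and> E k a)"
      and ep: "A k a * edge_prod A (a # vs @ [b]) * A k b = -1" by simp_all
    have "edge_prod A (a # vs @ [b]) = - (A k a * A k b)"
    proof -
      have "edge_prod A (a # vs @ [b]) = (A k a * A k a) * edge_prod A (a # vs @ [b]) * (A k b * A k b)"
        using sq ab by simp
      also have "\<dots> = A k a * (A k a * edge_prod A (a # vs @ [b]) * A k b) * A k b"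
        by (simp only: mult_ac)
      finally show ?thesis unfolding ep by simp
    qed
    \<comment> \<open>Exactly one of the two arrows points to \<open>k\<close>, so the directional
      signs in \<theta> contribute the missing factor -1.\<close>
    moreover have "(E a k \<and> \<not> E b k) \<or> (E b k \<and> \<not> E a k)" using types arrow_asym by blast
    ultimately show ?thesis by (auto simp: \<theta>_def)
  qed
  have "edge_prod A (x # ys @ [x]) = \<theta> (hd (x # ys @ [x])) * \<theta> (last (x # ys @ [x]))"
    by (rule edge_prod_walk[of _ ?N, OF arc \<theta>]) (use xy in auto)
  then have "edge_prod A (x # ys @ [x]) = 1" using \<theta>[OF xy(4)] by simp
  moreover have "edge_prod A (x # ys @ [x]) = -1"
    using edge_prod_induced_cycle[OF finite_V A cyc] cV set by simp
  ultimately show False by simp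
qed

text \<open>If \<open>b\<close> also had an arrow to \<open>k\<close>, the edge between
  \<open>a\<close> and \<open>b\<close> would be old and form a non-oriented triangle with
  \<open>k\<close>. So it is created by the mutation. It is the only edge on the cycle that changes,
  and putting \<open>k\<close> in its place gives a chordless cycle of \<open>E\<close>, oriented by
  its arrow from \<open>a\<close> to \<open>k\<close>.\<close>

lemma mut_cycle_contracted:
  assumes c: "induced_cycle (adj (mut k E)) (a # b # cs)" and k: "k \<notin> set (a # b # cs)"
    and N: "\<forall>z\<in>set (a # b # cs). adj E k z \<longleftrightarrow> z = a \<or> z = b" and "E a k"
  shows "mut_cycle_shape E k (a # b # cs) \<and> cyclic (mut k E) (a # b # cs)"
proof -
  let ?E = "mut k E"
  have cs: "cs \<noteq> []" using c by auto
  have path: "induced_path (adj ?E) (b # cs)" "a \<notin> set (b # cs)"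
    and az: "\<And>z. z \<in> set (b # cs) \<Longrightarrow> adj ?E a z \<longleftrightarrow> z = b \<or> z = last cs"
    using c cs by auto
  have ncs: "\<forall>z\<in>set cs. \<not> adj E k z"
    using N induced_cycle_distinct[OF c] by auto
  have ab: "adj ?E a b" "b \<noteq> k" "a \<noteq> k" using az k by auto
  have "\<not> E b k"
  proof
    assume "E b k"
    then have "adj E a b" using ab adj_mut_unchanged[of a k b] \<open>E a k\<close> arrow_asym by blast
    then show False using triangle[of a b k] triangle[of b a k] \<open>E a k\<close> \<open>E b k\<close> by (auto simp: adj_def)
  qed
  then have kb: "E k b" using N by (auto simp: adj_def)
  have nab: "\<not> E a b" "\<not> E b a" "?E a b"
    using triangle[OF \<open>E a k\<close> kb] adj_mut_through[OF \<open>E a k\<close> kb] ab by auto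
  have unch: "?E u v \<longleftrightarrow> E u v"
    if "u \<in> set (a # b # cs)" "v \<in> set (a # b # cs)" "u \<in> set cs \<or> v \<in> set cs" for u v
    using that k ncs by (intro mut_unchanged) (auto simp: adj_def)
  have un: "adj ?E u v \<longleftrightarrow> adj E u v"
    if "u \<in> set (a # b # cs)" "v \<in> set (a # b # cs)" "u \<in> set cs \<or> v \<in> set cs" for u v
    using unch[of u v] unch[of v u] that by (auto simp: adj_def)
  have "adj ?E u v \<longleftrightarrow> adj E u v" if "u \<in> set (b # cs)" "v \<in> set (b # cs)" for u v
  proof (cases "u = b \<and> v = b")
    case True
    then show ?thesis using mut_asym[of k b b] adj_irrefl by (auto simp: adj_def)
  qed (use un that in auto)
  then have "induced_path (adj E) (b # cs)" using path induced_path_cong by blast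
  then have "induced_path (adj E) (k # b # cs)" using k kb ncs path by (auto simp: adj_def)
  moreover have "adj E a z \<longleftrightarrow> z = k \<or> z = last cs" if "z \<in> set (k # b # cs)" for z
  proof (cases "z \<in> set cs")
    case True
    then have "z \<noteq> b" "z \<noteq> k" using path k by auto
    then show ?thesis using un[of a z] az[of z] True by auto
  next
    case False
    then have "z \<noteq> last cs" using cs by auto
    then show ?thesis using that False nab \<open>E a k\<close> ab by (auto simp: adj_def)
  qed
  ultimately have cyc: "induced_cycle (adj E) (a # k # b # cs)" using cs k path by auto
  then have "cyclic E (a # k # b # cs) \<or> cyclic E (rev (a # k # b # cs))" by (rule cycle_oriented)
  moreover have "\<not> cyclic E (rev (a # k # b # cs))"
    using \<open>E a k\<close> arrow_asym by (subst cyclic_rev) (auto simp: cyclic_def)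
  ultimately have cE: "cyclic E (a # k # b # cs)" by blast
  have "successively ?E cs \<longleftrightarrow> successively E cs" by (intro successively_cong unch) auto
  then have "cyclic ?E (a # b # cs)"
    using cE cs nab unch[of b "hd cs"] unch[of "last cs" a]
    by (auto simp: cyclic_def successively_Cons)
  then show ?thesis using mut_cycle_shape.contracted[of E a k b cs] \<open>E a k\<close> kb ncs cyc by blast
qed

text \<open>Reversal is needed because \<open>c\<close> carries no direction, whereas the shapes
  start from a neighbour with an arrow into \<open>k\<close>. The orientation of \<open>d\<close> is
  part of the conclusion, so that an oriented \<open>c\<close> will be related to \<open>d\<close>
  by rotation alone.\<close>

lemma mut_cycle_cases:
  assumes kV: "k \<in> V" and c: "induced_cycle (adj (mut k E)) c"
  shows "(k \<notin> set c \<and> (\<forall>x\<in>set c. \<forall>y\<in>set c. adj E k x \<longrightarrow> adj E k y \<longrightarrow> x = y)) \<or>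
    (\<exists>n d. (d = rotate n c \<or> d = rotate n (rev c)) \<and> mut_cycle_shape E k d \<and> cyclic (mut k E) d)"
    (is "_ \<or> ?ex")
proof -
  let ?E = "mut k E"
  have R: "symp (adj ?E)" by (rule symp_adj)
  have ?ex if kc: "k \<in> set c"
  proof -
    have *: "mut_cycle_shape E k (k # a # zs) \<and> cyclic ?E (k # a # zs)"
      if d: "induced_cycle (adj ?E) (k # a # zs)" and a: "E a k" for a zs
    proof -
      have zs: "zs \<noteq> []" using d by auto
      then obtain cs b where b: "zs = cs @ [b]" by (cases zs rule: rev_cases) auto
      have ak: "\<not> E k a" using a arrow_asym by blast
      have kb: "E k b" using mut_cycle_through(1)[OF d] b a ak by auto
      have dis: "distinct (k # a # cs @ [b])" using induced_cycle_distinct[OF d] b by simp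
      have ncs: "\<forall>z\<in>set cs. \<not> adj E k z" using d b dis by (auto simp: adj_mut_k)
      have "mut_cycle_shape E k (k # a # cs @ [b])"
      proof (cases "cs = []")
        case True
        then show ?thesis using mut_cycle_through(2)[OF d] b a kb mut_cycle_shape.triangle[of E a k b] by simp
      next
        case False
        then have "induced_cycle (adj E) (a # cs @ [b])"
          using mut_cycle_through(3)[OF d] b by simp
        then show ?thesis using a kb ncs dis by (intro mut_cycle_shape.extended) auto
      qed
      then show ?thesis using mut_cycle_through_cyclic[OF d a] b by simp
    qed
    obtain n ys where n: "rotate n c = k # ys" using rotate_to_head[OF kc] .
    then have cyc: "induced_cycle (adj ?E) (k # ys)" using induced_cycle_rotate[OF R c, of n] by simp
    then have ys: "ys \<noteq> []" by auto
    show ?ex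
    proof (cases "E (hd ys) k")
      case True
      then show ?thesis using *[of "hd ys" "tl ys"] cyc n ys by (metis list.collapse)
    next
      case False
      then have l: "E (last ys) k" using mut_cycle_through(1)[OF cyc] by blast
      have "rev (rotate n c) = rev ys @ [k]" using n by simp
      then have "rotate (length ys) (rev (rotate n c)) = k # rev ys"
        using rotate_append[of "rev ys" "[k]"] by simp
      moreover obtain n' where "rev (rotate n c) = rotate n' (rev c)"
        using rev_rotate_ex by blast
      ultimately have r: "k # rev ys = rotate (length ys + n') (rev c)"
        by (simp add: rotate_rotate)
      have "induced_cycle (adj ?E) (k # rev ys)"
        unfolding r by (intro induced_cycle_rotate R induced_cycle_rev c)
      moreover have "rev ys = last ys # tl (rev ys)" using ys by (metis hd_rev list.collapse rev_is_Nil_conv)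
      ultimately show ?thesis using * l r by metis
    qed
  qed
  moreover have ?ex if kc: "k \<notin> set c"
    and xy: "x \<in> set c" "y \<in> set c" "x \<noteq> y" "adj E k x" "adj E k y" for x y
  proof -
    obtain n a b cs where n: "rotate n c = a # b # cs" and N: "\<forall>z\<in>set c. adj E k z \<longleftrightarrow> z = a \<or> z = b"
      using mut_cycle_avoiding[OF kV c kc xy] by blast
    have set: "set (a # b # cs) = set c" using n by (metis set_rotate)
    have d: "induced_cycle (adj ?E) (a # b # cs)" using induced_cycle_rotate[OF R c, of n] n by simp
    show ?ex
    proof (cases "E a k")
      case True
      then show ?thesis using mut_cycle_contracted[OF d _ _ True] N set kc n by metis
    next
      case False
      obtain m where "rev (rotate n c) = rotate m (rev c)" using rev_rotate_ex by blast
      then have "rev cs @ [b, a] = rotate m (rev c)" using n by simp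
      then have "b # a # rev cs = rotate (length (rev cs)) (rotate m (rev c))"
        using rotate_append[of "rev cs" "[b, a]"] by simp
      then obtain n' where r: "b # a # rev cs = rotate n' (rev c)" by (auto simp: rotate_rotate)
      have kk: "E k a" using False N set by (auto simp: adj_def)
      have e: "induced_cycle (adj ?E) (b # a # rev cs)"
        unfolding r by (intro induced_cycle_rotate R induced_cycle_rev c)
      \<comment> \<open>Otherwise both arrows leave \<open>k\<close>, the edge between
        \<open>a\<close> and \<open>b\<close> is old, and the triangle they form with
        \<open>k\<close> is not oriented.\<close>
      have "E b k"
      proof (rule ccontr)
        assume nb: "\<not> E b k"
        then have kb: "E k b" using N set by (auto simp: adj_def)
        have "adj ?E a b" "a \<noteq> k" "b \<noteq> k" using d kc set by auto
        then have "adj E a b" using adj_mut_unchanged[of a k b] False nb by blast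
        then show False using triangle[of k a b] triangle[of k b a] kk kb unfolding adj_def by blast
      qed
      have set': "set (b # a # rev cs) = set c" using set by auto
      show ?thesis using mut_cycle_contracted[OF e _ _ \<open>E b k\<close>] N set' kc r by metis
    qed
  qed
  ultimately show ?thesis by blast
qed

lemma mut_eq_on:
  assumes "k \<notin> S" "\<forall>x\<in>S. \<forall>y\<in>S. adj E k x \<longrightarrow> adj E k y \<longrightarrow> x = y" "x \<in> S" "y \<in> S"
  shows "mut k E x y \<longleftrightarrow> E x y"
proof (rule mut_unchanged)
  have "x = y \<or> \<not> adj E k x \<or> \<not> adj E k y" using assms by blast
  then show "\<not> (E x k \<and> E k y)" "\<not> (E y k \<and> E k x)" using arrow_asym by (auto simp: adj_def)
qed (use assms in auto)

lemma finite_type_mut: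
  assumes kV: "k \<in> V"
  shows "finite_type V (mut k E)"
proof
  fix c assume c: "induced_cycle (adj (mut k E)) c"
  then have len: "length c \<ge> 3" by (rule induced_cycle_length)
  from mut_cycle_cases[OF kV c]
  show "cyclic (mut k E) c \<or> cyclic (mut k E) (rev c)"
  proof
    assume *: "k \<notin> set c \<and> (\<forall>x\<in>set c. \<forall>y\<in>set c. adj E k x \<longrightarrow> adj E k y \<longrightarrow> x = y)"
    then have eq: "mut k E x y \<longleftrightarrow> E x y" if "x \<in> set c" "y \<in> set c" for x y
      using mut_eq_on[of k "set c"] that by blast
    then have "induced_cycle (adj E) c"
      using c induced_cycle_cong[of c "adj (mut k E)" "adj E"] by (simp add: adj_def)
    moreover have "cyclic (mut k E) c \<longleftrightarrow> cyclic E c" "cyclic (mut k E) (rev c) \<longleftrightarrow> cyclic E (rev c)"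
      using len eq by (intro cyclic_cong; auto)+
    ultimately show ?thesis using cycle_oriented by blast
  next
    assume "\<exists>n d. (d = rotate n c \<or> d = rotate n (rev c)) \<and> mut_cycle_shape E k d \<and> cyclic (mut k E) d"
    then show ?thesis using len cyclic_rotate[of c] cyclic_rotate[of "rev c"] by auto
  qed
qed (use finite_V mut_arrow_V mut_asym companion_mut[OF kV] in blast)+

end

section \<open>Mutation of families of braid generators\<close>

definition (in group) artin_family :: "'v set \<Rightarrow> ('v \<Rightarrow> 'v \<Rightarrow> bool) \<Rightarrow> ('v \<Rightarrow> 'a) \<Rightarrow> bool" where
  "artin_family V R x \<longleftrightarrow> x \<in> V \<rightarrow> carrier G \<and>
     (\<forall>i\<in>V. \<forall>j\<in>V. if R i j then braids (x i) (x j) else commutes (x i) (x j))"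

text \<open>Cycles are read only along their arrows. All starting vertices are demanded, but by
  \<open>artin_family_cyc_rotate\<close> any one of them implies the others.\<close>

definition (in group) braid_family :: "'v set \<Rightarrow> ('v \<Rightarrow> 'v \<Rightarrow> bool) \<Rightarrow> ('v \<Rightarrow> 'a) \<Rightarrow> bool" where
  "braid_family V E x \<longleftrightarrow> artin_family V (adj E) x \<and>
     (\<forall>c. set c \<subseteq> V \<longrightarrow> induced_cycle (adj E) c \<longrightarrow> cyclic E c \<longrightarrow> cyc (map x c))"

context group
begin

lemma artin_family_closed: "artin_family V R x \<Longrightarrow> i \<in> V \<Longrightarrow> x i \<in> carrier G"
  by (auto simp: artin_family_def)

lemma artin_family_closed_list: "artin_family V R x \<Longrightarrow> set l \<subseteq> V \<Longrightarrow> set (map x l) \<subseteq> carrier G"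
  by (auto simp: artin_family_def)

lemma artin_family_path:
  "artin_family V R x \<Longrightarrow> set l \<subseteq> V \<Longrightarrow> induced_path R l \<Longrightarrow> braid_path (map x l)"
proof (induction l)
  case (Cons y ys)
  have "braids (x y) (x (hd ys))" if "ys \<noteq> []"
  proof -
    have "hd ys \<in> set ys" using that by simp
    then have "R y (hd ys)" "hd ys \<in> V" "y \<in> V" using Cons.prems by auto
    then show ?thesis using Cons.prems(1) unfolding artin_family_def by metis
  qed
  moreover have "commutes (x y) (x z)" if "z \<in> set (tl ys)" for z
  proof -
    have "z \<in> set ys" "z \<noteq> hd ys" using that Cons.prems(3) induced_path_distinct[of R ys]
      by (cases ys; auto)+
    then have "\<not> R y z" "z \<in> V" "y \<in> V" using Cons.prems by auto
    then show ?thesis using Cons.prems(1) unfolding artin_family_def by metis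
  qed
  ultimately show ?case using Cons by (auto simp: hd_map map_tl[symmetric])
qed simp

lemma artin_family_cyc_rotate:
  assumes x: "artin_family V R x" and R: "symp R"
    and c: "set c \<subseteq> V" "induced_cycle R c" "cyc (map x c)"
  shows "cyc (map x (rotate n c))"
proof (induction n)
  case (Suc n)
  have i: "induced_cycle R (rotate n c)" using c R by (simp add: induced_cycle_rotate)
  then obtain y ys where y: "rotate n c = y # ys" by (cases "rotate n c") auto
  then have "set (y # ys) \<subseteq> V" using c by (metis set_rotate)
  moreover have "induced_path R ys" "ys \<noteq> []" using i y by auto
  ultimately have "cyc (map x ys @ [x y])"
    using artin_family_path[OF x, of ys] artin_family_closed_list[OF x, of "y # ys"] Suc y
    by (intro cyc_rotate) auto
  then show ?case using y by simp
qed (use c in simp)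

text \<open>Rotating on to a multiple of the length undoes a rotation, so the converse direction
  reduces to the forward one.\<close>

lemma artin_family_cyc_rotate_iff:
  assumes x: "artin_family V R x" and R: "symp R"
    and c: "set c \<subseteq> V" "induced_cycle R c" and n: "cyc (map x (rotate n c))"
  shows "cyc (map x c)"
proof -
  let ?m = "n * length c - n"
  have "length c \<ge> 3" using induced_cycle_length[OF c(2)] .
  then have "n \<le> n * length c" by simp
  then have "?m + n = n * length c" by simp
  then have "rotate ?m (rotate n c) = c" by (simp add: rotate_rotate rotate_id)
  then show ?thesis
    using artin_family_cyc_rotate[OF x R _ _ n, of ?m] c R by (simp add: induced_cycle_rotate)
qed

lemma artin_family_conjug:
  assumes "artin_family V R x" "g \<in> carrier G"
  shows "artin_family V R (\<lambda>i. conjug g (x i))"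
  using assms by (auto simp: artin_family_def braids_conjug commutes_conjug Pi_def)

lemma braid_family_conjug:
  assumes "braid_family V E x" "g \<in> carrier G"
  shows "braid_family V E (\<lambda>i. conjug g (x i))"
proof -
  have x: "artin_family V (adj E) x" using assms by (simp add: braid_family_def)
  have "cyc (map (\<lambda>i. conjug g (x i)) c)"
    if "set c \<subseteq> V" "induced_cycle (adj E) c" "cyclic E c" for c
  proof -
    have "length c \<ge> 3" using induced_cycle_length[OF that(2)] .
    moreover have "cyc (map x c)" using that assms by (simp add: braid_family_def)
    ultimately have "cyc (map (conjug g) (map x c))"
      using assms artin_family_closed_list[OF x that(1)] by (subst cyc_conjug) auto
    then show ?thesis by (simp add: comp_def)
  qed
  then show ?thesis using artin_family_conjug[OF x assms(2)] by (simp add: braid_family_def)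
qed

end

context finite_type
begin

lemma cyclic_last_hd:
  assumes "induced_cycle (adj E) c" "E (last c) (hd c)"
  shows "cyclic E c"
proof -
  have "c \<noteq> []" using assms by auto
  then have "\<not> cyclic E (rev c)"
    using arrow_asym[OF assms(2)] by (simp add: cyclic_def hd_rev last_rev)
  then show ?thesis using cycle_oriented assms by blast
qed

text \<open>Conjugation by the inverse of \<open>x k\<close> respects all relations and fixes the
  generators not adjacent to \<open>k\<close>, so the essential pairs are those joined by a path
  through \<open>k\<close>. If the path lies on an oriented triangle, the cycle relation is the new
  commutation up to conjugation. If not, \<open>braids_conjug_inv\<close> rewrites the new generator
  as \<open>x k\<close> conjugated by \<open>x i\<close>; since \<open>x i\<close> also fixes
  \<open>x j\<close>, the old braid relation of \<open>x k\<close> and \<open>x j\<close> becomes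
  the new one.\<close>

lemma artin_family_mut:
  fixes G (structure)
  assumes "group G" and "k \<in> V" and x: "group.braid_family G V E x"
  shows "group.artin_family G V (adj (mut k E))
    (\<lambda>i. if E i k then group.conjug G (inv (x k)) (x i) else x i)"
proof -
  interpret group G by fact
  let ?E = "mut k E" and ?K = "inv (x k)"
  let ?t = "\<lambda>i. if E i k then conjug ?K (x i) else x i"
  have ax: "artin_family V (adj E) x" using x by (simp add: braid_family_def)
  have cl: "x i \<in> carrier G" if "i \<in> V" for i using artin_family_closed[OF ax that] .
  have k: "x k \<in> carrier G" "?K \<in> carrier G" using cl \<open>k \<in> V\<close> by auto
  have rel: "if adj E i j then braids (x i) (x j) else commutes (x i) (x j)"
    if "i \<in> V" "j \<in> V" for i j
    using ax that by (simp add: artin_family_def)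
  have fix_k: "conjug ?K (x i) = x i" if "i \<in> V" "\<not> adj E i k" for i
  proof -
    have "commutes (x k) (x i)" using rel[of i k] that \<open>k \<in> V\<close> commutes_sym by auto
    then show ?thesis using commutes_iff_conjug[of "x k" "x i"] conjug_swap[of "x k" "x i" "x i"] k cl that
      by auto
  qed
  have sim: "if adj E i j then braids (?t i) (?t j) else commutes (?t i) (?t j)"
    if ij: "i \<in> V" "j \<in> V" and same: "E i k \<or> \<not> adj E i k" "E j k \<or> \<not> adj E j k" for i j
  proof -
    have "?t i = conjug ?K (x i)" "?t j = conjug ?K (x j)"
      using fix_k ij same by auto
    then show ?thesis using rel[OF ij] k cl ij by (simp add: braids_conjug commutes_conjug)
  qed
  have through: "if adj ?E i j then braids (?t i) (?t j) else commutes (?t i) (?t j)"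
    if ij: "E i k" "E k j" for i j
  proof -
    have iV: "i \<in> V" "j \<in> V" using ij arrow_V by auto
    have nj: "\<not> E j k" using ij arrow_asym by blast
    have t: "?t i = conjug ?K (x i)" "?t j = x j" using ij nj by auto
    have brk: "braids (x i) (x k)" "braids (x k) (x j)"
      using rel[OF iV(1) \<open>k \<in> V\<close>] rel[OF \<open>k \<in> V\<close> iV(2)] ij by (auto simp: adj_def)
    show ?thesis
    proof (cases "E j i")
      case True
      have ne: "i \<noteq> k" "j \<noteq> k" "i \<noteq> j" using ij not_arrow_refl nj by auto
      have "induced_cycle (adj E) [i, k, j]" "cyclic E [i, k, j]"
        using ij True ne by (auto simp: adj_def cyclic_def)
      moreover have "set [i, k, j] \<subseteq> V" using iV \<open>k \<in> V\<close> by auto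
      ultimately have "cyc (map x [i, k, j])"
        using x unfolding braid_family_def by blast
      then have "commutes (x i) (conjug (x k) (x j))" by simp
      then have "commutes (conjug ?K (x i)) (conjug ?K (conjug (x k) (x j)))"
        using k cl iV by (simp only: commutes_conjug conjug_closed)
      then have "commutes (?t i) (?t j)" using t k cl iV by simp
      then show ?thesis using True adj_mut_through(1)[OF ij] by simp
    next
      case False
      then have "\<not> adj E i j" using triangle[OF ij] by (auto simp: adj_def)
      then have "commutes (x i) (x j)" using rel[OF iV] by simp
      then have "x j = conjug (x i) (x j)" using commutes_iff_conjug cl iV by simp
      moreover have "?t i = conjug (x i) (x k)" using braids_conjug_inv brk t k cl iV by simp
      moreover have "braids (conjug (x i) (x k)) (conjug (x i) (x j))"
        using brk k cl iV by (simp add: braids_conjug)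
      ultimately have "braids (?t i) (?t j)" using t by metis
      then show ?thesis using False adj_mut_through(1)[OF ij] by simp
    qed
  qed
  have "if adj ?E i j then braids (?t i) (?t j) else commutes (?t i) (?t j)"
    if ij: "i \<in> V" "j \<in> V" for i j
  proof (cases rule: mut_cases[where i = i and j = j and k = k])
    case 1
    show ?thesis
    proof (cases "E j k \<or> \<not> adj E j k")
      case True
      then show ?thesis using sim[OF ij] adj_irrefl 1 by (simp add: adj_mut_k)
    next
      case False
      then show ?thesis using rel[OF ij] not_arrow_refl unfolding 1 by (simp add: adj_mut_k)
    qed
  next
    case 2
    show ?thesis
    proof (cases "E i k \<or> \<not> adj E i k")
      case True
      then show ?thesis using sim[OF ij] adj_irrefl 2 by (simp add: adj_mut_k)
    next
      case False
      then show ?thesis using rel[OF ij] not_arrow_refl unfolding 2 by (simp add: adj_mut_k)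
    qed
  next
    case 3
    then show ?thesis by (rule through)
  next
    case 4
    then show ?thesis
      using through[of j i] adj_sym[of ?E i j] braids_sym[of "?t i"] commutes_sym[of "?t i"] by metis
  next
    case 5
    then have adj: "adj ?E i j \<longleftrightarrow> adj E i j" by (rule adj_mut_unchanged)
    show ?thesis
    proof (cases "E i k \<or> E j k")
      case True
      then have "E i k \<or> \<not> adj E i k" "E j k \<or> \<not> adj E j k" using 5 by (auto simp: adj_def)
      then show ?thesis using sim[OF ij] adj by simp
    next
      case False
      then show ?thesis using rel[OF ij] adj by simp
    qed
  qed
  moreover have "?t \<in> V \<rightarrow> carrier G" using k cl by auto
  ultimately show ?thesis unfolding artin_family_def by blast
qed

text \<open>For each shape, after a suitable rotation, the new cycle relation is an old relation
  conjugated by the inverse of \<open>x k\<close>. In a contracted cycle the conjugation cancels the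
  leading \<open>x k\<close> of the chain, and only the generator of \<open>a\<close> keeps it. In a
  new triangle the old relation is the commutation of \<open>x a\<close> and
  \<open>x b\<close>.\<close>

lemma braid_family_mut:
  fixes G (structure)
  assumes "group G" and kV: "k \<in> V" and x: "group.braid_family G V E x"
  shows "group.braid_family G V (mut k E)
    (\<lambda>i. if E i k then group.conjug G (inv (x k)) (x i) else x i)"
proof -
  interpret group G by fact
  let ?E = "mut k E" and ?K = "inv (x k)"
  define t where "t = (\<lambda>i. if E i k then conjug ?K (x i) else x i)"
  have at: "artin_family V (adj ?E) t"
    unfolding t_def by (rule artin_family_mut[OF \<open>group G\<close> kV x])
  have ax: "artin_family V (adj E) x" using x by (simp add: braid_family_def)
  have cl: "x i \<in> carrier G" if "i \<in> V" for i using artin_family_closed[OF ax that] .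
  have cll: "set (map x l) \<subseteq> carrier G" if "set l \<subseteq> V" for l
    using artin_family_closed_list[OF ax that] .
  have k: "x k \<in> carrier G" "?K \<in> carrier G" using cl kV by auto
  have rel: "if adj E i j then braids (x i) (x j) else commutes (x i) (x j)"
    if "i \<in> V" "j \<in> V" for i j
    using ax that by (simp add: artin_family_def)
  have com_k: "commutes (x k) (x i)" if "i \<in> V" "\<not> adj E i k" for i
    using rel[of i k] that kV commutes_sym by auto
  have fix_k: "conjug ?K (x i) = x i" if "i \<in> V" "\<not> adj E i k" for i
    using commutes_iff_conjug[of "x k" "x i"] conjug_swap[of "x k" "x i" "x i"] com_k k cl that
    by auto
  have cycx: "cyc (map x c)" if "set c \<subseteq> V" "induced_cycle (adj E) c" "cyclic E c" for c
    using x that unfolding braid_family_def by blast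
  have shape: "cyc (map t d)"
    if "mut_cycle_shape E k d" and dV: "set d \<subseteq> V" and d: "induced_cycle (adj ?E) d" for d
    using that(1)
  proof cases
    case (contracted a b cs)
    have V: "a \<in> V" "b \<in> V" "set (b # cs) \<subseteq> V" using dV contracted by auto
    have "cyclic E (a # k # b # cs)"
    proof -
      have "\<not> cyclic E (rev (a # k # b # cs))"
        using contracted arrow_asym by (subst cyclic_rev) (auto simp: cyclic_def)
      then show ?thesis using cycle_oriented contracted by blast
    qed
    then have "cyc (map x (a # k # b # cs))"
      using contracted V kV by (intro cycx) auto
    then have "commutes (x a) (conjug (x k) (cchain (map x (b # cs))))" by simp
    then have "commutes (conjug ?K (x a)) (conjug ?K (conjug (x k) (cchain (map x (b # cs)))))"
      using k cl V cll[OF V(3)] by (simp only: commutes_conjug conjug_closed cchain_closed)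
    then have "commutes (conjug ?K (x a)) (cchain (map x (b # cs)))"
      using k cchain_closed[OF cll[OF V(3)]] by simp
    moreover have "map t (b # cs) = map x (b # cs)"
      using contracted arrow_asym by (auto simp: t_def adj_def)
    moreover have "t a = conjug ?K (x a)" using contracted by (simp add: t_def)
    ultimately have "cyc (t a # map t (b # cs))" by (simp only: cyc.simps)
    then show ?thesis using contracted by simp
  next
    case (triangle a b)
    have V: "a \<in> V" "b \<in> V" using dV triangle by auto
    have bk: "\<not> E b k" using triangle arrow_asym by blast
    have "commutes (x a) (x b)" using rel[OF V] triangle by simp
    then have "commutes (conjug ?K (x a)) (conjug ?K (x b))"
      using k cl V by (simp add: commutes_conjug)
    moreover have "braids (x b) (x k)" using rel[OF V(2) kV] triangle by (auto simp: adj_def)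
    then have "conjug (x b) (x k) = conjug ?K (x b)"
      using k cl V by (intro braids_conjug_inv)
    ultimately have "cyc (map t [a, b, k])"
      using triangle bk not_arrow_refl by (simp add: t_def)
    moreover have "[a, b, k] = rotate 1 d" using triangle by simp
    ultimately show ?thesis
      using artin_family_cyc_rotate_iff[OF at symp_adj dV d, of 1] by simp
  next
    case (extended a b cs)
    have V: "a \<in> V" "b \<in> V" "set cs \<subseteq> V" "set (cs @ [b]) \<subseteq> V" using dV extended by auto
    have bk: "\<not> E b k" "E k b" using extended arrow_asym by auto
    have cyc': "induced_cycle (adj E) (a # cs @ [b])" by fact
    have "adj E a b" using cyc' by auto
    then have "E b a" using finite_type.triangle[OF finite_type_axioms \<open>E a k\<close> \<open>E k b\<close>] by (simp add: adj_def)
    then have "cyclic E (a # cs @ [b])" using cyc' by (intro cyclic_last_hd) auto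
    then have "cyc (map x (a # cs @ [b]))"
      using cyc' V by (intro cycx) auto
    then have c: "commutes (x a) (cchain (map x (cs @ [b])))" by simp
    \<comment> \<open>With \<open>k\<close> rotated to the end, the chain finishes with
      \<open>x k\<close> conjugated by \<open>x b\<close>, which equals \<open>x b\<close>
      conjugated by \<open>?K\<close>. As no vertex of \<open>cs\<close> is adjacent to
      \<open>k\<close>, \<open>?K\<close> moves past \<open>?p\<close>, and the new chain is the old
      one conjugated by \<open>?K\<close>.\<close>
    let ?p = "lprod (map x cs)"
    have p: "?p \<in> carrier G" using cll[OF V(3)] by (rule lprod_closed)
    have ch: "cchain (map x (cs @ [b])) = conjug ?p (x b)"
      using cchain_snoc[of "map x cs" "x b"] cll[OF V(4)] by simp
    have "\<forall>y\<in>set (map x cs). commutes (x k) y"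
      using com_k V extended adj_sym[of E k] by auto
    then have "commutes (x k) ?p" using cll[OF V(3)] k by (intro commutes_lprod) 
    then have "commutes ?p ?K" using commutes_inv[of ?p "x k"] commutes_sym p k by metis
    then have pk: "?p \<otimes> ?K = ?K \<otimes> ?p" by (simp add: commutes_def)
    have "braids (x b) (x k)" using rel[OF V(2) kV] bk by (auto simp: adj_def)
    then have "conjug (x b) (x k) = conjug ?K (x b)"
      using k cl V by (intro braids_conjug_inv)
    moreover have "cchain (map x (cs @ [b]) @ [x k]) = conjug (lprod (map x (cs @ [b]))) (x k)"
      using cll[OF V(4)] k by (intro cchain_snoc) auto
    moreover have "lprod (map x (cs @ [b])) = ?p \<otimes> x b"
      using lprod_append[of "map x cs" "[x b]"] cll[OF V(4)] by simp
    ultimately have "cchain (map x (cs @ [b]) @ [x k]) = conjug ?p (conjug ?K (x b))"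
      using p k cl V by (simp add: conjug_conjug[symmetric])
    also have "\<dots> = conjug ?K (conjug ?p (x b))"
      using p k cl V by (simp add: conjug_conjug pk)
    finally have "cchain (map x (cs @ [b]) @ [x k]) = conjug ?K (cchain (map x (cs @ [b])))"
      by (simp only: ch)
    then have "commutes (conjug ?K (x a)) (cchain (map x (cs @ [b]) @ [x k]))"
      using c k cl V cchain_closed[OF cll[OF V(4)]] by (simp only: commutes_conjug)
    moreover have "map t (cs @ [b]) = map x (cs @ [b])"
      using extended bk by (auto simp: t_def adj_def)
    moreover have "t a = conjug ?K (x a)" "t k = x k"
      using \<open>E a k\<close> not_arrow_refl by (simp_all add: t_def)
    ultimately have "cyc (map t (a # (cs @ [b]) @ [k]))"
      by (simp only: map_append list.map cyc.simps)
    moreover have "a # (cs @ [b]) @ [k] = rotate 1 d" using extended by simp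
    ultimately have "cyc (map t (rotate 1 d))" by (simp only:)
    then show ?thesis by (rule artin_family_cyc_rotate_iff[OF at symp_adj dV d])
  qed
  have "cyc (map t c)" if cV: "set c \<subseteq> V" and c: "induced_cycle (adj ?E) c" and o: "cyclic ?E c" for c
    using mut_cycle_cases[OF kV c]
  proof
    assume *: "k \<notin> set c \<and> (\<forall>x\<in>set c. \<forall>y\<in>set c. adj E k x \<longrightarrow> adj E k y \<longrightarrow> x = y)"
    have len: "length c \<ge> 3" using induced_cycle_length[OF c] .
    have eq: "?E x y \<longleftrightarrow> E x y" if "x \<in> set c" "y \<in> set c" for x y
      using mut_eq_on[of k "set c"] that * by blast
    then have "induced_cycle (adj E) c"
      using c induced_cycle_cong[of c "adj ?E" "adj E"] by (simp add: adj_def)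
    moreover have "cyclic ?E c \<longleftrightarrow> cyclic E c" using len eq by (intro cyclic_cong) auto
    ultimately have cx: "cyc (map x c)" using cycx cV o by blast
    \<comment> \<open>The cycle contains at most one neighbour of \<open>k\<close>. If this one
      points to \<open>k\<close>, conjugating the whole cycle by \<open>?K\<close> changes no other
      generator, so the family on the cycle is either conjugated as a whole or untouched.\<close>
    show ?thesis
    proof (cases "\<exists>z\<in>set c. E z k")
      case True
      then obtain z where z: "z \<in> set c" "E z k" by blast
      have "t i = conjug ?K (x i)" if "i \<in> set c" for i
      proof (cases "i = z")
        case False
        then have "\<not> adj E i k" using * z that by (auto simp: adj_def)
        then show ?thesis using fix_k that cV by (auto simp: t_def)
      qed (use z in \<open>simp add: t_def\<close>)
      then have tc: "map t c = map (conjug ?K) (map x c)" by simp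
      show ?thesis unfolding tc using cx cyc_conjug[OF k(2) cll[OF cV]] len by (simp del: map_map)
    next
      case False
      then have tc: "map t c = map x c" by (simp add: t_def)
      show ?thesis unfolding tc by (rule cx)
    qed
  next
    assume "\<exists>n d. (d = rotate n c \<or> d = rotate n (rev c)) \<and> mut_cycle_shape E k d \<and> cyclic ?E d"
    then obtain n d where d: "d = rotate n c \<or> d = rotate n (rev c)" "mut_cycle_shape E k d"
      "cyclic ?E d" by blast
    have "length c \<ge> 2" "c \<noteq> []" using induced_cycle_length[OF c] by auto
    \<comment> \<open>Both \<open>c\<close> and \<open>d\<close> follow the arrows, which excludes
      the reversal.\<close>
    then have "\<not> cyclic ?E (rev c)"
      using o mut_asym by (subst cyclic_rev) (auto simp: cyclic_def)
    then have dn: "d = rotate n c"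
      using d cyclic_rotate[of "rev c" ?E n] \<open>length c \<ge> 2\<close> by auto
    then have "cyc (map t (rotate n c))"
      using d shape cV induced_cycle_rotate[OF symp_adj c] by simp
    then show ?thesis by (rule artin_family_cyc_rotate_iff[OF at symp_adj cV c])
  qed
  then have "braid_family V ?E t" using at by (simp add: braid_family_def)
  then show ?thesis by (simp add: t_def)
qed

end

section \<open>Induced paths and cycles in terms of positions\<close>

lemma induced_path_nth:
  "induced_path R l \<longleftrightarrow>
    distinct l \<and> (\<forall>q<length l. \<forall>p<q. R (l ! p) (l ! q) \<longleftrightarrow> q = Suc p)"
proof (induction l)
  case (Cons x ys)
  have hd: "(\<forall>z\<in>set ys. R x z \<longleftrightarrow> z = hd ys) \<longleftrightarrow> (\<forall>q<length ys. R x (ys ! q) \<longleftrightarrow> q = 0)"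
    if "distinct ys"
  proof -
    have "ys ! q = hd ys \<longleftrightarrow> q = 0" if "q < length ys" for q
    proof -
      have "ys \<noteq> []" using that by auto
      then show ?thesis using that \<open>distinct ys\<close> by (simp add: hd_conv_nth nth_eq_iff_index_eq)
    qed
    then show ?thesis by (auto simp: all_set_conv_all_nth)
  qed
  have "(\<forall>q<length (x # ys). \<forall>p<q. R ((x # ys) ! p) ((x # ys) ! q) \<longleftrightarrow> q = Suc p) \<longleftrightarrow>
      (\<forall>q<length ys. R x (ys ! q) \<longleftrightarrow> q = 0) \<and>
      (\<forall>q<length ys. \<forall>p<q. R (ys ! p) (ys ! q) \<longleftrightarrow> q = Suc p)"
    by (simp add: All_less_Suc2) blast
  then show ?case using Cons hd by auto
qed simp

lemma induced_cycle_nth: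
  "induced_cycle R c \<longleftrightarrow> length c \<ge> 3 \<and> distinct c \<and>
    (\<forall>q<length c. \<forall>p<q. R (c ! p) (c ! q) \<longleftrightarrow> q = Suc p \<or> (p = 0 \<and> Suc q = length c))"
proof (cases c)
  case (Cons x ys)
  have ends: "(\<forall>z\<in>set ys. R x z \<longleftrightarrow> z = hd ys \<or> z = last ys) \<longleftrightarrow>
      (\<forall>q<length ys. R x (ys ! q) \<longleftrightarrow> q = 0 \<or> Suc q = length ys)"
    if "distinct ys"
  proof -
    have "ys ! q = hd ys \<longleftrightarrow> q = 0" "ys ! q = last ys \<longleftrightarrow> Suc q = length ys"
      if "q < length ys" for q
    proof -
      have "ys \<noteq> []" using that by auto
      then show "ys ! q = hd ys \<longleftrightarrow> q = 0" "ys ! q = last ys \<longleftrightarrow> Suc q = length ys"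
        using that \<open>distinct ys\<close> by (auto simp: hd_conv_nth last_conv_nth nth_eq_iff_index_eq)
    qed
    then show ?thesis by (auto simp: all_set_conv_all_nth)
  qed
  have "(\<forall>q<length c. \<forall>p<q. R (c ! p) (c ! q) \<longleftrightarrow> q = Suc p \<or> (p = 0 \<and> Suc q = length c)) \<longleftrightarrow>
      (\<forall>q<length ys. R x (ys ! q) \<longleftrightarrow> q = 0 \<or> Suc q = length ys) \<and>
      (\<forall>q<length ys. \<forall>p<q. R (ys ! p) (ys ! q) \<longleftrightarrow> q = Suc p)"
    by (simp add: Cons All_less_Suc2) blast
  then show ?thesis using Cons ends induced_path_nth[of R ys] by auto
qed simp

section \<open>Quivers without multiple arrows\<close>

definition arrow :: "'v quiver \<Rightarrow> 'v \<Rightarrow> 'v \<Rightarrow> bool" where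
  "arrow Q i j \<longleftrightarrow> arr Q i j \<noteq> 0"

lemma adj_arrow: "adj (arrow Q) = adjacent Q"
  by (intro ext) (simp add: adj_def adjacent_def arrow_def)

text \<open>\<open>finite_type\<close> sees only whether arrows exist; the bound on multiplicities,
  under which \<open>mut\<close> describes the actual mutation, is carried along separately.\<close>

locale finite_type_quiver = finite_type "verts Q" "arrow Q" for Q :: "'v quiver" +
  assumes arr_le_one: "arr Q i j \<le> 1"
begin

lemma arr_eq: "arr Q i j = (if arrow Q i j then 1 else 0)"
  using arr_le_one[of i j] by (auto simp: arrow_def)

lemma arr_mutate: "arr (mutate k Q) i j = (if mut k (arrow Q) i j then 1 else 0)"
proof -
  have z: "arr Q i i = 0" for i using not_arrow_refl[of i] by (simp add: arrow_def)
  have m: "arr (mutate k Q) i j = (if i = k \<or> j = k then arr Q j i - arr Q i j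
    else arr Q i j + arr Q i k * arr Q k j - (arr Q j i + arr Q j k * arr Q k i))"
    by (auto simp: mutate_def cancel_two_cycles_def reverse_at_def add_paths_def z)
  show ?thesis
  proof (cases rule: mut_cases[where i = i and j = j and k = k])
    case 1
    then show ?thesis unfolding m mut_def
      using arr_eq[of i j] arr_eq[of j i] arrow_asym[of j i] by auto
  next
    case 2
    then show ?thesis unfolding m mut_def
      using arr_eq[of i j] arr_eq[of j i] arrow_asym[of j i] by auto
  next
    case 3
    then have "i \<noteq> k" "j \<noteq> k" "arr Q k i = 0" "arr Q i k = 1" "arr Q k j = 1" "arr Q i j = 0"
      using z not_arrow_refl arrow_asym[of i k] triangle[OF 3] by (auto simp: arr_eq)
    then show ?thesis using arr_eq[of j i] mut_through(1)[OF 3] unfolding m by auto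
  next
    case 4
    then have "i \<noteq> k" "j \<noteq> k" "arr Q k j = 0" "arr Q j k = 1" "arr Q k i = 1" "arr Q j i = 0"
      using z not_arrow_refl arrow_asym[of j k] triangle[OF 4] by (auto simp: arr_eq)
    then show ?thesis using arr_le_one[of i j] mut_through(2)[OF 4] unfolding m by auto
  next
    case 5
    then have "arr Q i k * arr Q k j = 0" "arr Q j k * arr Q k i = 0" by (auto simp: arr_eq)
    then show ?thesis using 5 mut_unchanged[OF 5] arr_eq[of i j] arr_eq[of j i] arrow_asym[of i j]
      unfolding m by auto
  qed
qed

lemma arrow_mutate: "arrow (mutate k Q) = mut k (arrow Q)"
  by (intro ext) (simp add: arrow_def arr_mutate)

lemma finite_type_quiver_mutate:
  assumes "k \<in> verts Q"
  shows "finite_type_quiver (mutate k Q)"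
proof (intro finite_type_quiver.intro finite_type_quiver_axioms.intro)
  show "finite_type (verts (mutate k Q)) (arrow (mutate k Q))"
    unfolding arrow_mutate verts_mutate by (rule finite_type_mut[OF assms])
  show "arr (mutate k Q) i j \<le> 1" for i j by (simp add: arr_mutate)
qed

lemma chordless_cycle_iff:
  "chordless_cycle Q c \<longleftrightarrow>
    set c \<subseteq> verts Q \<and> induced_cycle (adj (arrow Q)) c \<and> cyclic (arrow Q) c"
proof (cases "length c \<ge> 3")
  case True
  let ?r = "length c" and ?E = "arrow Q"
  have ne: "c \<noteq> []" using True by auto
  have cyc: "cyclic ?E c \<longleftrightarrow> (\<forall>p<?r. ?E (c ! p) (c ! (Suc p mod ?r)))"
  proof
    assume c: "cyclic ?E c"
    show "\<forall>p<?r. ?E (c ! p) (c ! (Suc p mod ?r))"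
    proof (intro allI impI)
      fix p assume "p < ?r"
      show "?E (c ! p) (c ! (Suc p mod ?r))"
      proof (cases "Suc p < ?r")
        case True
        then show ?thesis using c by (simp add: cyclic_def successively_conv_nth)
      next
        case False
        then have "Suc p = ?r" using \<open>p < ?r\<close> by simp
        then have "Suc p mod ?r = 0" "p = ?r - 1" by auto
        then show ?thesis using c ne by (simp add: cyclic_def last_conv_nth hd_conv_nth)
      qed
    qed
  next
    assume *: "\<forall>p<?r. ?E (c ! p) (c ! (Suc p mod ?r))"
    have "?E (c ! i) (c ! Suc i)" if "Suc i < ?r" for i
      using *[rule_format, of i] that by simp
    moreover have "?E (c ! (?r - 1)) (c ! 0)"
      using *[rule_format, of "?r - 1"] ne by (cases "?r") auto
    ultimately show "cyclic ?E c"
      using ne by (simp add: cyclic_def successively_conv_nth last_conv_nth hd_conv_nth)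
  qed
  show ?thesis
  proof
    assume ch: "chordless_cycle Q c"
    then have E: "?E (c ! p) (c ! q) \<longleftrightarrow> q = Suc p mod ?r" if "p < ?r" "q < ?r" for p q
      using that by (simp add: chordless_cycle_def arrow_def)
    have "adj ?E (c ! p) (c ! q) \<longleftrightarrow> q = Suc p \<or> (p = 0 \<and> Suc q = ?r)" if "q < ?r" "p < q" for p q
    proof (cases "Suc q = ?r")
      case True
      then show ?thesis using that by (auto simp: adj_def E)
    next
      case False
      then show ?thesis using that by (auto simp: adj_def E)
    qed
    moreover have "cyclic ?E c" unfolding cyc using E ne by simp
    ultimately show "set c \<subseteq> verts Q \<and> induced_cycle (adj ?E) c \<and> cyclic ?E c"
      using ch by (simp add: induced_cycle_nth chordless_cycle_def)
  next
    assume *: "set c \<subseteq> verts Q \<and> induced_cycle (adj ?E) c \<and> cyclic ?E c"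
    then have step: "?E (c ! p) (c ! (Suc p mod ?r))" if "p < ?r" for p
      using cyc that by blast
    have adj: "adj ?E (c ! p) (c ! q) \<longleftrightarrow> q = Suc p \<or> (p = 0 \<and> Suc q = ?r)"
      if "q < ?r" "p < q" for p q
      using * that by (simp add: induced_cycle_nth)
    \<comment> \<open>Chordlessness leaves only arrows between cyclic neighbours, and one running
      backwards would be opposite to an arrow of the cycle.\<close>
    have "q = Suc p mod ?r" if pq: "p < ?r" "q < ?r" and E: "?E (c ! p) (c ! q)" for p q
    proof (rule ccontr)
      assume n: "q \<noteq> Suc p mod ?r"
      have "p \<noteq> q" using E not_arrow_refl by blast
      then have "p = Suc q mod ?r"
      proof (cases "p < q")
        case True
        then have "q = Suc p \<or> (p = 0 \<and> Suc q = ?r)" using adj[of q p] pq E by (simp add: adj_def)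
        then show ?thesis using n pq by auto
      next
        case False
        then have "p = Suc q \<or> (q = 0 \<and> Suc p = ?r)"
          using adj[of p q] pq E \<open>p \<noteq> q\<close> by (auto simp: adj_def)
        then show ?thesis using n pq by auto
      qed
      then have "?E (c ! q) (c ! p)" using step[of q] pq by simp
      then show False using E arrow_asym by blast
    qed
    then have "arrow Q (c ! p) (c ! q) \<longleftrightarrow> q = Suc p mod ?r" if "p < ?r" "q < ?r" for p q
      using that step[of p] by blast
    then have "arr Q (c ! p) (c ! q) = (if q = Suc p mod ?r then 1 else 0)"
      if "p < ?r" "q < ?r" for p q
      using that unfolding arr_eq[of "c ! p" "c ! q"] by simp
    then show "chordless_cycle Q c"
      using * by (simp add: chordless_cycle_def induced_cycle_nth)
  qed
next
  case False
  then show ?thesis by (auto simp: chordless_cycle_def dest: induced_cycle_length)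
qed

end

section \<open>The braid group of a quiver of finite type\<close>

text \<open>The length 2r - 2 is r + (r - 2): once around the cycle from position \<open>p\<close>,
  then again without the last two vertices.\<close>

lemma cycle_word_rotate:
  assumes "p < length c" "length c \<ge> 2"
  shows "cycle_word c p = rotate p c @ butlast (butlast (rotate p c))"
proof (rule nth_equalityI)
  fix i assume i: "i < length (cycle_word c p)"
  let ?d = "rotate p c" and ?n = "length c"
  have bb: "butlast (butlast ?d) = take (?n - 2) ?d"
    by (simp add: butlast_conv_take min_def numeral_2_eq_2)
  have i': "i < 2 * ?n - 2" using i by (simp add: cycle_word_def)
  have "(?d @ take (?n - 2) ?d) ! i = ?d ! (i mod ?n)"
  proof (cases "i < ?n")
    case True
    then show ?thesis by (simp add: nth_append)
  next
    case False
    then have "i mod ?n = i - ?n" using i' by (simp add: le_mod_geq)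
    then show ?thesis using False i' by (simp add: nth_append)
  qed
  also have "\<dots> = c ! ((p + i) mod ?n)"
    using assms by (subst nth_rotate) (auto simp: mod_simps intro!: mod_less_divisor)
  finally show "cycle_word c p ! i = (?d @ butlast (butlast ?d)) ! i"
    using i' by (simp add: bb cycle_word_def)
qed (use assms in \<open>simp add: cycle_word_def\<close>)

context group
begin

lemma word_eval_pos_word: "word_eval G f (pos_word l) = lprod (map f l)"
  by (induction l) (simp_all add: word_eval_def)

lemma cyc_iff_cycle_words:
  assumes f: "artin_family V R f" and R: "symp R"
    and c: "set c \<subseteq> V" "induced_cycle R c"
  shows "cyc (map f c) \<longleftrightarrow>
    lprod (map f (c @ butlast (butlast c))) =
    lprod (map f (rotate1 c @ butlast (butlast (rotate1 c))))"
proof -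
  obtain x ys where x: "c = x # ys" using c by (cases c) auto
  have "ys \<noteq> []" using c x by auto
  then obtain w r where w: "ys = w @ [r]" by (cases ys rule: rev_cases) auto
  have wne: "w \<noteq> []" using c x w by auto
  \<comment> \<open>With \<open>r\<close> rotated to the front, the rest of the cycle is the path
    \<open>x # w\<close> that \<open>cyc_iff_words_eq\<close> asks for.\<close>
  have "induced_cycle R (rotate (length c - 1) c)" using c R by (simp add: induced_cycle_rotate)
  moreover have "rotate (length c - 1) c = r # x # w"
    using x w rotate_append[of "x # w" "[r]"] by simp
  ultimately have "induced_path R (x # w)" by simp
  then have "braid_path (map f (x # w))" using artin_family_path[OF f, of "x # w"] c x w by simp
  moreover have "set (map f (x # w @ [r])) \<subseteq> carrier G"
    using artin_family_closed_list[OF f c(1)] x w by simp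
  ultimately show ?thesis
    using cyc_iff_words_eq[of "f x" "map f w" "f r"] x w wne
    by (simp add: butlast_append map_butlast)
qed

text \<open>Equality of the words at two consecutive starting positions is \<open>cyc\<close> for a
  rotation of the cycle; chaining these gives all cycle relations. Conversely the positions 0 and 1
  already give back \<open>cyc\<close>.\<close>

lemma (in finite_type_quiver) braid_family_iff:
  fixes G (structure)
  assumes "group G"
  shows "group.braid_family G (verts Q) (arrow Q) f \<longleftrightarrow>
    f \<in> verts Q \<rightarrow> carrier G \<and>
    (\<forall>(u, v)\<in>quiver_relations Q. word_eval G f u = word_eval G f v)"
proof -
  interpret group G by fact
  let ?V = "verts Q" and ?E = "arrow Q"
  show ?thesis
  proof
    assume bf: "braid_family ?V ?E f"
    then have af: "artin_family ?V (adj ?E) f" by (simp add: braid_family_def)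
    have fV: "f \<in> ?V \<rightarrow> carrier G" using af by (simp add: artin_family_def)
    have rel: "if adj ?E i j then braids (f i) (f j) else commutes (f i) (f j)"
      if "i \<in> ?V" "j \<in> ?V" for i j
      using af that by (simp add: artin_family_def)
    have cl: "f i \<in> carrier G" if "i \<in> ?V" for i using fV that by auto
    have words: "lprod (map f (cycle_word c p)) = lprod (map f (cycle_word c 0))"
      if ch: "chordless_cycle Q c" and "p < length c" for c p
      using that(2)
    proof (induction p)
      case (Suc p)
      let ?d = "rotate p c"
      have c: "set c \<subseteq> ?V" "induced_cycle (adj ?E) c" "cyclic ?E c"
        using ch chordless_cycle_iff by auto
      have len: "length c \<ge> 3" using induced_cycle_length c by blast
      have d: "set ?d \<subseteq> ?V" "induced_cycle (adj ?E) ?d" "cyclic ?E ?d"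
        using c len by (simp_all add: induced_cycle_rotate symp_adj cyclic_rotate)
      then have "cyc (map f ?d)" using bf by (simp add: braid_family_def)
      then have "lprod (map f (cycle_word c p)) = lprod (map f (cycle_word c (Suc p)))"
        using cyc_iff_cycle_words[OF af symp_adj d(1,2)] Suc.prems len
        by (simp add: cycle_word_rotate)
      then show ?case using Suc by simp
    qed simp
    have "word_eval G f u = word_eval G f v" if "(u, v) \<in> quiver_relations Q" for u v
    proof -
      from that consider
        (comm) i j where "u = pos_word [i, j]" "v = pos_word [j, i]" "i \<in> ?V" "j \<in> ?V"
          "\<not> adjacent Q i j"
      | (braid) i j where "u = pos_word [i, j, i]" "v = pos_word [j, i, j]" "i \<in> ?V" "j \<in> ?V"
          "adjacent Q i j"
      | (cycle) c p q where "u = pos_word (cycle_word c p)" "v = pos_word (cycle_word c q)"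
          "chordless_cycle Q c" "p < length c" "q < length c"
        unfolding quiver_relations_def by blast
      then show ?thesis
      proof cases
        case comm
        then show ?thesis using rel[of i j] cl
          by (simp add: word_eval_pos_word adj_arrow commutes_def del: list.map) simp
      next
        case braid
        then show ?thesis using rel[of i j] cl
          by (simp add: word_eval_pos_word adj_arrow braids_def del: list.map) (simp add: m_assoc)
      next
        case cycle
        then show ?thesis using words[of c p] words[of c q] by (simp add: word_eval_pos_word)
      qed
    qed
    then show "f \<in> ?V \<rightarrow> carrier G \<and> (\<forall>(u, v)\<in>quiver_relations Q. word_eval G f u = word_eval G f v)"
      using fV by auto
  next
    assume "f \<in> ?V \<rightarrow> carrier G \<and> (\<forall>(u, v)\<in>quiver_relations Q. word_eval G f u = word_eval G f v)"
    then have fV: "f \<in> ?V \<rightarrow> carrier G"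
      and eq: "\<And>l l'. (pos_word l, pos_word l') \<in> quiver_relations Q \<Longrightarrow> lprod (map f l) = lprod (map f l')"
      by (auto simp flip: word_eval_pos_word)
    have cl: "f i \<in> carrier G" if "i \<in> ?V" for i using fV that by auto
    have "if adj ?E i j then braids (f i) (f j) else commutes (f i) (f j)"
      if ij: "i \<in> ?V" "j \<in> ?V" for i j
    proof (cases "adj ?E i j")
      case True
      then have "(pos_word [i, j, i], pos_word [j, i, j]) \<in> quiver_relations Q"
        using ij unfolding quiver_relations_def adj_arrow by blast
      from eq[OF this] show ?thesis using True cl ij by (simp add: braids_def m_assoc)
    next
      case False
      then have "(pos_word [i, j], pos_word [j, i]) \<in> quiver_relations Q"
        using ij unfolding quiver_relations_def adj_arrow by blast
      from eq[OF this] show ?thesis using False cl ij by (simp add: commutes_def)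
    qed
    then have af: "artin_family ?V (adj ?E) f" using fV by (simp add: artin_family_def)
    have "cyc (map f c)" if c: "set c \<subseteq> ?V" "induced_cycle (adj ?E) c" "cyclic ?E c" for c
    proof -
      have len: "length c \<ge> 3" using induced_cycle_length c by blast
      have "chordless_cycle Q c" using c chordless_cycle_iff by blast
      moreover have l: "0 < length c" "1 < length c" "2 \<le> length c" using len by auto
      ultimately have "(pos_word (cycle_word c 0), pos_word (cycle_word c 1)) \<in> quiver_relations Q"
        unfolding quiver_relations_def by blast
      moreover have "cycle_word c 0 = c @ butlast (butlast c)"
        "cycle_word c 1 = rotate1 c @ butlast (butlast (rotate1 c))"
        using cycle_word_rotate[OF l(1,3)] cycle_word_rotate[OF l(2,3)] by simp_all
      ultimately show ?thesis
        using eq cyc_iff_cycle_words[OF af symp_adj c(1,2)] by metis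
    qed
    then show "braid_family ?V ?E f" using af by (simp add: braid_family_def)
  qed
qed

end

section \<open>Homomorphisms out of presented groups\<close>

definition gen :: "'a set \<Rightarrow> ('a word \<times> 'a word) set \<Rightarrow> 'a \<Rightarrow> 'a word set" where
  "gen S R x = pres_rel S R `` {[(x, True)]}"

lemma gen_closed: "x \<in> S \<Longrightarrow> gen S R x \<in> carrier (presented_group S R)"
  unfolding gen_def by (rule pres_class_carrier) simp

lemma inv_gen:
  assumes "x \<in> S"
  shows "inv\<^bsub>presented_group S R\<^esub> gen S R x = pres_rel S R `` {[(x, False)]}"
proof -
  interpret group "presented_group S R" by (rule group_presented_group)
  have w: "[(x, True)] \<in> words S" "[(x, False)] \<in> words S" using assms by auto
  have "pres_eq S R [(x, False), (x, True)] []" using pres_cancel[OF assms, of R False] by simp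
  then have "pres_rel S R `` {[(x, False)] @ [(x, True)]} = pres_rel S R `` {[]}"
    using assms by (subst pres_rel_class_eq) auto
  then have "pres_rel S R `` {[(x, False)]} \<otimes>\<^bsub>presented_group S R\<^esub> gen S R x = \<one>\<^bsub>presented_group S R\<^esub>"
    unfolding gen_def pres_mult_class[OF w(2,1)] pres_one .
  then show ?thesis
    using gen_closed[OF assms, of R] pres_class_carrier[OF w(2)] by (rule inv_equality)
qed

lemma word_eval_gen:
  assumes "w \<in> words S"
  shows "word_eval (presented_group S R) (gen S R) w = pres_rel S R `` {w}"
  using assms
proof (induction w)
  case Nil
  then show ?case by (simp add: word_eval_def pres_one)
next
  case (Cons a w)
  obtain x b where a: "a = (x, b)" by force
  have x: "x \<in> S" and w: "w \<in> words S" using Cons.hyps a by auto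
  have "(if b then gen S R x else inv\<^bsub>presented_group S R\<^esub> gen S R x) = pres_rel S R `` {[(x, b)]}"
    using inv_gen[OF x] by (auto simp: gen_def)
  moreover have "[(x, b)] \<in> words S" using x by simp
  ultimately show ?case
    using Cons.IH a pres_mult_class[OF _ w, of "[(x, b)]" R] by (simp add: word_eval_def)
qed

lemma word_eval_gen_relation:
  assumes "(u, v) \<in> R" "u \<in> words S" "v \<in> words S"
  shows "word_eval (presented_group S R) (gen S R) u = word_eval (presented_group S R) (gen S R) v"
  using assms pres_rel_class_eq[of u S v R] by (simp add: word_eval_gen pres_relator)

lemma hom_word_eval:
  assumes G: "group G" and h: "h \<in> hom (presented_group S R) G" and w: "w \<in> words S"
  shows "h (pres_rel S R `` {w}) = word_eval G (\<lambda>x. h (gen S R x)) w"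
proof -
  let ?P = "presented_group S R"
  interpret group_hom ?P G h
    using G h group_presented_group by (simp add: group_hom_def group_hom_axioms_def)
  show ?thesis
    unfolding word_eval_gen[OF w, symmetric] using w
  proof (induction w)
    case Nil
    then show ?case by (simp add: word_eval_def)
  next
    case (Cons a w)
    obtain x b where a: "a = (x, b)" by force
    have x: "x \<in> S" and w: "w \<in> words S" using Cons.hyps a by auto
    have "word_eval ?P (gen S R) w \<in> carrier ?P"
      using gen_closed w by (intro word_eval_carrier[OF group_presented_group _ w]) auto
    then show ?case
      using Cons.IH a gen_closed[OF x, of R] by (simp add: word_eval_def)
  qed
qed

lemma presented_group_hom_gen:
  assumes "group G" "f \<in> S \<rightarrow> carrier G" "\<forall>(u, v)\<in>R. word_eval G f u = word_eval G f v"
  obtains h where "h \<in> hom (presented_group S R) G" "\<And>x. x \<in> S \<Longrightarrow> h (gen S R x) = f x"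
proof -
  interpret group G by fact
  obtain h where h: "h \<in> hom (presented_group S R) G"
    "\<forall>w\<in>words S. h (pres_rel S R `` {w}) = word_eval G f w"
    using presented_group_hom[OF assms(1,2), of R] assms(3) by blast
  have "h (gen S R x) = f x" if "x \<in> S" for x
  proof -
    have "[(x, True)] \<in> words S" using that by simp
    then have "h (gen S R x) = word_eval G f [(x, True)]" using h(2) unfolding gen_def by blast
    also have "\<dots> = f x" using funcset_mem[OF assms(2) that] by (simp add: word_eval_def)
    finally show ?thesis .
  qed
  then show ?thesis using that h(1) by blast
qed

lemma hom_eq_id_on_gen:
  assumes "h \<in> hom (presented_group S R) (presented_group S R)" "\<forall>x\<in>S. h (gen S R x) = gen S R x"
    and "A \<in> carrier (presented_group S R)"
  shows "h A = A"
proof -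
  let ?P = "presented_group S R"
  obtain w where w: "w \<in> words S" "A = pres_rel S R `` {w}" using assms(3) by (rule pres_carrierE)
  have "word_eval ?P (\<lambda>x. h (gen S R x)) w = word_eval ?P (gen S R) w"
    using w(1) assms(2) by (induction w) (auto simp: word_eval_def)
  then show ?thesis
    using hom_word_eval[OF group_presented_group assms(1) w(1)] word_eval_gen[OF w(1), of R] w(2) by simp
qed

lemma presented_group_isoI:
  assumes h: "h \<in> hom (presented_group S R) (presented_group S' R')"
    and h': "h' \<in> hom (presented_group S' R') (presented_group S R)"
    and "\<And>x. x \<in> S \<Longrightarrow> h' (h (gen S R x)) = gen S R x"
    and "\<And>x. x \<in> S' \<Longrightarrow> h (h' (gen S' R' x)) = gen S' R' x"
  shows "presented_group S R \<cong> presented_group S' R'"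
proof -
  let ?P = "presented_group S R" and ?P' = "presented_group S' R'"
  have "h' \<circ> h \<in> hom ?P ?P" "h \<circ> h' \<in> hom ?P' ?P'"
    using h h' by (auto intro: Group.hom_compose)
  then have "\<forall>A\<in>carrier ?P. h' (h A) = A" "\<forall>A\<in>carrier ?P'. h (h' A) = A"
    using hom_eq_id_on_gen[of "h' \<circ> h"] hom_eq_id_on_gen[of "h \<circ> h'"] assms(3,4) by auto
  moreover have "h ` carrier ?P \<subseteq> carrier ?P'" "h' ` carrier ?P' \<subseteq> carrier ?P"
    using h h' by (auto simp: hom_def)
  ultimately have "bij_betw h (carrier ?P) (carrier ?P')"
    by (intro bij_betw_byWitness[of _ h'])
  then show ?thesis using h by (auto simp: is_iso_def iso_def)
qed

lemma hom_inv_group: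
  assumes "group G" "group H" "h \<in> hom G H" "g \<in> carrier G"
  shows "h (inv\<^bsub>G\<^esub> g) = inv\<^bsub>H\<^esub> (h g)"
proof -
  interpret group_hom G H h
    using assms by (simp add: group_hom_def group_hom_axioms_def)
  show ?thesis using assms by simp
qed

lemma hom_conjug:
  assumes "group G" "group H" "h \<in> hom G H" "g \<in> carrier G" "x \<in> carrier G"
  shows "h (group.conjug G g x) = group.conjug H (h g) (h x)"
proof -
  interpret group_hom G H h
    using assms by (simp add: group_hom_def group_hom_axioms_def)
  show ?thesis using assms by (simp add: G.conjug_def H.conjug_def)
qed

section \<open>The isomorphism given by one mutation\<close>

context finite_type_quiver
begin

lemma braid_family_gen:
  "group.braid_family (quiver_braid_group Q) (verts Q) (arrow Q) (gen (verts Q) (quiver_relations Q))"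
proof -
  let ?S = "verts Q" and ?R = "quiver_relations Q"
  have words: "u \<in> words ?S \<and> v \<in> words ?S" if "(u, v) \<in> ?R" for u v
  proof -
    have cw: "set (cycle_word c p) \<subseteq> ?S" if "chordless_cycle Q c" for c p
    proof -
      have "length c > 0" "set c \<subseteq> ?S" using that by (auto simp: chordless_cycle_def)
      then show ?thesis by (auto simp: cycle_word_def dest: nth_mem)
    qed
    show ?thesis using that unfolding quiver_relations_def by (auto dest: subsetD[OF cw])
  qed
  have "\<forall>(u, v)\<in>?R. word_eval (presented_group ?S ?R) (gen ?S ?R) u =
      word_eval (presented_group ?S ?R) (gen ?S ?R) v"
  proof clarify
    fix u v assume uv: "(u, v) \<in> ?R"
    show "word_eval (presented_group ?S ?R) (gen ?S ?R) u =
      word_eval (presented_group ?S ?R) (gen ?S ?R) v"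
      by (rule word_eval_gen_relation[OF uv]) (use words[OF uv] in simp_all)
  qed
  moreover have "gen ?S ?R \<in> ?S \<rightarrow> carrier (presented_group ?S ?R)"
    using gen_closed by (rule Pi_I)
  ultimately show ?thesis
    unfolding quiver_braid_group_def braid_family_iff[OF group_presented_group] by (rule conjI[rotated])
qed

lemma braid_family_hom:
  assumes "group G" "group.braid_family G (verts Q) (arrow Q) f"
  obtains h where "h \<in> hom (quiver_braid_group Q) G"
    "\<And>x. x \<in> verts Q \<Longrightarrow> h (gen (verts Q) (quiver_relations Q) x) = f x"
  using presented_group_hom_gen[OF assms(1), of f "verts Q" "quiver_relations Q"] assms
  unfolding quiver_braid_group_def braid_family_iff[OF assms(1)] by blast

text \<open>Arrows into \<open>k\<close> become arrows out of \<open>k\<close>, so of the two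
  successive mutations of families exactly one conjugates a given neighbour of \<open>k\<close>; all
  other generators commute with that of \<open>k\<close>. The composite is therefore one and the
  same conjugation on all generators, which the family \<open>u\<close> compensates.\<close>

lemma braid_group_mutate:
  assumes kV: "k \<in> verts Q"
  shows "quiver_braid_group (mutate k Q) \<cong> quiver_braid_group Q"
proof -
  let ?Q' = "mutate k Q" and ?V = "verts Q" and ?E = "arrow Q"
  interpret Q': finite_type_quiver ?Q' using finite_type_quiver_mutate[OF kV] .
  have E': "arrow ?Q' = mut k ?E" by (rule arrow_mutate)
  have E'k: "arrow ?Q' i k \<longleftrightarrow> ?E k i" for i unfolding E' by (rule mut_k)
  define G where "G = quiver_braid_group Q"
  define G' where "G' = quiver_braid_group ?Q'"
  have gG: "group G" "group G'"
    by (simp_all add: G_def G'_def quiver_braid_group_def group_presented_group)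
  interpret G: group G by fact
  interpret G': group G' by fact
  define s where "s = gen ?V (quiver_relations Q)"
  define s' where "s' = gen ?V (quiver_relations ?Q')"
  have fs: "G.braid_family ?V ?E s" unfolding G_def s_def by (rule braid_family_gen)
  have fs': "G'.braid_family ?V (mut k ?E) s'"
    using Q'.braid_family_gen unfolding G'_def s'_def E' by simp
  have sc: "s i \<in> carrier G" "s' i \<in> carrier G'" if "i \<in> ?V" for i
    using that fs fs' by (auto simp: G.braid_family_def G'.braid_family_def
        intro: G.artin_family_closed G'.artin_family_closed)
  let ?K = "inv\<^bsub>G\<^esub> s k" and ?K' = "inv\<^bsub>G'\<^esub> s' k"
  define t where "t i = (if ?E i k then G.conjug ?K (s i) else s i)" for i
  define t' where "t' i = (if ?E k i then G'.conjug ?K' (s' i) else s' i)" for i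
  \<comment> \<open>Without this conjugation the two homomorphisms would compose to inner automorphisms.\<close>
  define u where "u i = G'.conjug (s' k) (t' i)" for i
  have "G.braid_family ?V (arrow ?Q') t"
    unfolding E' t_def by (rule braid_family_mut[OF gG(1) kV fs])
  then obtain \<phi> where \<phi>: "\<phi> \<in> hom G' G" "\<And>i. i \<in> ?V \<Longrightarrow> \<phi> (s' i) = t i"
    using Q'.braid_family_hom[OF gG(1), of t] unfolding G'_def s'_def by (metis verts_mutate)
  have "G'.braid_family ?V (mut k (mut k ?E)) t'"
    using finite_type.braid_family_mut[OF Q'.finite_type_axioms gG(2), of k s'] kV fs'
    unfolding t'_def by (simp add: E' mut_k)
  then have "G'.braid_family ?V ?E u"
    unfolding u_def mut_mut by (rule G'.braid_family_conjug) (use sc kV in simp)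
  then obtain \<psi> where \<psi>: "\<psi> \<in> hom G G'" "\<And>i. i \<in> ?V \<Longrightarrow> \<psi> (s i) = u i"
    using braid_family_hom[OF gG(2), of u] unfolding G_def s_def by metis
  note c\<phi> = hom_conjug[OF gG(2,1) \<phi>(1)] and c\<psi> = hom_conjug[OF gG \<psi>(1)]
  have kk: "\<not> ?E k k" by (rule not_arrow_refl)
  have tk: "t k = s k" "t' k = s' k" using kk by (simp_all add: t_def t'_def)
  have uk: "u k = s' k" using sc[OF kV] by (simp add: u_def tk G'.conjug_def G'.m_assoc)
  have K: "\<phi> ?K' = ?K" "\<psi> ?K = ?K'"
    using hom_inv_group[OF gG(2,1) \<phi>(1), of "s' k"] hom_inv_group[OF gG \<psi>(1), of "s k"]
      sc \<phi>(2) \<psi>(2) kV tk uk by simp_all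
  have com: "G.conjug (s k) (s i) = s i" "G'.conjug (s' k) (s' i) = s' i"
    if "i \<in> ?V" "\<not> ?E i k" "\<not> ?E k i" for i
  proof -
    have "\<not> adj ?E k i" "\<not> adj (mut k ?E) k i" using that adj_mut_k(1)[of k i] by (simp_all add: adj_def)
    then have "G.commutes (s k) (s i)" "G'.commutes (s' k) (s' i)"
      using fs fs' that kV by (auto simp: G.braid_family_def G.artin_family_def
          G'.braid_family_def G'.artin_family_def)
    then show "G.conjug (s k) (s i) = s i" "G'.conjug (s' k) (s' i) = s' i"
      using G.commutes_iff_conjug G'.commutes_iff_conjug sc that kV by auto
  qed
  have t'c: "t' i \<in> carrier G'" "t i \<in> carrier G" if "i \<in> ?V" for i
    using sc that kV by (auto simp: t'_def t_def)
  have "\<phi> (u i) = s i" if i: "i \<in> ?V" for i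
  proof -
    have 1: "\<phi> (u i) = G.conjug (s k) (\<phi> (t' i))"
      unfolding u_def using c\<phi>[of "s' k" "t' i"] sc kV t'c i \<phi>(2) tk by simp
    consider "?E k i" "\<not> ?E i k" | "?E i k" "\<not> ?E k i" | "\<not> ?E i k" "\<not> ?E k i"
      using arrow_asym by blast
    then show ?thesis
    proof cases
      case 1
      then have "\<phi> (t' i) = G.conjug ?K (s i)"
        using c\<phi>[of ?K' "s' i"] K sc kV i \<phi>(2) by (simp add: t'_def t_def)
      then show ?thesis unfolding \<open>\<phi> (u i) = _\<close> using sc kV i by simp
    next
      case 2
      then have "\<phi> (t' i) = G.conjug ?K (s i)" using i \<phi>(2) by (simp add: t'_def t_def)
      then show ?thesis unfolding \<open>\<phi> (u i) = _\<close> using sc kV i by simp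
    next
      case 3
      then have "\<phi> (t' i) = s i" using i \<phi>(2) by (simp add: t'_def t_def)
      then show ?thesis unfolding \<open>\<phi> (u i) = _\<close> using com i 3 by simp
    qed
  qed
  moreover have "\<psi> (t i) = s' i" if i: "i \<in> ?V" for i
  proof -
    consider "?E k i" "\<not> ?E i k" | "?E i k" "\<not> ?E k i" | "\<not> ?E i k" "\<not> ?E k i"
      using arrow_asym by blast
    then show ?thesis
    proof cases
      case 1
      then have "\<psi> (t i) = G'.conjug (s' k) (G'.conjug ?K' (s' i))"
        using i \<psi>(2) by (simp add: t_def u_def t'_def)
      then show ?thesis using sc kV i by simp
    next
      case 2
      then have "\<psi> (t i) = G'.conjug ?K' (u i)"
        using c\<psi>[of ?K "s i"] K sc kV i \<psi>(2) by (simp add: t_def)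
      then show ?thesis using 2 sc kV i by (simp add: u_def t'_def)
    next
      case 3
      then show ?thesis using com(2)[of i] i \<psi>(2) by (simp add: t_def u_def t'_def)
    qed
  qed
  ultimately show ?thesis
    unfolding quiver_braid_group_def verts_mutate
    using \<phi> \<psi> unfolding G_def G'_def s_def s'_def quiver_braid_group_def verts_mutate
    by (intro presented_group_isoI[of \<phi> _ _ _ _ \<psi>]) auto
qed

end

lemma fold_mutate:
  "finite_type_quiver Q \<Longrightarrow> set ks \<subseteq> verts Q \<Longrightarrow>
    quiver_braid_group (fold mutate ks Q) \<cong> quiver_braid_group Q"
proof (induction ks arbitrary: Q)
  case Nil
  then show ?case by (simp add: iso_refl)
next
  case (Cons k ks)
  interpret finite_type_quiver Q by fact
  have k: "k \<in> verts Q" "set ks \<subseteq> verts (mutate k Q)" using Cons.prems by auto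
  have "quiver_braid_group (fold mutate ks (mutate k Q)) \<cong> quiver_braid_group (mutate k Q)"
    using finite_type_quiver_mutate[OF k(1)] k(2) by (rule Cons.IH)
  from iso_trans[OF this braid_group_mutate[OF k(1)]] show ?case by simp
qed

section \<open>Dynkin quivers\<close>

definition tree_form :: "('v \<Rightarrow> 'v \<Rightarrow> bool) \<Rightarrow> 'v \<Rightarrow> 'v \<Rightarrow> real" where
  "tree_form R i j = (if i = j then 2 else if R i j then -1 else 0)"

text \<open>The bound at the root \<open>r\<close> is what makes gluing trees at their roots possible.\<close>

definition rooted_pos :: "('v \<Rightarrow> 'v \<Rightarrow> bool) \<Rightarrow> 'v set \<Rightarrow> 'v \<Rightarrow> real \<Rightarrow> bool" where
  "rooted_pos R V r c \<longleftrightarrow> finite V \<and> r \<in> V \<and> c > 0 \<and>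
     (\<forall>x. form V (tree_form R) x \<ge> c * (x r)\<^sup>2) \<and>
     (\<forall>x. (\<exists>i\<in>V. x i \<noteq> 0) \<longrightarrow> form V (tree_form R) x > 0)"

lemma rooted_pos_singleton: "rooted_pos R {v} v 2"
  by (auto simp: rooted_pos_def form_def tree_form_def power2_eq_square zero_less_mult_iff linorder_neq_iff)

lemma form_Un:
  assumes "finite V" "finite W" "V \<inter> W = {}" "\<And>i j. A i j = A j i"
  shows "form (V \<union> W) A x = form V A x + form W A x + 2 * (\<Sum>i\<in>V. \<Sum>j\<in>W. A i j * x i * x j)"
proof -
  have "(\<Sum>i\<in>W. \<Sum>j\<in>V. A i j * x i * x j) = (\<Sum>j\<in>V. \<Sum>i\<in>W. A i j * x i * x j)"
    by (rule sum.swap)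
  also have "\<dots> = (\<Sum>i\<in>V. \<Sum>j\<in>W. A i j * x i * x j)"
  proof (intro sum.cong refl)
    show "A j i * x j * x i = A i j * x i * x j" for i j
      unfolding assms(4)[of j i] by (simp only: mult_ac)
  qed
  finally show ?thesis
    unfolding form_def using assms by (simp add: sum.union_disjoint sum.distrib algebra_simps)
qed

text \<open>The joining edge contributes the cross term -2 \<open>x r * x s\<close>. Completing the
  square with the bound \<open>c\<close> at \<open>r\<close> costs 1/c of the bound \<open>d\<close>
  at \<open>s\<close>. When \<open>x s\<close> is zero the cross term vanishes, and strict
  positivity comes from one of the two parts.\<close>

lemma rooted_pos_glue:
  assumes V: "rooted_pos R V r c" and W: "rooted_pos R W s d" and dis: "V \<inter> W = {}" and "symp R"
    and R: "\<And>i j. i \<in> V \<Longrightarrow> j \<in> W \<Longrightarrow> R i j \<longleftrightarrow> i = r \<and> j = s"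
    and e: "e = d - 1 / c" "e > 0"
  shows "rooted_pos R (V \<union> W) s e"
proof -
  let ?A = "tree_form R"
  have c: "c > 0" "d > 0" using V W by (auto simp: rooted_pos_def)
  have fin: "finite V" "finite W" "r \<in> V" "s \<in> W" using V W by (auto simp: rooted_pos_def)
  have sym: "?A i j = ?A j i" for i j using \<open>symp R\<close> by (auto simp: tree_form_def symp_def)
  have "(\<Sum>i\<in>V. \<Sum>j\<in>W. ?A i j * x i * x j) = - x r * x s" for x
  proof -
    have "(\<Sum>i\<in>V. \<Sum>j\<in>W. ?A i j * x i * x j) = (\<Sum>i\<in>V. \<Sum>j\<in>W. if i = r then if j = s then - x r * x s else 0 else 0)"
      using R dis by (intro sum.cong refl) (auto simp: tree_form_def)
    also have "\<dots> = (\<Sum>i\<in>V. if i = r then - x r * x s else 0)"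
      using fin by (intro sum.cong refl) simp
    also have "\<dots> = - x r * x s" using fin by simp
    finally show ?thesis .
  qed
  then have f: "form (V \<union> W) ?A x = form V ?A x + form W ?A x - 2 * (x r * x s)" for x
    using form_Un[OF fin(1,2) dis sym, where x = x] by simp
  have sq: "c * (x r)\<^sup>2 - 2 * (x r * x s) + 1 / c * (x s)\<^sup>2 = c * (x r - x s / c)\<^sup>2" for x :: "'a \<Rightarrow> real"
    using c by (simp add: power2_eq_square field_simps)
  have lower: "form V ?A x + form W ?A x - 2 * (x r * x s) \<ge>
      (form W ?A x - d * (x s)\<^sup>2) + (form V ?A x - c * (x r)\<^sup>2) + e * (x s)\<^sup>2" for x
  proof -
    have "c * (x r - x s / c)\<^sup>2 \<ge> 0" using c by simp
    moreover have "d * (x s)\<^sup>2 = e * (x s)\<^sup>2 + 1 / c * (x s)\<^sup>2"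
      unfolding e(1) by (simp add: left_diff_distrib)
    ultimately show ?thesis using sq[of x] by linarith
  qed
  have Vc: "form V ?A x \<ge> c * (x r)\<^sup>2" and Wd: "form W ?A x \<ge> d * (x s)\<^sup>2" for x
    using V W by (auto simp: rooted_pos_def)
  have "form (V \<union> W) ?A x \<ge> e * (x s)\<^sup>2" for x
    using lower[of x] Vc[of x] Wd[of x] f[of x] by linarith
  moreover have "form (V \<union> W) ?A x > 0" if "\<exists>i\<in>V \<union> W. x i \<noteq> 0" for x
  proof (cases "x s = 0")
    case False
    then have "e * (x s)\<^sup>2 > 0" using e by simp
    then show ?thesis using calculation[of x] by linarith
  next
    case True
    have V0: "form V ?A x \<ge> 0" "form W ?A x \<ge> 0"
      using Vc[of x] Wd[of x] c by (meson mult_nonneg_nonneg less_imp_le order_trans zero_le_power2)+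
    have "form V ?A x > 0 \<or> form W ?A x > 0" using that V W by (auto simp: rooted_pos_def)
    then show ?thesis using f[of x] True V0 by auto
  qed
  ultimately show ?thesis using e fin by (simp add: rooted_pos_def)
qed

section \<open>Positivity of the Dynkin diagrams\<close>

abbreviation dynkin_adj :: "dynkin_type \<Rightarrow> nat \<Rightarrow> nat \<Rightarrow> bool" where
  "dynkin_adj T i j \<equiv> {i, j} \<in> dynkin_edges T"

lemma symp_dynkin_adj: "symp (dynkin_adj T)"
  by (simp add: symp_def insert_commute)

lemma dynkin_adj_A:
  "dynkin_adj (Dynkin_A m) i j \<longleftrightarrow>
    (1 \<le> i \<and> j = i + 1 \<and> j \<le> m) \<or> (1 \<le> j \<and> i = j + 1 \<and> i \<le> m)"
  by (auto simp: doubleton_eq_iff)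

lemma dynkin_adj_D:
  "dynkin_adj (Dynkin_D m) i j \<longleftrightarrow>
    (1 \<le> i \<and> j = i + 1 \<and> j \<le> m - 1) \<or> (1 \<le> j \<and> i = j + 1 \<and> i \<le> m - 1) \<or>
    (i = m - 2 \<and> j = m) \<or> (j = m - 2 \<and> i = m)"
  by (auto simp: doubleton_eq_iff)

lemma dynkin_adj_E:
  "dynkin_adj (Dynkin_E m) i j \<longleftrightarrow>
    (3 \<le> i \<and> j = i + 1 \<and> j \<le> m) \<or> (3 \<le> j \<and> i = j + 1 \<and> i \<le> m) \<or>
    (i = 1 \<and> j = 3) \<or> (j = 1 \<and> i = 3) \<or> (i = 2 \<and> j = 4) \<or> (j = 2 \<and> i = 4)"
  by (auto simp: doubleton_eq_iff)

text \<open>The constants solve the recursion c' = 2 - 1/c starting from 2. They are the quotients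
  of consecutive determinants l + 1 and l of the Cartan matrices of type A.\<close>

lemma rooted_pos_induced_path:
  assumes "symp R"
  shows "induced_path R l \<Longrightarrow> l \<noteq> [] \<Longrightarrow>
    rooted_pos R (set l) (hd l) ((real (length l) + 1) / real (length l))"
proof (induction l)
  case (Cons x ys)
  show ?case
  proof (cases "ys = []")
    case True
    then show ?thesis using rooted_pos_singleton[of R x] by simp
  next
    case False
    then have "length ys > 0" by simp
    then have l: "real (length ys) > 0" by simp
    have "rooted_pos R (set ys \<union> {x}) x ((real (length (x # ys)) + 1) / real (length (x # ys)))"
    proof (rule rooted_pos_glue[OF _ rooted_pos_singleton _ assms])
      show "rooted_pos R (set ys) (hd ys) ((real (length ys) + 1) / real (length ys))"
        using Cons False by simp
      show "(real (length (x # ys)) + 1) / real (length (x # ys))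
          = 2 - 1 / ((real (length ys) + 1) / real (length ys))"
        using l by (simp add: field_simps)
      show "R i j \<longleftrightarrow> i = hd ys \<and> j = x" if "i \<in> set ys" "j \<in> {x}" for i j
        using that Cons.prems assms by (auto simp: symp_def)
    qed (use Cons.prems l in \<open>auto simp: field_simps\<close>)
    then show ?thesis by simp
  qed
qed simp

lemma induced_path_upt:
  assumes "\<And>i j. a \<le> i \<Longrightarrow> i < j \<Longrightarrow> j < b \<Longrightarrow> R i j \<longleftrightarrow> j = Suc i"
  shows "induced_path R [a..<b]"
  using assms by (simp add: induced_path_nth)

lemma rooted_pos_upt:
  assumes "symp R" "1 \<le> m" "\<And>i j. 1 \<le> i \<Longrightarrow> i < j \<Longrightarrow> j \<le> m \<Longrightarrow> R i j \<longleftrightarrow> j = Suc i"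
  shows "rooted_pos R {1..m} m ((real m + 1) / real m)"
proof -
  have "induced_path R (rev [1..<Suc m])"
    using assms by (simp add: induced_path_rev induced_path_upt del: upt_Suc)
  moreover have "rev [1..<Suc m] \<noteq> []" "hd (rev [1..<Suc m]) = m" using assms by simp_all
  ultimately have "rooted_pos R (set (rev [1..<Suc m])) m
      ((real (length (rev [1..<Suc m])) + 1) / real (length (rev [1..<Suc m])))"
    using rooted_pos_induced_path[OF assms(1), of "rev [1..<Suc m]"] by simp
  moreover have "set (rev [1..<Suc m]) = {1..m}" "length (rev [1..<Suc m]) = m" by auto
  ultimately show ?thesis by simp
qed

lemma ex_rooted_pos:
  assumes "is_dynkin_type T"
  shows "\<exists>r c. rooted_pos (dynkin_adj T) (dynkin_verts T) r c"
proof (cases T)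
  case (Dynkin_A m)
  have "rooted_pos (dynkin_adj T) {1..m} m ((real m + 1) / real m)"
    using assms Dynkin_A by (intro rooted_pos_upt symp_dynkin_adj) (auto simp: dynkin_adj_A simp del: dynkin_edges.simps)
  then show ?thesis using Dynkin_A by (auto simp: dynkin_verts_def)
next
  case (Dynkin_D m)
  let ?R = "dynkin_adj T"
  have m: "m \<ge> 4" using assms Dynkin_D by simp
  note glue = rooted_pos_glue[OF _ _ _ symp_dynkin_adj]
  have 1: "rooted_pos ?R {1..m-2} (m-2) ((real (m-2) + 1) / real (m-2))"
    using m Dynkin_D by (intro rooted_pos_upt symp_dynkin_adj) (auto simp: dynkin_adj_D simp del: dynkin_edges.simps)
  have 2: "rooted_pos ?R ({m-1} \<union> {1..m-2}) (m-2) ((real (m-2) + 1) / real (m-2) - 1 / 2)"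
    by (rule glue[OF rooted_pos_singleton 1])
      (use m Dynkin_D in \<open>auto simp: dynkin_adj_D field_simps simp del: dynkin_edges.simps\<close>)
  \<comment> \<open>Each of the two leaves at the branch vertex \<open>m - 2\<close> costs 1/2; what
    remains is 1/(m - 2), which is positive.\<close>
  have 3: "rooted_pos ?R ({m} \<union> ({m-1} \<union> {1..m-2})) (m-2) ((real (m-2) + 1) / real (m-2) - 1 / 2 - 1 / 2)"
    by (rule glue[OF rooted_pos_singleton 2])
      (use m Dynkin_D in \<open>auto simp: dynkin_adj_D field_simps simp del: dynkin_edges.simps\<close>)
  moreover have "{m} \<union> ({m-1} \<union> {1..m-2}) = dynkin_verts T" using m Dynkin_D by (auto simp: dynkin_verts_def)
  ultimately show ?thesis by metis
next
  case (Dynkin_E m)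
  let ?R = "dynkin_adj T"
  have m: "m = 6 \<or> m = 7 \<or> m = 8" using assms Dynkin_E by auto
  note glue = rooted_pos_glue[OF _ _ _ symp_dynkin_adj]
  have R: "?R i j \<longleftrightarrow>
      (3 \<le> i \<and> j = i + 1 \<and> j \<le> m) \<or> (3 \<le> j \<and> i = j + 1 \<and> i \<le> m) \<or>
      (i = 1 \<and> j = 3) \<or> (j = 1 \<and> i = 3) \<or> (i = 2 \<and> j = 4) \<or> (j = 2 \<and> i = 4)" for i j
    unfolding Dynkin_E by (rule dynkin_adj_E)
  have R': "?R 1 3" "?R 2 4" "?R 3 4" "\<not> ?R 1 4" "\<not> ?R 2 1" "\<not> ?R 2 3" unfolding R using m by auto
  \<comment> \<open>The root is moved to the branch vertex 4: the arm 1, 3, 4 leaves 2 - 1/2 = 3/2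
    and then 2 - 2/3 = 4/3, and the leaf 2 reduces this to 5/6.\<close>
  have 1: "rooted_pos ?R ({1} \<union> {3}) 3 (3/2)"
    by (rule glue[OF rooted_pos_singleton rooted_pos_singleton]) (use R' in auto)
  have 2: "rooted_pos ?R (({1} \<union> {3}) \<union> {4}) 4 (4/3)"
    by (rule glue[OF 1 rooted_pos_singleton]) (use R' in auto)
  have 3: "rooted_pos ?R ({2} \<union> (({1} \<union> {3}) \<union> {4})) 4 (5/6)"
    by (rule glue[OF rooted_pos_singleton 2]) (use R' in auto)
  have "induced_path ?R [5..<Suc m]" by (rule induced_path_upt) (unfold R, auto)
  moreover have "[5..<Suc m] \<noteq> []" "hd [5..<Suc m] = 5" using m by (auto simp: hd_upt)
  ultimately have 4: "rooted_pos ?R (set [5..<Suc m]) 5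
      ((real (length [5..<Suc m]) + 1) / real (length [5..<Suc m]))"
    using rooted_pos_induced_path[OF symp_dynkin_adj, of T "[5..<Suc m]"] by simp
  have "\<exists>e. rooted_pos ?R (set [5..<Suc m] \<union> ({2} \<union> (({1} \<union> {3}) \<union> {4}))) 4 e"
  proof (intro exI, rule glue[OF 4 3])
    show "?R i j \<longleftrightarrow> i = 5 \<and> j = 4"
      if "i \<in> set [5..<Suc m]" "j \<in> {2} \<union> (({1} \<union> {3}) \<union> {4})" for i j
    proof -
      have "5 \<le> i" "i \<le> m" "j = 1 \<or> j = 2 \<or> j = 3 \<or> j = 4" using that by auto
      then show ?thesis unfolding R by (elim disjE) auto
    qed
    \<comment> \<open>The tail has m - 4 vertices, so the bound is 5/6 - (m - 4)/(m - 3). It would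
      reach 0 at m = 9, the affine diagram extending E8.\<close>
    show "5 / 6 - 1 / ((real (length [5..<Suc m]) + 1) / real (length [5..<Suc m])) > 0"
      using m by (elim disjE) (simp_all del: upt_Suc)
  qed (auto simp del: upt_Suc)
  moreover have "set [5..<Suc m] \<union> ({2} \<union> (({1} \<union> {3}) \<union> {4})) = dynkin_verts T"
    using m Dynkin_E by (auto simp: dynkin_verts_def)
  ultimately show ?thesis by metis
qed

text \<open>All factors of \<open>edge_prod\<close> are non-negative here, but around a cycle it is \<open>-1\<close>.\<close>

lemma no_induced_cycle:
  assumes "finite V" "companion V R A" "\<And>i j. i \<noteq> j \<Longrightarrow> A i j \<le> 0" "set c \<subseteq> V"
  shows "\<not> induced_cycle R c"
proof
  assume c: "induced_cycle R c"
  then obtain x ys where x: "c = x # ys" by (cases c) auto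
  have "edge_prod A l \<ge> 0" if "distinct_adj l" for l
    using that
  proof (induction l)
    case (Cons y ys)
    then show ?case using assms(3)[of y "hd ys"]
      by (auto simp: distinct_adj_Cons intro!: mult_nonpos_nonneg)
  qed simp
  moreover have "distinct_adj (x # ys @ [x])"
  proof -
    have "distinct c" "ys \<noteq> []" using induced_cycle_distinct[OF c] c x by auto
    moreover from this(1) have "distinct_adj c"
      by (simp add: distinct_adj_conv_nth nth_eq_iff_index_eq)
    moreover have "last ys \<noteq> x" using calculation x by auto
    ultimately show ?thesis using x by (simp add: distinct_adj_Cons distinct_adj_append_iff)
  qed
  moreover have "edge_prod A (x # ys @ [x]) = -1"
    using edge_prod_induced_cycle[OF assms(1,2)] c x assms(4) by blast
  ultimately show False by fastforce
qed

lemma dynkin_quiver_no_cycle: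
  assumes T: "is_dynkin_type T" and Q: "dynkin_quiver T Q"
  shows "\<exists>A. companion (verts Q) (adj (arrow Q)) A"
    and "set c \<subseteq> verts Q \<Longrightarrow> \<not> induced_cycle (adj (arrow Q)) c"
proof -
  let ?V = "verts Q"
  obtain f where f: "bij_betw f ?V (dynkin_verts T)"
    and arr: "\<forall>i\<in>?V. \<forall>j\<in>?V. arr Q i j + arr Q j i = (if dynkin_adj T (f i) (f j) then 1 else 0)"
    using Q by (auto simp: dynkin_quiver_def)
  have fin: "finite ?V" and supp: "\<And>i j. arr Q i j \<noteq> 0 \<Longrightarrow> i \<in> ?V \<and> j \<in> ?V"
    using Q by (auto simp: dynkin_quiver_def is_quiver_def)
  have adj: "adj (arrow Q) i j \<longleftrightarrow> dynkin_adj T (f i) (f j)" if "i \<in> ?V" "j \<in> ?V" for i j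
    using arr[rule_format, OF that] by (auto simp: adj_def arrow_def split: if_splits) 
  define A :: "'a \<Rightarrow> 'a \<Rightarrow> int" where
    "A i j = (if i = j then 2 else if adj (arrow Q) i j then -1 else 0)" for i j
  obtain r e where rp: "rooted_pos (dynkin_adj T) (dynkin_verts T) r e"
    using ex_rooted_pos[OF T] by blast
  have pos: "form ?V A x > 0" if x: "\<exists>i\<in>?V. x i \<noteq> 0" for x
  proof -
    \<comment> \<open>The integer vector on the vertices of \<open>Q\<close>, transported to the
      standard diagram and read over the reals, where \<open>rooted_pos\<close> applies.\<close>
    define y where "y j = real_of_int (x (inv_into ?V f j))" for j
    have yf: "y (f i) = x i" if "i \<in> ?V" for i
      using f that by (simp add: y_def bij_betw_def)
    have "form (dynkin_verts T) (tree_form (dynkin_adj T)) y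
        = (\<Sum>i\<in>?V. \<Sum>j\<in>?V. tree_form (dynkin_adj T) (f i) (f j) * y (f i) * y (f j))"
      unfolding form_def by (simp add: sum.reindex_bij_betw[OF f, symmetric])
    also have "\<dots> = (\<Sum>i\<in>?V. \<Sum>j\<in>?V. real_of_int (A i j * x i * x j))"
    proof (intro sum.cong refl)
      fix i j assume ij: "i \<in> ?V" "j \<in> ?V"
      have "f i = f j \<longleftrightarrow> i = j" using f ij by (auto simp: bij_betw_def dest: inj_onD)
      then have "tree_form (dynkin_adj T) (f i) (f j) = A i j"
        using adj[OF ij] by (simp add: tree_form_def A_def)
      then show "tree_form (dynkin_adj T) (f i) (f j) * y (f i) * y (f j) = real_of_int (A i j * x i * x j)"
        using yf ij by simp
    qed
    finally have "form (dynkin_verts T) (tree_form (dynkin_adj T)) y = real_of_int (form ?V A x)"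
      by (simp add: form_def)
    moreover have "\<exists>j\<in>dynkin_verts T. y j \<noteq> 0"
      using x yf f by (metis bij_betwE of_int_eq_0_iff)
    ultimately show ?thesis using rp by (auto simp: rooted_pos_def)
  qed
  have comp: "companion ?V (adj (arrow Q)) A"
    using pos by (auto simp: companion_def A_def adj_def)
  then show "\<exists>A. companion ?V (adj (arrow Q)) A" by blast
  show "\<not> induced_cycle (adj (arrow Q)) c" if "set c \<subseteq> ?V"
    using no_induced_cycle[OF fin comp _ that] by (simp add: A_def)
qed

text \<open>The orientation condition holds vacuously, as a Dynkin diagram has no cycles at
  all.\<close>

lemma finite_type_dynkin_quiver:
  assumes T: "is_dynkin_type T" and Q: "dynkin_quiver T Q"
  shows "finite_type_quiver Q"
proof -
  obtain f where f: "bij_betw f (verts Q) (dynkin_verts T)"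
    and arr: "\<forall>i\<in>verts Q. \<forall>j\<in>verts Q. arr Q i j + arr Q j i = (if dynkin_adj T (f i) (f j) then 1 else 0)"
    using Q by (auto simp: dynkin_quiver_def)
  have q: "finite (verts Q)" "\<And>i j. arr Q i j \<noteq> 0 \<Longrightarrow> i \<in> verts Q \<and> j \<in> verts Q"
      "\<And>i j. arr Q i j = 0 \<or> arr Q j i = 0"
    using Q by (auto simp: dynkin_quiver_def is_quiver_def)
  \<comment> \<open>\<open>induced_cycle\<close> does not mention the vertex set, but each vertex of
    a cycle is the end of an arrow.\<close>
  have supp: "set c \<subseteq> verts Q" if c: "induced_cycle (adj (arrow Q)) c" for c
  proof
    fix z assume "z \<in> set c"
    then obtain n zs where "rotate n c = z # zs" using rotate_to_head by metis
    then have "induced_cycle (adj (arrow Q)) (z # zs)"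
      using induced_cycle_rotate[OF symp_adj c, of n] by simp
    then have "adj (arrow Q) z (hd zs)" by (cases zs) auto
    then show "z \<in> verts Q" using q(2) by (auto simp: adj_def arrow_def)
  qed
  show ?thesis
  proof
    show "arr Q i j \<le> 1" for i j
    proof (cases "arr Q i j = 0")
      case False
      then have "arr Q i j + arr Q j i \<le> 1" using arr q(2) by auto
      then show ?thesis by simp
    qed simp
    show "\<exists>A. companion (verts Q) (adj (arrow Q)) A"
      by (rule dynkin_quiver_no_cycle(1)[OF T Q])
    show "cyclic (arrow Q) c \<or> cyclic (arrow Q) (rev c)" if "induced_cycle (adj (arrow Q)) c" for c
      using dynkin_quiver_no_cycle(2)[OF T Q supp[OF that]] that by blast
    show "\<not> arrow Q j i" if "arrow Q i j" for i j using q(3)[of i j] that by (auto simp: arrow_def)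
  qed (use q(1,2) in \<open>auto simp: arrow_def\<close>)
qed

section \<open>The braid group of a Dynkin quiver\<close>

lemma (in group) artin_family_iff:
  "artin_family W (\<lambda>i j. {i, j} \<in> D) f \<longleftrightarrow>
    f \<in> W \<rightarrow> carrier G \<and> (\<forall>(u, v)\<in>artin_relations W D. word_eval G f u = word_eval G f v)"
proof (cases "f \<in> W \<rightarrow> carrier G")
  case True
  then have cl: "f i \<in> carrier G" if "i \<in> W" for i using that by auto
  have comm: "word_eval G f (pos_word [i, j]) = word_eval G f (pos_word [j, i]) \<longleftrightarrow>
      commutes (f i) (f j)" if "i \<in> W" "j \<in> W" for i j
    using cl that by (simp add: word_eval_def commutes_def)
  have braid: "word_eval G f (pos_word [i, j, i]) = word_eval G f (pos_word [j, i, j]) \<longleftrightarrow>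
      braids (f i) (f j)" if "i \<in> W" "j \<in> W" for i j
    using cl that by (simp add: word_eval_def braids_def m_assoc)
  have "(\<forall>(u, v)\<in>artin_relations W D. word_eval G f u = word_eval G f v) \<longleftrightarrow>
    (\<forall>i\<in>W. \<forall>j\<in>W. {i, j} \<notin> D \<longrightarrow>
      word_eval G f (pos_word [i, j]) = word_eval G f (pos_word [j, i])) \<and>
    (\<forall>i\<in>W. \<forall>j\<in>W. {i, j} \<in> D \<longrightarrow>
      word_eval G f (pos_word [i, j, i]) = word_eval G f (pos_word [j, i, j]))"
    unfolding artin_relations_def by fast
  also have "\<dots> \<longleftrightarrow> (\<forall>i\<in>W. \<forall>j\<in>W. if {i, j} \<in> D then braids (f i) (f j) else commutes (f i) (f j))"
  proof -
    have "(\<forall>i\<in>W. \<forall>j\<in>W. {i, j} \<notin> D \<longrightarrow>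
        word_eval G f (pos_word [i, j]) = word_eval G f (pos_word [j, i])) \<longleftrightarrow>
      (\<forall>i\<in>W. \<forall>j\<in>W. {i, j} \<notin> D \<longrightarrow> commutes (f i) (f j))"
      by (intro ball_cong refl imp_cong comm)
    moreover have "(\<forall>i\<in>W. \<forall>j\<in>W. {i, j} \<in> D \<longrightarrow>
        word_eval G f (pos_word [i, j, i]) = word_eval G f (pos_word [j, i, j])) \<longleftrightarrow>
      (\<forall>i\<in>W. \<forall>j\<in>W. {i, j} \<in> D \<longrightarrow> braids (f i) (f j))"
      by (intro ball_cong refl imp_cong braid)
    ultimately show ?thesis by auto
  qed
  finally show ?thesis using True by (simp add: artin_family_def)
qed (simp add: artin_family_def)

lemma artin_family_gen:
  "group.artin_family (artin_braid_group W D) W (\<lambda>i j. {i, j} \<in> D) (gen W (artin_relations W D))"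
  unfolding artin_braid_group_def group.artin_family_iff[OF group_presented_group]
proof (intro conjI Pi_I)
  show "\<forall>(u, v)\<in>artin_relations W D.
      word_eval (presented_group W (artin_relations W D)) (gen W (artin_relations W D)) u =
      word_eval (presented_group W (artin_relations W D)) (gen W (artin_relations W D)) v"
  proof clarify
    fix u v assume uv: "(u, v) \<in> artin_relations W D"
    then have "u \<in> words W" "v \<in> words W" by (auto simp: artin_relations_def)
    then show "word_eval (presented_group W (artin_relations W D)) (gen W (artin_relations W D)) u =
        word_eval (presented_group W (artin_relations W D)) (gen W (artin_relations W D)) v"
      by (rule word_eval_gen_relation[OF uv])
  qed
qed (rule gen_closed)

lemma (in group) artin_family_comp:
  assumes "artin_family W R' x" "\<And>i. i \<in> V \<Longrightarrow> f i \<in> W"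
    and "\<And>i j. i \<in> V \<Longrightarrow> j \<in> V \<Longrightarrow> R i j \<longleftrightarrow> R' (f i) (f j)"
  shows "artin_family V R (\<lambda>i. x (f i))"
  using assms by (auto simp: artin_family_def)

text \<open>In the absence of chordless cycles the two presentations differ only by the relabelling
  \<open>f\<close> of the generators, and the homomorphisms given by \<open>f\<close> and its
  inverse cancel on generators.\<close>

lemma dynkin_quiver_braid_group:
  assumes T: "is_dynkin_type T" and Q: "dynkin_quiver T Q"
  shows "quiver_braid_group Q \<cong> artin_braid_group (dynkin_verts T) (dynkin_edges T)"
proof -
  let ?V = "verts Q" and ?W = "dynkin_verts T" and ?D = "dynkin_edges T"
  let ?R = "quiver_relations Q" and ?R' = "artin_relations ?W ?D"
  obtain f where f: "bij_betw f ?V ?W"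
    and arr: "\<forall>i\<in>?V. \<forall>j\<in>?V. arr Q i j + arr Q j i = (if dynkin_adj T (f i) (f j) then 1 else 0)"
    using Q by (auto simp: dynkin_quiver_def)
  let ?g = "inv_into ?V f"
  have adj: "adj (arrow Q) i j \<longleftrightarrow> dynkin_adj T (f i) (f j)" if "i \<in> ?V" "j \<in> ?V" for i j
    using arr[rule_format, OF that] by (auto simp: adj_def arrow_def split: if_splits)
  have fg: "f (?g j) = j" if "j \<in> ?W" for j using f that by (rule bij_betw_inv_into_right)
  have gf: "?g (f i) = i" if "i \<in> ?V" for i using f that by (rule bij_betw_inv_into_left)
  have mem: "f i \<in> ?W" if "i \<in> ?V" for i using bij_betwE[OF f] that by blast
  have memg: "?g j \<in> ?V" if "j \<in> ?W" for j using bij_betwE[OF bij_betw_inv_into[OF f]] that by blast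
  interpret finite_type_quiver Q by (rule finite_type_dynkin_quiver[OF T Q])
  let ?P = "quiver_braid_group Q" and ?P' = "artin_braid_group ?W ?D"
  let ?s = "gen ?V ?R" and ?t = "gen ?W ?R'"
  have gP: "group ?P" "group ?P'"
    by (simp_all add: quiver_braid_group_def artin_braid_group_def group_presented_group)
  interpret P: group ?P by fact
  interpret P': group ?P' by fact
  have "P'.artin_family ?V (adj (arrow Q)) (\<lambda>i. ?t (f i))"
    by (rule P'.artin_family_comp[OF artin_family_gen mem adj])
  then have "P'.braid_family ?V (arrow Q) (\<lambda>i. ?t (f i))"
    using dynkin_quiver_no_cycle(2)[OF T Q] by (simp add: P'.braid_family_def)
  then obtain h where h: "h \<in> hom ?P ?P'" "\<And>i. i \<in> ?V \<Longrightarrow> h (?s i) = ?t (f i)"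
    using braid_family_hom[OF gP(2)] by metis
  have "P.artin_family ?V (adj (arrow Q)) ?s"
    using braid_family_gen by (simp add: P.braid_family_def)
  then have "P.artin_family ?W (\<lambda>i j. {i, j} \<in> ?D) (\<lambda>j. ?s (?g j))"
  proof (rule P.artin_family_comp)
    show "{i, j} \<in> ?D \<longleftrightarrow> adj (arrow Q) (?g i) (?g j)" if "i \<in> ?W" "j \<in> ?W" for i j
      by (simp only: adj[OF memg memg, OF that] fg[OF that(1)] fg[OF that(2)])
  qed (rule memg)
  then obtain h' where h': "h' \<in> hom ?P' ?P" "\<And>j. j \<in> ?W \<Longrightarrow> h' (?t j) = ?s (?g j)"
    unfolding P.artin_family_iff artin_braid_group_def
    using presented_group_hom_gen[OF gP(1), of "\<lambda>j. ?s (?g j)" ?W ?R'] by metis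
  show ?thesis
    unfolding quiver_braid_group_def artin_braid_group_def
  proof (rule presented_group_isoI)
    show "h \<in> hom (presented_group ?V ?R) (presented_group ?W ?R')"
      using h(1) by (simp only: quiver_braid_group_def artin_braid_group_def)
    show "h' \<in> hom (presented_group ?W ?R') (presented_group ?V ?R)"
      using h'(1) by (simp only: quiver_braid_group_def artin_braid_group_def)
  qed (simp_all only: h h' fg gf mem memg)
qed

theorem theoremA:
  fixes n :: nat and Q\<^sub>0 Q :: "nat quiver" and T :: dynkin_type and ks :: "nat list"
  assumes "is_dynkin_type T"
    and "dynkin_quiver T Q\<^sub>0"
    and "verts Q\<^sub>0 = {1..n}"
    and "set ks \<subseteq> {1..n}"
    and "Q = fold mutate ks Q\<^sub>0"
  shows "quiver_braid_group Q \<cong> artin_braid_group (dynkin_verts T) (dynkin_edges T)"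
proof -
  have "quiver_braid_group Q \<cong> quiver_braid_group Q\<^sub>0"
    unfolding assms(5) using assms(3,4)
    by (intro fold_mutate finite_type_dynkin_quiver[OF assms(1,2)]) simp
  then show ?thesis by (rule iso_trans[OF _ dynkin_quiver_braid_group[OF assms(1,2)]])
qed

end
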